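(* Let $p$ be a prime, $W$ a $p$-adically complete ring and $R=W[[q-1]]$. The comultiplication map $\Delta:R[[\xi]]\to R[[\xi]]\widehat\otimes'_RR[[\xi]]$ that sends $\xi$ to $1\otimes\xi+\xi\otimes1$ extends uniquely to a morphism of $R$-algebras $$\Delta:\widehat{R\langle\omega\rangle}_{\mathbb{\Delta}}\to\widehat{R\langle\omega\rangle}_{\mathbb{\Delta}}\widehat\otimes'_R\widehat{R\langle\omega\rangle}_{\mathbb{\Delta}}.$$
   Context: $(n)_q=1+q+\cdots+q^{n-1}$; $(n)_{q^p}$, $\binom nk_{q^p}$ are Gaussian integers and binomials at $q^p$. $R\langle\omega\rangle_{\mathbb{\Delta}}$ is the commutative $R$-algebra free as a module on $(\omega^{\{n\}_{\mathbb{\Delta}}})_{n\in\mathbb N}$, with unit $\omega^{\{0\}_{\mathbb{\Delta}}}$, $\omega:=\omega^{\{1\}_{\mathbb{\Delta}}}$ and $$\omega^{\{n_1\}_{\mathbb{\Delta}}}\omega^{\{n_2\}_{\mathbb{\Delta}}}=\sum_{0\le i\le\min(n_1,n_2)}q^{\frac{pi(i-1)}2}\binom{n_1+n_2-i}{n_1}_{q^p}\binom{n_1}{i}_{q^p}(q-1)^iq^i\,\omega^{\{n_1+n_2-i\}_{\mathbb{\Delta}}};$$ $\widehat{R\langle\omega\rangle}_{\mathbb{\Delta}}$ is its $(p,q-1)$-adic completion, and $R[[\xi]]\to\widehat{R\langle\omega\rangle}_{\mathbb{\Delta}}$ is the continuous $R$-algebra morphism $\xi\mapsto(p)_q\omega$;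 "extends" is with respect to this map. The Taylor maps are the unique continuous $W$-algebra morphisms $R\to R[[\xi]]$, $q\mapsto q+\xi$, and $\theta:R\to\widehat{R\langle\omega\rangle}_{\mathbb{\Delta}}$, $q\mapsto q+(p)_q\omega$. The notation $\otimes'_R$ means that the left factor is viewed as an $R$-module through the Taylor map (and the right factor through the canonical map). So $R[[\xi]]\widehat\otimes'_RR[[\xi]]\simeq W[[q-1,\xi_1,\xi_2]]$ with $\xi_1=\xi\otimes1$, $\xi_2=1\otimes\xi$. The $R$-algebra structure on the completed tensor products is the canonical one on the left factor ($q\mapsto q\otimes1$). On $R[[\xi]]$, $\Delta$ is the continuous $R$-algebra morphism with $\Delta(q)=q\otimes1$ and $\Delta(\xi)=1\otimes\xi+\xi\otimes1$. *)

theory Defs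
  imports
    "HOL-Algebra.Algebra"
    "HOL-Algebra.Algebraic_Closure_Type"
    "HOL-Computational_Algebra.Formal_Power_Series"
begin

section \<open>Adic completions and continuous morphisms\<close>

definition ideal_power :: "('a, 'm) ring_scheme \<Rightarrow> 'a set \<Rightarrow> nat \<Rightarrow> 'a set"
  where "ideal_power A I n = I [^]\<^bsub>ideals_set A\<^esub> n"

text \<open>The completion is the inverse limit of the quotients of \<open>A\<close> by the powers of \<open>I\<close>.
  Elements of the quotients are cosets, so a family of cosets is compatible with the transition
  maps iff each coset contains the next one.\<close>

definition adic_completion :: "('a, 'm) ring_scheme \<Rightarrow> 'a set \<Rightarrow> (nat \<Rightarrow> 'a set) ring"
  where "adic_completion A I =
    \<lparr>carrier = {x. (\<forall>n. x n \<in> carrier (A Quot ideal_power A I n)) \<and> (\<forall>n. x (Suc n) \<subseteq> x n)},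
     monoid.mult = (\<lambda>x y n. x n \<otimes>\<^bsub>A Quot ideal_power A I n\<^esub> y n),
     one = (\<lambda>n. \<one>\<^bsub>A Quot ideal_power A I n\<^esub>),
     ring.zero = (\<lambda>n. \<zero>\<^bsub>A Quot ideal_power A I n\<^esub>),
     add = (\<lambda>x y n. x n \<oplus>\<^bsub>A Quot ideal_power A I n\<^esub> y n)\<rparr>"

definition to_completion :: "('a, 'm) ring_scheme \<Rightarrow> 'a set \<Rightarrow> 'a \<Rightarrow> (nat \<Rightarrow> 'a set)"
  where "to_completion A I a = (\<lambda>n. ideal_power A I n +>\<^bsub>A\<^esub> a)"

text \<open>Complete includes separated.\<close>

definition adically_complete :: "('a, 'm) ring_scheme \<Rightarrow> 'a set \<Rightarrow> bool"
  where "adically_complete A I \<longleftrightarrow>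
    bij_betw (to_completion A I) (carrier A) (carrier (adic_completion A I))"

text \<open>The basic neighbourhoods of zero for the inverse limit topology: the kernels of the
  projections to the quotients.\<close>

definition completion_nhd :: "('a, 'm) ring_scheme \<Rightarrow> 'a set \<Rightarrow> nat \<Rightarrow> (nat \<Rightarrow> 'a set) set"
  where "completion_nhd A I n =
    {x \<in> carrier (adic_completion A I). x n = \<zero>\<^bsub>A Quot ideal_power A I n\<^esub>}"

text \<open>Topologies are given by decreasing sequences \<open>F\<close>, \<open>G\<close> of neighbourhoods of zero; \<open>\<sigma>\<close> and
  \<open>\<tau>\<close> are the structure maps of \<open>A\<close> and \<open>B\<close> as algebras over the ring \<open>'s\<close>. Membership in
  \<^const>\<open>extensional\<close> makes a map on the carrier correspond to exactly one function of the
  ambient type.\<close>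

definition continuous_algebra_hom ::
  "('a, 'm) ring_scheme \<Rightarrow> (nat \<Rightarrow> 'a set) \<Rightarrow> ('s \<Rightarrow> 'a) \<Rightarrow>
   ('b, 'n) ring_scheme \<Rightarrow> (nat \<Rightarrow> 'b set) \<Rightarrow> ('s \<Rightarrow> 'b) \<Rightarrow> ('a \<Rightarrow> 'b) \<Rightarrow> bool"
  where "continuous_algebra_hom A F \<sigma> B G \<tau> f \<longleftrightarrow>
    f \<in> ring_hom A B \<and> f \<in> extensional (carrier A) \<and>
    (\<forall>s. f (\<sigma> s) = \<tau> s) \<and>
    (\<forall>n. \<exists>m. f ` F m \<subseteq> G n)"

section \<open>Completed tensor products\<close>

text \<open>The monoid ring over the integers of the multiplicative monoid of \<open>A \<times> B\<close>.\<close>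

definition pair_ring ::
  "('a, 'm) ring_scheme \<Rightarrow> ('b, 'n) ring_scheme \<Rightarrow> ('a \<times> 'b \<Rightarrow>\<^sub>0 int) ring"
  where "pair_ring A B =
    \<lparr>carrier = {x. Poly_Mapping.keys x \<subseteq> carrier A \<times> carrier B},
     monoid.mult = (\<lambda>x y. frag_extend (\<lambda>(a, b). frag_extend
        (\<lambda>(a', b'). frag_of (a \<otimes>\<^bsub>A\<^esub> a', b \<otimes>\<^bsub>B\<^esub> b')) y) x),
     one = frag_of (\<one>\<^bsub>A\<^esub>, \<one>\<^bsub>B\<^esub>),
     ring.zero = 0,
     add = (+)\<rparr>"

text \<open>\<open>f\<close> and \<open>g\<close> are the structure maps of \<open>A\<close> and \<open>B\<close> as algebras over \<open>K\<close>. The ideal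
  generated by these relations is already the subgroup they generate, since they are stable under
  multiplication by elements of \<open>A \<times> B\<close>.\<close>

definition tensor_relations ::
  "('k, 'l) ring_scheme \<Rightarrow> ('a, 'm) ring_scheme \<Rightarrow> ('k \<Rightarrow> 'a) \<Rightarrow>
   ('b, 'n) ring_scheme \<Rightarrow> ('k \<Rightarrow> 'b) \<Rightarrow> ('a \<times> 'b \<Rightarrow>\<^sub>0 int) set"
  where "tensor_relations K A f B g =
    {frag_of (a \<oplus>\<^bsub>A\<^esub> a', b) - frag_of (a, b) - frag_of (a', b) | a a' b.
       a \<in> carrier A \<and> a' \<in> carrier A \<and> b \<in> carrier B} \<union>
    {frag_of (a, b \<oplus>\<^bsub>B\<^esub> b') - frag_of (a, b) - frag_of (a, b') | a b b'.
       a \<in> carrier A \<and> b \<in> carrier B \<and> b' \<in> carrier B} \<union>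
    {frag_of (a \<otimes>\<^bsub>A\<^esub> f r, b) - frag_of (a, g r \<otimes>\<^bsub>B\<^esub> b) | a r b.
       a \<in> carrier A \<and> r \<in> carrier K \<and> b \<in> carrier B}"

definition tensor_ideal ::
  "('k, 'l) ring_scheme \<Rightarrow> ('a, 'm) ring_scheme \<Rightarrow> ('k \<Rightarrow> 'a) \<Rightarrow>
   ('b, 'n) ring_scheme \<Rightarrow> ('k \<Rightarrow> 'b) \<Rightarrow> ('a \<times> 'b \<Rightarrow>\<^sub>0 int) set"
  where "tensor_ideal K A f B g = genideal (pair_ring A B) (tensor_relations K A f B g)"

definition tensor_ring ::
  "('k, 'l) ring_scheme \<Rightarrow> ('a, 'm) ring_scheme \<Rightarrow> ('k \<Rightarrow> 'a) \<Rightarrow>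
   ('b, 'n) ring_scheme \<Rightarrow> ('k \<Rightarrow> 'b) \<Rightarrow> ('a \<times> 'b \<Rightarrow>\<^sub>0 int) set ring"
  where "tensor_ring K A f B g = pair_ring A B Quot tensor_ideal K A f B g"

definition pure_tensor ::
  "('k, 'l) ring_scheme \<Rightarrow> ('a, 'm) ring_scheme \<Rightarrow> ('k \<Rightarrow> 'a) \<Rightarrow>
   ('b, 'n) ring_scheme \<Rightarrow> ('k \<Rightarrow> 'b) \<Rightarrow> 'a \<Rightarrow> 'b \<Rightarrow> ('a \<times> 'b \<Rightarrow>\<^sub>0 int) set"
  where "pure_tensor K A f B g a b =
    tensor_ideal K A f B g +>\<^bsub>pair_ring A B\<^esub> frag_of (a, b)"

text \<open>For an \<open>I\<close>-adic ring \<open>A\<close> and a \<open>J\<close>-adic ring \<open>B\<close>, the tensor product is completed along the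
  ideal generated by \<open>I \<otimes> 1\<close> and \<open>1 \<otimes> J\<close>.\<close>

definition tensor_adic_ideal ::
  "('k, 'l) ring_scheme \<Rightarrow> ('a, 'm) ring_scheme \<Rightarrow> 'a set \<Rightarrow> ('k \<Rightarrow> 'a) \<Rightarrow>
   ('b, 'n) ring_scheme \<Rightarrow> 'b set \<Rightarrow> ('k \<Rightarrow> 'b) \<Rightarrow> ('a \<times> 'b \<Rightarrow>\<^sub>0 int) set set"
  where "tensor_adic_ideal K A I f B J g = genideal (tensor_ring K A f B g)
    ((\<lambda>a. pure_tensor K A f B g a \<one>\<^bsub>B\<^esub>) ` I \<union> pure_tensor K A f B g \<one>\<^bsub>A\<^esub> ` J)"

definition completed_tensor ::
  "('k, 'l) ring_scheme \<Rightarrow> ('a, 'm) ring_scheme \<Rightarrow> 'a set \<Rightarrow> ('k \<Rightarrow> 'a) \<Rightarrow>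
   ('b, 'n) ring_scheme \<Rightarrow> 'b set \<Rightarrow> ('k \<Rightarrow> 'b) \<Rightarrow>
   (nat \<Rightarrow> ('a \<times> 'b \<Rightarrow>\<^sub>0 int) set set) ring"
  where "completed_tensor K A I f B J g =
    adic_completion (tensor_ring K A f B g) (tensor_adic_ideal K A I f B J g)"

definition completed_tensor_nhd ::
  "('k, 'l) ring_scheme \<Rightarrow> ('a, 'm) ring_scheme \<Rightarrow> 'a set \<Rightarrow> ('k \<Rightarrow> 'a) \<Rightarrow>
   ('b, 'n) ring_scheme \<Rightarrow> 'b set \<Rightarrow> ('k \<Rightarrow> 'b) \<Rightarrow>
   nat \<Rightarrow> (nat \<Rightarrow> ('a \<times> 'b \<Rightarrow>\<^sub>0 int) set set) set"
  where "completed_tensor_nhd K A I f B J g =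
    completion_nhd (tensor_ring K A f B g) (tensor_adic_ideal K A I f B J g)"

definition completed_pure_tensor ::
  "('k, 'l) ring_scheme \<Rightarrow> ('a, 'm) ring_scheme \<Rightarrow> 'a set \<Rightarrow> ('k \<Rightarrow> 'a) \<Rightarrow>
   ('b, 'n) ring_scheme \<Rightarrow> 'b set \<Rightarrow> ('k \<Rightarrow> 'b) \<Rightarrow>
   'a \<Rightarrow> 'b \<Rightarrow> (nat \<Rightarrow> ('a \<times> 'b \<Rightarrow>\<^sub>0 int) set set)"
  where "completed_pure_tensor K A I f B J g a b =
    to_completion (tensor_ring K A f B g) (tensor_adic_ideal K A I f B J g)
      (pure_tensor K A f B g a b)"

section \<open>Gaussian integers and binomials\<close>

definition gauss_integer :: "'a::comm_ring_1 \<Rightarrow> nat \<Rightarrow> 'a"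
  where "gauss_integer x n = (\<Sum>k<n. x ^ k)"

fun gauss_binomial :: "'a::comm_ring_1 \<Rightarrow> nat \<Rightarrow> nat \<Rightarrow> 'a"
  where
    "gauss_binomial x n 0 = 1"
  | "gauss_binomial x 0 (Suc k) = 0"
  | "gauss_binomial x (Suc n) (Suc k) =
      gauss_binomial x n k + x ^ Suc k * gauss_binomial x n (Suc k)"

section \<open>The rings \<open>R = W[[q - 1]]\<close> and \<open>R[[\<xi>]]\<close>\<close>

text \<open>\<open>W\<close> is the type \<open>'w\<close>, \<open>R\<close> is \<open>'w fps\<close> and \<open>R[[\<xi>]]\<close> is \<open>'w fps fps\<close>; the variable of
  \<open>'w fps\<close> is \<open>q - 1\<close>.\<close>

definition p_ideal :: "nat \<Rightarrow> 'w::comm_ring_1 set"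
  where "p_ideal p = genideal ring_of_type_algebra {of_nat p}"

definition q :: "'w::comm_ring_1 fps"
  where "q = 1 + fps_X"

definition R_ring :: "'w::comm_ring_1 fps ring"
  where "R_ring = ring_of_type_algebra"

definition R_ideal :: "nat \<Rightarrow> 'w::comm_ring_1 fps set"
  where "R_ideal p = genideal R_ring {of_nat p, q - 1}"

definition Rxi_ring :: "'w::comm_ring_1 fps fps ring"
  where "Rxi_ring = ring_of_type_algebra"

definition xi :: "'w::comm_ring_1 fps fps"
  where "xi = fps_X"

definition Rxi_ideal :: "nat \<Rightarrow> 'w::comm_ring_1 fps fps set"
  where "Rxi_ideal p = genideal Rxi_ring {of_nat p, fps_const (q - 1), xi}"

definition taylor_Rxi :: "nat \<Rightarrow> 'w::comm_ring_1 fps \<Rightarrow> 'w fps fps"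
  where "taylor_Rxi p = (THE f. continuous_algebra_hom
      R_ring (ideal_power R_ring (R_ideal p)) fps_const
      Rxi_ring (ideal_power Rxi_ring (Rxi_ideal p)) (\<lambda>w. fps_const (fps_const w)) f \<and>
    f q = fps_const q + xi)"

text \<open>The completed tensor square of \<open>R[[\<xi>]]\<close>: the left factor is an \<open>R\<close>-module through the
  Taylor map, the right one through the canonical map.\<close>

definition Rxi2_ring ::
  "nat \<Rightarrow> (nat \<Rightarrow> ('w::comm_ring_1 fps fps \<times> 'w fps fps \<Rightarrow>\<^sub>0 int) set set) ring"
  where "Rxi2_ring p = completed_tensor R_ring
    Rxi_ring (Rxi_ideal p) (taylor_Rxi p) Rxi_ring (Rxi_ideal p) fps_const"

definition Rxi2_nhd ::
  "nat \<Rightarrow> nat \<Rightarrow> (nat \<Rightarrow> ('w::comm_ring_1 fps fps \<times> 'w fps fps \<Rightarrow>\<^sub>0 int) set set) set"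
  where "Rxi2_nhd p = completed_tensor_nhd R_ring
    Rxi_ring (Rxi_ideal p) (taylor_Rxi p) Rxi_ring (Rxi_ideal p) fps_const"

definition Rxi2_tensor ::
  "nat \<Rightarrow> 'w::comm_ring_1 fps fps \<Rightarrow> 'w fps fps \<Rightarrow>
   (nat \<Rightarrow> ('w fps fps \<times> 'w fps fps \<Rightarrow>\<^sub>0 int) set set)"
  where "Rxi2_tensor p = completed_pure_tensor R_ring
    Rxi_ring (Rxi_ideal p) (taylor_Rxi p) Rxi_ring (Rxi_ideal p) fps_const"

definition Delta_Rxi ::
  "nat \<Rightarrow> 'w::comm_ring_1 fps fps \<Rightarrow> (nat \<Rightarrow> ('w fps fps \<times> 'w fps fps \<Rightarrow>\<^sub>0 int) set set)"
  where "Delta_Rxi p = (THE f. continuous_algebra_hom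
      Rxi_ring (ideal_power Rxi_ring (Rxi_ideal p)) fps_const
      (Rxi2_ring p) (Rxi2_nhd p) (\<lambda>r. Rxi2_tensor p (fps_const r) 1) f \<and>
    f xi = Rxi2_tensor p 1 xi \<oplus>\<^bsub>Rxi2_ring p\<^esub> Rxi2_tensor p xi 1)"

section \<open>The algebra \<open>R\<langle>\<omega>\<rangle>\<close> of prismatic divided powers\<close>

text \<open>\<open>Poly_Mapping.single n r\<close> is \<open>r\<close> times the \<open>n\<close>-th divided power of \<open>\<omega>\<close>.\<close>

definition omega_ring :: "nat \<Rightarrow> (nat \<Rightarrow>\<^sub>0 'w::comm_ring_1 fps) ring"
  where "omega_ring p =
    \<lparr>carrier = UNIV,
     monoid.mult = (\<lambda>x y. \<Sum>m\<in>Poly_Mapping.keys x. \<Sum>n\<in>Poly_Mapping.keys y. \<Sum>i\<in>{0..min m n}.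
        Poly_Mapping.single (m + n - i)
          (Poly_Mapping.lookup x m * Poly_Mapping.lookup y n *
           (q ^ (p * i * (i - 1) div 2) *
            gauss_binomial (q ^ p) (m + n - i) m * gauss_binomial (q ^ p) m i *
            (q - 1) ^ i * q ^ i))),
     one = Poly_Mapping.single 0 1,
     ring.zero = 0,
     add = (+)\<rparr>"

definition omega_ideal :: "nat \<Rightarrow> (nat \<Rightarrow>\<^sub>0 'w::comm_ring_1 fps) set"
  where "omega_ideal p = genideal (omega_ring p)
    {Poly_Mapping.single 0 (of_nat p), Poly_Mapping.single 0 (q - 1)}"

definition omega_hat :: "nat \<Rightarrow> (nat \<Rightarrow> (nat \<Rightarrow>\<^sub>0 'w::comm_ring_1 fps) set) ring"
  where "omega_hat p = adic_completion (omega_ring p) (omega_ideal p)"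

definition omega_hat_nhd :: "nat \<Rightarrow> nat \<Rightarrow> (nat \<Rightarrow> (nat \<Rightarrow>\<^sub>0 'w::comm_ring_1 fps) set) set"
  where "omega_hat_nhd p = completion_nhd (omega_ring p) (omega_ideal p)"

definition omega_hat_const ::
  "nat \<Rightarrow> 'w::comm_ring_1 fps \<Rightarrow> (nat \<Rightarrow> (nat \<Rightarrow>\<^sub>0 'w fps) set)"
  where "omega_hat_const p r =
    to_completion (omega_ring p) (omega_ideal p) (Poly_Mapping.single 0 r)"

definition omega :: "nat \<Rightarrow> (nat \<Rightarrow> (nat \<Rightarrow>\<^sub>0 'w::comm_ring_1 fps) set)"
  where "omega p = to_completion (omega_ring p) (omega_ideal p) (Poly_Mapping.single 1 1)"

definition p_omega :: "nat \<Rightarrow> (nat \<Rightarrow> (nat \<Rightarrow>\<^sub>0 'w::comm_ring_1 fps) set)"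
  where "p_omega p = omega_hat_const p (gauss_integer q p) \<otimes>\<^bsub>omega_hat p\<^esub> omega p"

definition taylor_omega ::
  "nat \<Rightarrow> 'w::comm_ring_1 fps \<Rightarrow> (nat \<Rightarrow> (nat \<Rightarrow>\<^sub>0 'w fps) set)"
  where "taylor_omega p = (THE f. continuous_algebra_hom
      R_ring (ideal_power R_ring (R_ideal p)) fps_const
      (omega_hat p) (omega_hat_nhd p) (\<lambda>w. omega_hat_const p (fps_const w)) f \<and>
    f q = omega_hat_const p q \<oplus>\<^bsub>omega_hat p\<^esub> p_omega p)"

definition Rxi_to_omega ::
  "nat \<Rightarrow> 'w::comm_ring_1 fps fps \<Rightarrow> (nat \<Rightarrow> (nat \<Rightarrow>\<^sub>0 'w fps) set)"
  where "Rxi_to_omega p = (THE f. continuous_algebra_hom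
      Rxi_ring (ideal_power Rxi_ring (Rxi_ideal p)) fps_const
      (omega_hat p) (omega_hat_nhd p) (omega_hat_const p) f \<and>
    f xi = p_omega p)"

definition omega_hat_ideal :: "nat \<Rightarrow> (nat \<Rightarrow> (nat \<Rightarrow>\<^sub>0 'w::comm_ring_1 fps) set) set"
  where "omega_hat_ideal p = genideal (omega_hat p)
    {omega_hat_const p (of_nat p), omega_hat_const p (q - 1)}"

type_synonym 'w omega2 =
  "nat \<Rightarrow> ((nat \<Rightarrow> (nat \<Rightarrow>\<^sub>0 'w fps) set) \<times> (nat \<Rightarrow> (nat \<Rightarrow>\<^sub>0 'w fps) set) \<Rightarrow>\<^sub>0 int) set set"

text \<open>As for \<open>R[[\<xi>]]\<close>, the left factor is viewed as an \<open>R\<close>-module through the Taylor map.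
  Because of \<open>1 \<otimes> (q - 1) = (q - 1 + (p)\<^sub>q \<omega>) \<otimes> 1\<close>, the adic ideal of the completed tensor
  product is generated by \<open>p\<close> and \<open>(q - 1) \<otimes> 1\<close>.\<close>

definition omega2_ring :: "nat \<Rightarrow> 'w::comm_ring_1 omega2 ring"
  where "omega2_ring p = completed_tensor R_ring
    (omega_hat p) (omega_hat_ideal p) (taylor_omega p)
    (omega_hat p) (omega_hat_ideal p) (omega_hat_const p)"

definition omega2_nhd :: "nat \<Rightarrow> nat \<Rightarrow> 'w::comm_ring_1 omega2 set"
  where "omega2_nhd p = completed_tensor_nhd R_ring
    (omega_hat p) (omega_hat_ideal p) (taylor_omega p)
    (omega_hat p) (omega_hat_ideal p) (omega_hat_const p)"

definition omega2_tensor ::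
  "nat \<Rightarrow> (nat \<Rightarrow> (nat \<Rightarrow>\<^sub>0 'w::comm_ring_1 fps) set) \<Rightarrow> (nat \<Rightarrow> (nat \<Rightarrow>\<^sub>0 'w fps) set) \<Rightarrow> 'w omega2"
  where "omega2_tensor p = completed_pure_tensor R_ring
    (omega_hat p) (omega_hat_ideal p) (taylor_omega p)
    (omega_hat p) (omega_hat_ideal p) (omega_hat_const p)"

definition omega2_const :: "nat \<Rightarrow> 'w::comm_ring_1 fps \<Rightarrow> 'w omega2"
  where "omega2_const p r = omega2_tensor p (omega_hat_const p r) \<one>\<^bsub>omega_hat p\<^esub>"

text \<open>The completed tensor square of the map \<^const>\<open>Rxi_to_omega\<close>.\<close>

definition Rxi2_to_omega2 ::
  "nat \<Rightarrow> (nat \<Rightarrow> ('w::comm_ring_1 fps fps \<times> 'w fps fps \<Rightarrow>\<^sub>0 int) set set) \<Rightarrow> 'w omega2"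
  where "Rxi2_to_omega2 p = (THE f. continuous_algebra_hom
      (Rxi2_ring p) (Rxi2_nhd p) (\<lambda>r. Rxi2_tensor p (fps_const r) 1)
      (omega2_ring p) (omega2_nhd p) (omega2_const p) f \<and>
    (\<forall>a b. f (Rxi2_tensor p a b) = omega2_tensor p (Rxi_to_omega p a) (Rxi_to_omega p b)))"

end

theory Submission
  imports Defs
begin

text \<open>
  Write \<open>Q = q\<^sup>p\<close> and \<open>\<theta>(q) = q + (p)\<^sub>q \<omega>\<close>. The specialisations \<open>\<theta>(q) \<mapsto> q\<^bsup>p m + 1\<^esup>\<close>, for \<open>m \<in> \<nat>\<close>, embed
  the algebra of divided powers into the ring of functions \<open>\<nat> \<rightarrow> R\<close>: the \<open>n\<close>-th divided power becomes
  \<open>(q (q - 1))\<^sup>n Q\<^bsup>n (n - 1) / 2\<^esup>\<close> times the Gaussian binomial of \<open>m\<close> and \<open>n\<close> at \<open>Q\<close>, so that the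
  multiplication table is the \<open>q\<close>-Vandermonde identity. Similarly the completed tensor square
  embeds into the functions of two exponents \<open>m\<close> and \<open>l\<close>, and the comultiplication has to be the
  substitution \<open>f(m) \<mapsto> f(p m l + m + l)\<close>, which is visibly multiplicative. What remains is that the
  divided powers are sent into the image of the tensor square. By the \<open>q\<close>-Vandermonde identity their
  differences in the direction of \<open>l\<close> are combinations of previous ones, with coefficients that are
  divisible in the algebra by the factor needed for summing up in the direction of \<open>l\<close>.
  Uniqueness holds because \<open>(p)\<^sub>q\<close> and \<open>(n)\<^sub>Q\<close> are nonzerodivisors, and every ring morphism in question
  is continuous because the ideal \<open>(p, q - 1)\<close> is finitely generated.
\<close>

section \<open>Filtered rings and adic completions\<close>

text \<open>The exponents p m + 1 come from q^(p m + 1) - q = q (q - 1) (p)_q (m)_Q: there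
  \<theta>(q) - q is divisible by (p)_q, and \<omega> gets the value q (q - 1) (m)_Q. The
  substitutions q -> q^(p m + 1) are stable under composition, and composing them is what 1
  \<otimes> \<xi> + \<xi> \<otimes> 1 amounts to. Two obstacles shape the proof. Summing in the
  direction of l takes place in the right tensor factor and needs the coefficient y (y - 1) with y =
  q^(p m + 1), whereas the q-Vandermonde identity only shows q (q - 1). For each single m the two
  differ by a unit of R, but the quotient has to be a function of m that belongs to the algebra of
  divided powers; it is obtained by extracting (p m + 1)_Q from the Gaussian binomials of p m + 1.
  The completed tensor square is the completion of a quotient of a free group and comes without
  coordinates. Finite combinations of products of divided powers replace a basis: they approximate
  every element modulo each power of the ideal. Recovering a coefficient from the values loses
  powers of q - 1, so each coefficient is controlled through a finer approximation, whose level
  depends on it.\<close>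

locale filtered_ring = cring C for C (structure) +
  fixes G :: "nat \<Rightarrow> 'a set"
  assumes filtration_ideal: "ideal (G n) C"
    and filtration_Suc: "G (Suc n) \<subseteq> G n"
    and filtration_mult: "\<lbrakk>x \<in> G m; y \<in> G n\<rbrakk> \<Longrightarrow> x \<otimes> y \<in> G (m + n)"
    and filtration_0: "G 0 = carrier C"
begin

lemma filtration_carrier: "x \<in> G n \<Longrightarrow> x \<in> carrier C"
  using ideal.Icarr[OF filtration_ideal] .

lemma filtration_antimono: "m \<le> n \<Longrightarrow> G n \<subseteq> G m"
  using filtration_Suc by (rule lift_Suc_antimono_le)

lemma filtration_zero: "\<zero> \<in> G n"
  using additive_subgroup.zero_closed[OF ideal.axioms(1)[OF filtration_ideal]] .

lemma filtration_add: "\<lbrakk>x \<in> G n; y \<in> G n\<rbrakk> \<Longrightarrow> x \<oplus> y \<in> G n"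
  using additive_subgroup.a_closed[OF ideal.axioms(1)[OF filtration_ideal]] .

lemma filtration_uminus: "x \<in> G n \<Longrightarrow> \<ominus> x \<in> G n"
  using additive_subgroup.a_inv_closed[OF ideal.axioms(1)[OF filtration_ideal]] .

lemma filtration_diff: "\<lbrakk>x \<in> G n; y \<in> G n\<rbrakk> \<Longrightarrow> x \<ominus> y \<in> G n"
  by (simp add: a_minus_def filtration_add filtration_uminus)

lemma filtration_mult_left: "\<lbrakk>x \<in> carrier C; y \<in> G n\<rbrakk> \<Longrightarrow> x \<otimes> y \<in> G n"
  using ideal.I_l_closed[OF filtration_ideal] by blast

lemma filtration_mult_right: "\<lbrakk>x \<in> G n; y \<in> carrier C\<rbrakk> \<Longrightarrow> x \<otimes> y \<in> G n"
  using ideal.I_r_closed[OF filtration_ideal] by blast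

lemma filtration_cong_refl: "x \<in> carrier C \<Longrightarrow> x \<ominus> x \<in> G n"
  using filtration_zero by (simp add: r_neg minus_eq)

lemma filtration_cong_sym:
  assumes "x \<in> carrier C" "y \<in> carrier C" "x \<ominus> y \<in> G n" shows "y \<ominus> x \<in> G n"
proof -
  have "y \<ominus> x = \<ominus> (x \<ominus> y)" using assms(1,2) by algebra
  then show ?thesis using filtration_uminus[OF assms(3)] by simp
qed

lemma filtration_cong_trans:
  assumes "x \<in> carrier C" "y \<in> carrier C" "z \<in> carrier C" "x \<ominus> y \<in> G n" "y \<ominus> z \<in> G n"
  shows "x \<ominus> z \<in> G n"
proof -
  have "x \<ominus> z = (x \<ominus> y) \<oplus> (y \<ominus> z)" using assms(1-3) by algebra
  then show ?thesis using filtration_add[OF assms(4,5)] by simp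
qed

lemma filtration_cong_trans2:
  assumes "x \<in> carrier C" "y \<in> carrier C" "z \<in> carrier C" "x \<ominus> y \<in> G n" "z \<ominus> y \<in> G n"
  shows "x \<ominus> z \<in> G n"
  using filtration_cong_trans[OF assms(1-4) filtration_cong_sym[OF assms(3,2,5)]] .

lemma filtration_cong_add:
  assumes "x \<in> carrier C" "y \<in> carrier C" "x' \<in> carrier C" "y' \<in> carrier C"
    "x \<ominus> x' \<in> G n" "y \<ominus> y' \<in> G n"
  shows "(x \<oplus> y) \<ominus> (x' \<oplus> y') \<in> G n"
proof -
  have "(x \<oplus> y) \<ominus> (x' \<oplus> y') = (x \<ominus> x') \<oplus> (y \<ominus> y')" using assms(1-4) by algebra
  then show ?thesis using filtration_add[OF assms(5,6)] by simp
qed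

lemma filtration_cong_uminus:
  assumes "x \<in> carrier C" "x' \<in> carrier C" "x \<ominus> x' \<in> G n"
  shows "(\<ominus> x) \<ominus> (\<ominus> x') \<in> G n"
proof -
  have "(\<ominus> x) \<ominus> (\<ominus> x') = \<ominus> (x \<ominus> x')" using assms(1-2) by algebra
  then show ?thesis using filtration_uminus[OF assms(3)] by simp
qed

lemma filtration_cong_mult:
  assumes "x \<in> carrier C" "y \<in> carrier C" "x' \<in> carrier C" "y' \<in> carrier C"
    "x \<ominus> x' \<in> G n" "y \<ominus> y' \<in> G n"
  shows "(x \<otimes> y) \<ominus> (x' \<otimes> y') \<in> G n"
proof -
  have "(x \<otimes> y) \<ominus> (x' \<otimes> y') = (x \<ominus> x') \<otimes> y \<oplus> x' \<otimes> (y \<ominus> y')"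
    using assms(1-4) by algebra
  then show ?thesis
    using filtration_add[OF filtration_mult_right[OF assms(5) assms(2)]
      filtration_mult_left[OF assms(3) assms(6)]] by simp
qed

lemma filtration_cong_mem:
  assumes "x \<in> carrier C" "y \<in> carrier C" "x \<ominus> y \<in> G n" shows "x \<in> G n \<longleftrightarrow> y \<in> G n"
proof
  assume "x \<in> G n"
  have "y = x \<ominus> (x \<ominus> y)" using assms(1,2) by algebra
  then show "y \<in> G n" using filtration_diff[OF \<open>x \<in> G n\<close> assms(3)] by simp
next
  assume "y \<in> G n"
  have "x = (x \<ominus> y) \<oplus> y" using assms(1,2) by algebra
  then show "x \<in> G n" using filtration_add[OF assms(3) \<open>y \<in> G n\<close>] by simp
qed

lemma filtration_coset_eq_iff:
  assumes "x \<in> carrier C" "y \<in> carrier C"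
  shows "G n +> x = G n +> y \<longleftrightarrow> x \<ominus> y \<in> G n"
  using quotient_eq_iff_same_a_r_cos[OF filtration_ideal assms] by simp

lemma filtration_coset_mem_iff:
  assumes "x \<in> carrier C" "y \<in> carrier C"
  shows "y \<in> G n +> x \<longleftrightarrow> y \<ominus> x \<in> G n"
proof -
  interpret I: ideal "G n" C by (rule filtration_ideal)
  show ?thesis using I.a_rcos_module_minus[OF ring_axioms assms] .
qed

lemma filtration_coset_subset_iff:
  assumes "x \<in> carrier C" "y \<in> carrier C" "m \<le> n"
  shows "G n +> y \<subseteq> G m +> x \<longleftrightarrow> y \<ominus> x \<in> G m"
proof
  interpret I: ideal "G n" C by (rule filtration_ideal)
  assume "G n +> y \<subseteq> G m +> x"
  then have "y \<in> G m +> x" using I.a_rcos_self[OF assms(2)] by blast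
  then show "y \<ominus> x \<in> G m" using filtration_coset_mem_iff[OF assms(1,2)] by simp
next
  interpret I: ideal "G n" C by (rule filtration_ideal)
  assume yx: "y \<ominus> x \<in> G m"
  show "G n +> y \<subseteq> G m +> x"
  proof
    fix z assume z: "z \<in> G n +> y"
    then have zc: "z \<in> carrier C"
      using I.a_rcosets_carrier[OF a_rcosetsI[OF I.a_subset assms(2)]] by blast
    then have "z \<ominus> y \<in> G m"
      using z filtration_coset_mem_iff[OF assms(2) zc] filtration_antimono[OF assms(3)] by blast
    then show "z \<in> G m +> x"
      using filtration_coset_mem_iff[OF assms(1) zc] filtration_cong_trans[OF zc assms(2,1) _ yx] by blast
  qed
qed

end

text \<open>Completeness is stated with an explicit rate: steps in \<open>G n\<close> force a limit
  at distance \<open>G n\<close>. Arguments about limits thereby become congruences modulo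
  \<open>G n\<close>.\<close>

locale complete_filtered_ring = filtered_ring +
  assumes filtration_separated: "\<lbrakk>x \<in> carrier C; \<And>n. x \<in> G n\<rbrakk> \<Longrightarrow> x = \<zero>"
    and filtration_complete: "\<lbrakk>\<And>n. c n \<in> carrier C; \<And>n. c (Suc n) \<ominus> c n \<in> G n\<rbrakk>
      \<Longrightarrow> \<exists>x\<in>carrier C. \<forall>n. c n \<ominus> x \<in> G n"
begin

lemma filtration_eqI:
  assumes "x \<in> carrier C" "y \<in> carrier C" "\<And>n. x \<ominus> y \<in> G n" shows "x = y"
  using filtration_separated[of "x \<ominus> y"] assms by simp

end

lemma (in ring_hom_ring) hom_minus:
  "\<lbrakk>x \<in> carrier R; y \<in> carrier R\<rbrakk> \<Longrightarrow> h (x \<ominus>\<^bsub>R\<^esub> y) = h x \<ominus>\<^bsub>S\<^esub> h y"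
  by (simp add: a_minus_def)

lemma ring_hom_genideal_subset:
  assumes "ring A" "ring B" "h \<in> ring_hom A B" "S \<subseteq> carrier A" "ideal J B" "h ` S \<subseteq> J"
  shows "h ` genideal A S \<subseteq> J"
proof -
  interpret h: ring_hom_ring A B h
    using assms by (intro ring_hom_ringI2)
  have "ideal {r \<in> carrier A. h r \<in> J} A"
    using h.ideal_vimage[OF assms(5)] .
  then have "genideal A S \<subseteq> {r \<in> carrier A. h r \<in> J}"
    using assms by (intro ring.genideal_minimal) auto
  then show ?thesis by blast
qed

section \<open>Powers of an ideal as a filtration\<close>

lemma ideal_power_0: "ideal_power A I 0 = carrier A"
  by (simp add: ideal_power_def ideals_set_def nat_pow_def)

lemma ideal_power_Suc: "ideal_power A I (Suc n) = ideal_prod A (ideal_power A I n) I"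
  by (simp add: ideal_power_def ideals_set_def nat_pow_def)

context cring
begin

lemma ideal_power_ideal: "ideal I R \<Longrightarrow> ideal (ideal_power R I n) R"
  by (induction n) (auto simp: ideal_power_0 ideal_power_Suc oneideal ideal_prod_is_ideal)

lemma ideal_power_1: "ideal I R \<Longrightarrow> ideal_power R I 1 = I"
  using ideal_prod_commute[OF oneideal, of I] ideal_prod_one[of I]
  by (simp add: ideal_power_Suc ideal_power_0)

lemma ideal_power_mult:
  assumes "ideal I R" "x \<in> ideal_power R I m" "y \<in> ideal_power R I n"
  shows "x \<otimes> y \<in> ideal_power R I (m + n)"
  using assms(3)
proof (induction n arbitrary: y)
  case 0
  then show ?case using assms ideal.I_r_closed[OF ideal_power_ideal] by (simp add: ideal_power_0)
next
  case (Suc n)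
  have xc: "x \<in> carrier R" using ideal.Icarr[OF ideal_power_ideal[OF assms(1)] assms(2)] .
  note c = ideal.Icarr[OF ideal_power_ideal[OF assms(1)]] ideal.Icarr[OF assms(1)]
    subsetD[OF ideal_prod_in_carrier[OF ideal_power_ideal[OF assms(1)] assms(1)]]
  from Suc.prems have "y \<in> ideal_prod R (ideal_power R I n) I" by (simp add: ideal_power_Suc)
  then show ?case
  proof induction
    case (prod i j)
    then have "(x \<otimes> i) \<otimes> j \<in> ideal_power R I (m + Suc n)"
      using Suc.IH by (auto simp: ideal_power_Suc intro: ideal_prod.prod)
    then show ?case using prod c xc by (simp add: m_assoc)
  next
    case (sum s1 s2)
    then have "(x \<otimes> s1) \<oplus> (x \<otimes> s2) \<in> ideal_power R I (m + Suc n)"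
      by (auto simp: ideal_power_Suc intro: ideal_prod.sum)
    then show ?case using sum.hyps c xc by (simp add: r_distr)
  qed
qed

lemma filtered_ring_ideal_power:
  assumes "ideal I R" shows "filtered_ring R (ideal_power R I)"
proof (intro filtered_ring.intro filtered_ring_axioms.intro)
  show "ideal_power R I (Suc n) \<subseteq> ideal_power R I n" for n
    using ideal_prod_inter[OF ideal_power_ideal[OF assms] assms] by (simp add: ideal_power_Suc)
qed (use assms is_cring in \<open>simp_all add: ideal_power_0 ideal_power_ideal ideal_power_mult\<close>)

lemma genideal_pair_mem:
  assumes "a \<in> carrier R" "b \<in> carrier R" "z \<in> Idl {a, b}"
  obtains x y where "x \<in> carrier R" "y \<in> carrier R" "z = a \<otimes> x \<oplus> b \<otimes> y"
proof -
  have "ideal (set_add R (PIdl a) (PIdl b)) R"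
    by (intro add_ideals cgenideal_ideal assms)
  moreover have "a \<in> set_add R (PIdl a) (PIdl b)" "b \<in> set_add R (PIdl a) (PIdl b)"
  proof -
    have "\<zero> \<in> PIdl a" "\<zero> \<in> PIdl b"
      using assms additive_subgroup.zero_closed[OF ideal.axioms(1)[OF cgenideal_ideal]] by auto
    moreover have "a = a \<oplus> \<zero>" "b = \<zero> \<oplus> b" using assms by auto
    ultimately show "a \<in> set_add R (PIdl a) (PIdl b)" "b \<in> set_add R (PIdl a) (PIdl b)"
      using cgenideal_self assms unfolding set_add_def' by blast+
  qed
  ultimately have "z \<in> set_add R (PIdl a) (PIdl b)"
    using genideal_minimal[of "set_add R (PIdl a) (PIdl b)" "{a, b}"] assms by auto
  then obtain x y where "x \<in> carrier R" "y \<in> carrier R" "z = x \<otimes> a \<oplus> y \<otimes> b"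
    by (auto simp: set_add_def' cgenideal_def)
  then show ?thesis using that assms by (simp add: m_comm)
qed

text \<open>In a product i j the factor j of the ideal is written as a x + b y and i is absorbed
  into the cofactors; sums are collected generator by generator. Two cofactors therefore suffice for
  every n, which makes division of convergent sequences by a and b possible.\<close>

lemma ideal_power_pair_Suc_mem:
  assumes ab: "a \<in> carrier R" "b \<in> carrier R"
    and "z \<in> ideal_power R (Idl {a, b}) (Suc n)"
  obtains x y where "x \<in> ideal_power R (Idl {a, b}) n" "y \<in> ideal_power R (Idl {a, b}) n"
    "z = a \<otimes> x \<oplus> b \<otimes> y"
proof -
  let ?P = "ideal_power R (Idl {a, b}) n"
  have I: "ideal (Idl {a, b}) R" using ab by (intro genideal_ideal) auto
  interpret P: ideal ?P R by (rule ideal_power_ideal[OF I])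
  have "z \<in> ideal_prod R ?P (Idl {a, b})" using assms(3) by (simp add: ideal_power_Suc)
  then have "\<exists>x\<in>?P. \<exists>y\<in>?P. z = a \<otimes> x \<oplus> b \<otimes> y"
  proof induction
    case (prod i j)
    obtain x y where xy: "x \<in> carrier R" "y \<in> carrier R" "j = a \<otimes> x \<oplus> b \<otimes> y"
      using genideal_pair_mem[OF ab prod(2)] .
    have "i \<in> carrier R" using prod by simp
    then have "i \<otimes> j = a \<otimes> (i \<otimes> x) \<oplus> b \<otimes> (i \<otimes> y)" using ab xy by algebra
    then show ?case using P.I_r_closed[OF prod(1)] xy by blast
  next
    case (sum s1 s2)
    then obtain x1 y1 x2 y2 where *: "x1 \<in> ?P" "y1 \<in> ?P" "x2 \<in> ?P" "y2 \<in> ?P"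
      "s1 = a \<otimes> x1 \<oplus> b \<otimes> y1" "s2 = a \<otimes> x2 \<oplus> b \<otimes> y2" by blast
    then have c: "x1 \<in> carrier R" "y1 \<in> carrier R" "x2 \<in> carrier R" "y2 \<in> carrier R" by auto
    have "s1 \<oplus> s2 = a \<otimes> (x1 \<oplus> x2) \<oplus> b \<otimes> (y1 \<oplus> y2)"
      unfolding *(5,6) using c ab by algebra
    then show ?case using * P.a_closed by blast
  qed
  then show ?thesis using that by blast
qed

end

text \<open>The target carries an arbitrary multiplicative filtration, so a bound on the ideal
  itself propagates to all its powers. Checking generators is thus enough for continuity.\<close>

lemma ring_hom_ideal_power_subset:
  assumes "cring A" "filtered_ring B G" "h \<in> ring_hom A B" "ideal I A" "h ` I \<subseteq> G 1"
  shows "h ` ideal_power A I n \<subseteq> G n"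
proof (induction n)
  case 0
  then show ?case using ring_hom_closed[OF assms(3)] filtered_ring.filtration_0[OF assms(2)]
    by (auto simp: ideal_power_0)
next
  case (Suc n)
  interpret A: cring A by fact
  interpret B: filtered_ring B G by fact
  interpret h: ring_hom_ring A B h
    using assms(3) A.ring_axioms B.ring_axioms by (intro ring_hom_ringI2)
  have c: "x \<in> carrier A" if "x \<in> ideal_prod A (ideal_power A I n) I" for x
    using that A.ideal_prod_in_carrier[OF A.ideal_power_ideal[OF assms(4)] assms(4)] by blast
  have "h x \<in> G (Suc n)" if "x \<in> ideal_prod A (ideal_power A I n) I" for x
    using that
  proof induction
    case (prod i j)
    then have "h i \<otimes>\<^bsub>B\<^esub> h j \<in> G (n + 1)"
      using Suc assms(5) by (intro B.filtration_mult) auto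
    then show ?case using prod ideal.Icarr[OF assms(4)] ideal.Icarr[OF A.ideal_power_ideal[OF assms(4)]]
      by simp
  next
    case (sum s1 s2)
    then show ?case using c B.filtration_add by simp
  qed
  then show ?case by (auto simp: ideal_power_Suc)
qed

section \<open>The inverse limit described by Cauchy sequences of representatives\<close>

definition completion_limit :: "('a, 'm) ring_scheme \<Rightarrow> 'a set \<Rightarrow> (nat \<Rightarrow> 'a) \<Rightarrow> (nat \<Rightarrow> 'a set)"
  where "completion_limit A I a = (\<lambda>n. ideal_power A I n +>\<^bsub>A\<^esub> a n)"

locale adic_ring = cring A for A (structure) +
  fixes I :: "'a set"
  assumes I_ideal: "ideal I A"
begin

abbreviation P where "P \<equiv> ideal_power A I"
abbreviation Ahat where "Ahat \<equiv> adic_completion A I"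
abbreviation lim where "lim \<equiv> completion_limit A I"

sublocale adic: filtered_ring A P
  using filtered_ring_ideal_power[OF I_ideal] .

definition cauchy :: "(nat \<Rightarrow> 'a) \<Rightarrow> bool"
  where "cauchy a \<longleftrightarrow> (\<forall>n. a n \<in> carrier A \<and> a (Suc n) \<ominus> a n \<in> P n)"

lemma cauchyD: "cauchy a \<Longrightarrow> a n \<in> carrier A" "cauchy a \<Longrightarrow> a (Suc n) \<ominus> a n \<in> P n"
  by (auto simp: cauchy_def)

lemma cauchy_diff:
  assumes a: "cauchy a" and "n \<le> m" shows "a m \<ominus> a n \<in> P n"
  using assms(2)
proof (induction m rule: dec_induct)
  case base
  then show ?case using adic.filtration_cong_refl cauchyD a by blast
next
  case (step m)
  have "a (Suc m) \<ominus> a m \<in> P n"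
    using cauchyD(2)[OF a] adic.filtration_antimono[OF step.hyps(1)] by blast
  then show ?case using adic.filtration_cong_trans step cauchyD(1)[OF a] by blast
qed

text \<open>After choosing representatives, the inclusion \<open>x (Suc n) \<subseteq> x n\<close>
  of cosets becomes the congruence \<open>a (Suc n) \<ominus> a n \<in> P n\<close>. Operations in
  the completion are then computed termwise on sequences.\<close>

lemma completion_carrier_iff: "x \<in> carrier Ahat \<longleftrightarrow> (\<exists>a. cauchy a \<and> x = lim a)"
proof
  assume x: "x \<in> carrier Ahat"
  then have 1: "x n \<in> carrier (A Quot P n)" "x (Suc n) \<subseteq> x n" for n
    by (auto simp: adic_completion_def)
  then have "\<forall>n. \<exists>a\<in>carrier A. x n = P n +> a"
    by (auto simp: FactRing_def A_RCOSETS_def')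
  then obtain a where a: "a n \<in> carrier A" "x n = P n +> a n" for n by metis
  have "a (Suc n) \<ominus> a n \<in> P n" for n
    using 1(2)[of n] a adic.filtration_coset_subset_iff[of "a n" "a (Suc n)" n "Suc n"] by simp
  then show "\<exists>a. cauchy a \<and> x = lim a"
    using a by (intro exI[of _ a]) (simp add: cauchy_def completion_limit_def fun_eq_iff)
next
  assume "\<exists>a. cauchy a \<and> x = lim a"
  then obtain a where a: "cauchy a" "x = lim a" by blast
  have "x (Suc n) \<subseteq> x n" for n
    using a cauchyD[OF a(1)] adic.filtration_coset_subset_iff[of "a n" "a (Suc n)" n "Suc n"]
    by (simp add: completion_limit_def)
  then show "x \<in> carrier Ahat"
    using a cauchyD[OF a(1)] by (auto simp: adic_completion_def completion_limit_def FactRing_def A_RCOSETS_def')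
qed

lemma lim_carrier: "cauchy a \<Longrightarrow> lim a \<in> carrier Ahat"
  using completion_carrier_iff by blast

lemma completionE:
  assumes "x \<in> carrier Ahat"
  obtains a where "cauchy a" "x = lim a"
  using assms completion_carrier_iff by blast

lemma lim_eq_iff:
  assumes "\<And>n. a n \<in> carrier A" "\<And>n. b n \<in> carrier A"
  shows "lim a = lim b \<longleftrightarrow> (\<forall>n. a n \<ominus> b n \<in> P n)"
  using adic.filtration_coset_eq_iff assms by (simp add: completion_limit_def fun_eq_iff)

lemma lim_mem_iff:
  assumes "a n \<in> carrier A" "b \<in> carrier A"
  shows "b \<in> lim a n \<longleftrightarrow> b \<ominus> a n \<in> P n"
  using adic.filtration_coset_mem_iff assms by (simp add: completion_limit_def)

lemma mem_lim: "cauchy a \<Longrightarrow> a n \<in> lim a n"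
  using lim_mem_iff[of a n "a n"] adic.filtration_cong_refl[of "a n" n] cauchyD(1)[of a n] by simp

lemma lim_subset_carrier:
  assumes "cauchy a" shows "lim a n \<subseteq> carrier A"
proof -
  interpret ideal "P n" A by (rule adic.filtration_ideal)
  show ?thesis using a_rcosets_carrier[OF a_rcosetsI[OF a_subset cauchyD(1)[OF assms]]]
    by (simp add: completion_limit_def)
qed

lemma completion_subset_carrier: "x \<in> carrier Ahat \<Longrightarrow> x n \<subseteq> carrier A"
  using lim_subset_carrier by (metis completionE)

lemma completion_rep:
  assumes "x \<in> carrier Ahat" obtains b where "b \<in> x n" "b \<in> carrier A"
proof -
  obtain a where "cauchy a" "x = lim a" using completionE[OF assms] .
  then show ?thesis using that[of "a n"] lim_mem_iff[of a n "a n"] cauchyD(1) adic.filtration_cong_refl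
    by blast
qed

lemma lim_mult:
  assumes "\<And>n. a n \<in> carrier A" "\<And>n. b n \<in> carrier A"
  shows "lim a \<otimes>\<^bsub>Ahat\<^esub> lim b = lim (\<lambda>n. a n \<otimes> b n)"
  using assms ideal.rcoset_mult_add[OF adic.filtration_ideal]
  by (simp add: completion_limit_def adic_completion_def FactRing_def)

lemma lim_add:
  assumes "\<And>n. a n \<in> carrier A" "\<And>n. b n \<in> carrier A"
  shows "lim a \<oplus>\<^bsub>Ahat\<^esub> lim b = lim (\<lambda>n. a n \<oplus> b n)"
  using assms ideal.a_rcos_sum[OF adic.filtration_ideal]
  by (simp add: completion_limit_def adic_completion_def FactRing_def)

lemma completion_one: "\<one>\<^bsub>Ahat\<^esub> = lim (\<lambda>n. \<one>)"
  by (simp add: completion_limit_def adic_completion_def FactRing_def)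

lemma completion_zero: "\<zero>\<^bsub>Ahat\<^esub> = lim (\<lambda>n. \<zero>)"
proof -
  have "P n +> \<zero> = P n" for n
    by (simp add: additive_subgroup.a_subset adic.filtration_ideal ideal.axioms(1))
  then show ?thesis
    by (simp add: completion_limit_def adic_completion_def FactRing_def)
qed

lemma cauchy_mult: "\<lbrakk>cauchy a; cauchy b\<rbrakk> \<Longrightarrow> cauchy (\<lambda>n. a n \<otimes> b n)"
  by (simp add: cauchy_def adic.filtration_cong_mult)

lemma cauchy_add: "\<lbrakk>cauchy a; cauchy b\<rbrakk> \<Longrightarrow> cauchy (\<lambda>n. a n \<oplus> b n)"
  by (simp add: cauchy_def adic.filtration_cong_add)

lemma cauchy_uminus: "cauchy a \<Longrightarrow> cauchy (\<lambda>n. \<ominus> a n)"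
  by (simp add: cauchy_def adic.filtration_cong_uminus)

lemma cauchy_const: "a \<in> carrier A \<Longrightarrow> cauchy (\<lambda>n. a)"
  by (simp add: cauchy_def adic.filtration_cong_refl)

lemma completion_cring: "cring Ahat"
proof (rule cringI)
  show "abelian_group Ahat"
  proof (rule abelian_groupI)
    fix x y z assume "x \<in> carrier Ahat" "y \<in> carrier Ahat" "z \<in> carrier Ahat"
    then obtain a b c where "cauchy a" "cauchy b" "cauchy c" "x = lim a" "y = lim b" "z = lim c"
      by (metis completionE)
    then show "x \<oplus>\<^bsub>Ahat\<^esub> y \<oplus>\<^bsub>Ahat\<^esub> z = x \<oplus>\<^bsub>Ahat\<^esub> (y \<oplus>\<^bsub>Ahat\<^esub> z)"
      by (simp add: lim_add cauchyD(1) a_assoc)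
  next
    fix x y assume "x \<in> carrier Ahat" "y \<in> carrier Ahat"
    then obtain a b where ab: "cauchy a" "cauchy b" "x = lim a" "y = lim b"
      by (metis completionE)
    then show "x \<oplus>\<^bsub>Ahat\<^esub> y \<in> carrier Ahat"
      by (simp add: lim_add cauchyD(1) lim_carrier cauchy_add)
    from ab show "x \<oplus>\<^bsub>Ahat\<^esub> y = y \<oplus>\<^bsub>Ahat\<^esub> x"
      by (simp add: lim_add cauchyD(1) a_comm)
  next
    show "\<zero>\<^bsub>Ahat\<^esub> \<in> carrier Ahat" by (simp add: completion_zero lim_carrier cauchy_const)
  next
    fix x assume "x \<in> carrier Ahat"
    then obtain a where a: "cauchy a" "x = lim a" by (metis completionE)
    then show "\<zero>\<^bsub>Ahat\<^esub> \<oplus>\<^bsub>Ahat\<^esub> x = x"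
      by (simp add: completion_zero lim_add cauchyD(1))
    show "\<exists>y\<in>carrier Ahat. y \<oplus>\<^bsub>Ahat\<^esub> x = \<zero>\<^bsub>Ahat\<^esub>"
      using a by (intro bexI[of _ "lim (\<lambda>n. \<ominus> a n)"])
        (simp_all add: completion_zero lim_add cauchyD(1) lim_carrier cauchy_uminus l_neg)
  qed
next
  show "comm_monoid Ahat"
  proof (rule comm_monoidI)
    fix x y z assume "x \<in> carrier Ahat" "y \<in> carrier Ahat" "z \<in> carrier Ahat"
    then obtain a b c where "cauchy a" "cauchy b" "cauchy c" "x = lim a" "y = lim b" "z = lim c"
      by (metis completionE)
    then show "x \<otimes>\<^bsub>Ahat\<^esub> y \<otimes>\<^bsub>Ahat\<^esub> z = x \<otimes>\<^bsub>Ahat\<^esub> (y \<otimes>\<^bsub>Ahat\<^esub> z)"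
      by (simp add: lim_mult cauchyD(1) m_assoc)
  next
    fix x y assume "x \<in> carrier Ahat" "y \<in> carrier Ahat"
    then obtain a b where ab: "cauchy a" "cauchy b" "x = lim a" "y = lim b"
      by (metis completionE)
    then show "x \<otimes>\<^bsub>Ahat\<^esub> y \<in> carrier Ahat"
      by (simp add: lim_mult cauchyD(1) lim_carrier cauchy_mult)
    from ab show "x \<otimes>\<^bsub>Ahat\<^esub> y = y \<otimes>\<^bsub>Ahat\<^esub> x"
      by (simp add: lim_mult cauchyD(1) m_comm)
  next
    show "\<one>\<^bsub>Ahat\<^esub> \<in> carrier Ahat" by (simp add: completion_one lim_carrier cauchy_const)
  next
    fix x assume "x \<in> carrier Ahat"
    then obtain a where a: "cauchy a" "x = lim a" by (metis completionE)
    then show "\<one>\<^bsub>Ahat\<^esub> \<otimes>\<^bsub>Ahat\<^esub> x = x"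
      by (simp add: completion_one lim_mult cauchyD(1))
  qed
next
  fix x y z assume "x \<in> carrier Ahat" "y \<in> carrier Ahat" "z \<in> carrier Ahat"
  then obtain a b c where "cauchy a" "cauchy b" "cauchy c" "x = lim a" "y = lim b" "z = lim c"
    by (metis completionE)
  then show "(x \<oplus>\<^bsub>Ahat\<^esub> y) \<otimes>\<^bsub>Ahat\<^esub> z = x \<otimes>\<^bsub>Ahat\<^esub> z \<oplus>\<^bsub>Ahat\<^esub> y \<otimes>\<^bsub>Ahat\<^esub> z"
    by (simp add: lim_add lim_mult cauchyD(1) l_distr)
qed

sublocale hat: cring Ahat by (rule completion_cring)

lemma lim_uminus:
  assumes "cauchy a" shows "\<ominus>\<^bsub>Ahat\<^esub> lim a = lim (\<lambda>n. \<ominus> a n)"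
  using assms by (intro hat.minus_equality)
    (simp_all add: completion_zero lim_add cauchyD(1) lim_carrier cauchy_uminus l_neg)

lemma lim_minus:
  assumes "cauchy a" "cauchy b" shows "lim a \<ominus>\<^bsub>Ahat\<^esub> lim b = lim (\<lambda>n. a n \<ominus> b n)"
  using assms by (simp add: a_minus_def lim_uminus lim_add cauchyD(1))

abbreviation nhd where "nhd \<equiv> completion_nhd A I"

lemma lim_nhd_iff:
  assumes "cauchy a" shows "lim a \<in> nhd n \<longleftrightarrow> a n \<in> P n"
proof -
  have "\<zero>\<^bsub>A Quot P n\<^esub> = P n +> \<zero>"
    using completion_zero by (simp add: adic_completion_def completion_limit_def fun_eq_iff)
  then have "lim a \<in> nhd n \<longleftrightarrow> P n +> a n = P n +> \<zero>"
    using lim_carrier[OF assms] by (simp add: completion_nhd_def completion_limit_def)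
  also have "\<dots> \<longleftrightarrow> a n \<ominus> \<zero> \<in> P n"
    using adic.filtration_coset_eq_iff cauchyD(1)[OF assms] by simp
  finally show ?thesis using cauchyD(1)[OF assms] by (simp add: minus_eq)
qed

lemma nhd_subset: "nhd n \<subseteq> carrier Ahat"
  by (auto simp: completion_nhd_def)

lemma nhdE:
  assumes "x \<in> nhd n"
  obtains a where "cauchy a" "x = lim a" "a n \<in> P n"
proof -
  obtain a where a: "cauchy a" "x = lim a" using assms nhd_subset completionE by blast
  then show ?thesis using that assms lim_nhd_iff by blast
qed

lemma nhd_ideal: "ideal (nhd n) Ahat"
proof (rule idealI)
  show "ring Ahat" by (rule hat.ring_axioms)
  show "subgroup (nhd n) (add_monoid Ahat)"
  proof (rule group.subgroupI)
    show "group (add_monoid Ahat)" by (rule hat.a_group)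
    show "nhd n \<subseteq> carrier (add_monoid Ahat)" using nhd_subset by simp
    have "lim (\<lambda>n. \<zero>) \<in> nhd n" by (simp add: lim_nhd_iff cauchy_const adic.filtration_zero)
    then show "nhd n \<noteq> {}" by blast
  next
    fix x assume x: "x \<in> nhd n"
    obtain a where a: "cauchy a" "x = lim a" by (rule nhdE[OF x])
    then have "\<ominus>\<^bsub>Ahat\<^esub> x \<in> nhd n"
      using x by (simp add: lim_uminus lim_nhd_iff cauchy_uminus adic.filtration_uminus)
    then show "inv\<^bsub>add_monoid Ahat\<^esub> x \<in> nhd n" by (simp add: a_inv_def)
  next
    fix x y assume xy: "x \<in> nhd n" "y \<in> nhd n"
    obtain a where "cauchy a" "x = lim a" by (rule nhdE[OF xy(1)])
    moreover obtain b where "cauchy b" "y = lim b" by (rule nhdE[OF xy(2)])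
    ultimately show "x \<otimes>\<^bsub>add_monoid Ahat\<^esub> y \<in> nhd n"
      using xy by (simp add: lim_add cauchyD(1) lim_nhd_iff cauchy_add adic.filtration_add)
  qed
next
  fix x y assume xy: "x \<in> nhd n" "y \<in> carrier Ahat"
  obtain a where "cauchy a" "x = lim a" by (rule nhdE[OF xy(1)])
  moreover obtain b where "cauchy b" "y = lim b" by (rule completionE[OF xy(2)])
  ultimately show "y \<otimes>\<^bsub>Ahat\<^esub> x \<in> nhd n" "x \<otimes>\<^bsub>Ahat\<^esub> y \<in> nhd n"
    using xy by (simp_all add: lim_mult cauchyD(1) lim_nhd_iff cauchy_mult
      adic.filtration_mult_left adic.filtration_mult_right)
qed

lemma completion_filtered: "filtered_ring Ahat nhd"
proof (intro filtered_ring.intro filtered_ring_axioms.intro completion_cring nhd_ideal)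
  fix n
  show "nhd (Suc n) \<subseteq> nhd n"
  proof
    fix x assume x: "x \<in> nhd (Suc n)"
    obtain a where a: "cauchy a" "x = lim a" by (rule nhdE[OF x])
    then have "a (Suc n) \<in> P n" using x adic.filtration_Suc by (auto simp: lim_nhd_iff)
    then have "a n \<in> P n" using cauchyD[OF a(1)] adic.filtration_cong_mem by blast
    then show "x \<in> nhd n" using a by (simp add: lim_nhd_iff)
  qed
next
  fix x y m n assume xy: "x \<in> nhd m" "y \<in> nhd n"
  obtain a where a: "cauchy a" "x = lim a" by (rule nhdE[OF xy(1)])
  obtain b where b: "cauchy b" "y = lim b" by (rule nhdE[OF xy(2)])
  note ab = a b
  \<comment> \<open>Whether the product lies in the neighbourhood is read off at the index m + n, so
    the membership known at index m is moved there by the Cauchy property.\<close>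
  have "a (m + n) \<in> P m"
    using cauchy_diff[OF ab(1), of m "m + n"] adic.filtration_cong_mem[of "a (m + n)" "a m" m] xy ab cauchyD(1)
    by (simp add: lim_nhd_iff)
  moreover have "b (m + n) \<in> P n"
    using cauchy_diff[OF ab(3), of n "m + n"] adic.filtration_cong_mem[of "b (m + n)" "b n" n] xy ab cauchyD(1)
    by (simp add: lim_nhd_iff)
  ultimately show "x \<otimes>\<^bsub>Ahat\<^esub> y \<in> nhd (m + n)"
    using ab adic.filtration_mult by (simp add: lim_mult cauchyD(1) lim_nhd_iff cauchy_mult)
next
  show "nhd 0 = carrier Ahat"
    using nhd_subset lim_nhd_iff cauchyD(1) by (auto simp: ideal_power_0 elim!: completionE)
qed

sublocale hatf: complete_filtered_ring Ahat nhd
proof (intro complete_filtered_ring.intro complete_filtered_ring_axioms.intro completion_filtered)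
  fix x assume x: "x \<in> carrier Ahat" "\<And>n. x \<in> nhd n"
  then obtain a where a: "cauchy a" "x = lim a" using completionE by blast
  then have "a n \<ominus> \<zero> \<in> P n" for n using x(2)[of n] cauchyD(1)[OF a(1)] by (simp add: lim_nhd_iff a_minus_def)
  then show "x = \<zero>\<^bsub>Ahat\<^esub>"
    unfolding a(2) completion_zero by (subst lim_eq_iff) (auto intro: cauchyD(1)[OF a(1)])
next
  fix c assume c: "\<And>n. c n \<in> carrier Ahat" "\<And>n. c (Suc n) \<ominus>\<^bsub>Ahat\<^esub> c n \<in> nhd n"
  then have "\<forall>n. \<exists>a. cauchy a \<and> c n = lim a" using completion_carrier_iff by blast
  then obtain a where a: "cauchy (a n)" "c n = lim (a n)" for n by metis
  have ac: "a m n \<in> carrier A" for m n using cauchyD(1)[OF a(1)] .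
  have ca: "cauchy (\<lambda>n. a (Suc m) n \<ominus> a m n)" for m
    using cauchy_add[OF a(1) cauchy_uminus[OF a(1)]] by (simp add: a_minus_def)
  have d: "a (Suc n) n \<ominus> a n n \<in> P n" for n
    using c(2)[of n] unfolding a(2) lim_minus[OF a(1) a(1)] lim_nhd_iff[OF ca] .
  \<comment> \<open>The limit is the diagonal sequence: one step inside the sequence
    \<open>a (Suc n)\<close> and one step from \<open>a (Suc n)\<close> to \<open>a n\<close> both
    stay in \<open>P n\<close>.\<close>
  have "a (Suc n) (Suc n) \<ominus> a n n \<in> P n" for n
    using adic.filtration_cong_trans[OF ac ac ac cauchyD(2)[OF a(1)] d] .
  then have cd: "cauchy (\<lambda>n. a n n)" unfolding cauchy_def using ac by blast
  have "c n \<ominus>\<^bsub>Ahat\<^esub> lim (\<lambda>n. a n n) \<in> nhd n" for n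
  proof -
    have *: "cauchy (\<lambda>k. a n k \<ominus> a k k)"
      using cauchy_add[OF a(1) cauchy_uminus[OF cd]] by (simp add: a_minus_def)
    show ?thesis
      unfolding a(2) lim_minus[OF a(1) cd] lim_nhd_iff[OF *] by (rule adic.filtration_cong_refl[OF ac])
  qed
  then show "\<exists>x\<in>carrier Ahat. \<forall>n. c n \<ominus>\<^bsub>Ahat\<^esub> x \<in> nhd n"
    using lim_carrier[OF cd] by blast
qed

abbreviation to where "to \<equiv> to_completion A I"

lemma to_completion_eq_lim: "to a = lim (\<lambda>n. a)"
  by (simp add: to_completion_def completion_limit_def)

lemma to_completion_hom: "to \<in> ring_hom A Ahat"
  by (rule ring_hom_memI)
    (simp_all add: to_completion_eq_lim lim_carrier cauchy_const lim_mult lim_add completion_one)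

sublocale toh: ring_hom_ring A Ahat to
  using to_completion_hom ring_axioms hat.ring_axioms by (intro ring_hom_ringI2)

lemma to_nhd_iff: "a \<in> carrier A \<Longrightarrow> to a \<in> nhd n \<longleftrightarrow> a \<in> P n"
  by (simp add: to_completion_eq_lim lim_nhd_iff cauchy_const)

lemma mem_minus_to_nhd:
  assumes "x \<in> carrier Ahat" "b \<in> x n"
  shows "x \<ominus>\<^bsub>Ahat\<^esub> to b \<in> nhd n"
proof -
  have b: "b \<in> carrier A" using completion_subset_carrier assms by blast
  obtain a where a: "cauchy a" "x = lim a" using completionE[OF assms(1)] .
  have "b \<ominus> a n \<in> P n" using assms a b cauchyD(1) lim_mem_iff by blast
  then have "a n \<ominus> b \<in> P n" using adic.filtration_cong_sym b cauchyD(1) a by blast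
  moreover have "cauchy (\<lambda>n. a n \<ominus> b)"
    using cauchy_add[OF a(1) cauchy_uminus[OF cauchy_const[OF b]]] by (simp add: a_minus_def)
  ultimately show ?thesis
    using a b by (simp add: to_completion_eq_lim lim_minus cauchy_const lim_nhd_iff)
qed

lemma completion_dense:
  assumes "x \<in> carrier Ahat"
  obtains b where "b \<in> carrier A" "b \<in> x n" "x \<ominus>\<^bsub>Ahat\<^esub> to b \<in> nhd n"
proof -
  obtain b where "b \<in> x n" "b \<in> carrier A" by (rule completion_rep[OF assms])
  then show ?thesis using that mem_minus_to_nhd[OF assms] by blast
qed

lemma mem_to: "a \<in> carrier A \<Longrightarrow> a \<in> to a n"
  by (simp add: to_completion_eq_lim lim_mem_iff adic.filtration_cong_refl)

lemma completion_hom_unique: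
  assumes "complete_filtered_ring C G" "f \<in> ring_hom Ahat C" "g \<in> ring_hom Ahat C"
    and eq: "\<And>a. a \<in> carrier A \<Longrightarrow> f (to a) = g (to a)"
    and "\<And>n. \<exists>m. f ` nhd m \<subseteq> G n" "\<And>n. \<exists>m. g ` nhd m \<subseteq> G n"
    and x: "x \<in> carrier Ahat"
  shows "f x = g x"
proof -
  interpret C: complete_filtered_ring C G by fact
  interpret f: ring_hom_ring Ahat C f
    using assms C.ring_axioms hat.ring_axioms by (intro ring_hom_ringI2)
  interpret g: ring_hom_ring Ahat C g
    using assms C.ring_axioms hat.ring_axioms by (intro ring_hom_ringI2)
  show ?thesis
  proof (rule C.filtration_eqI)
    fix n
    obtain m1 m2 where m: "f ` nhd m1 \<subseteq> G n" "g ` nhd m2 \<subseteq> G n" using assms by blast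
    obtain b where b: "b \<in> carrier A" "x \<ominus>\<^bsub>Ahat\<^esub> to b \<in> nhd (max m1 m2)"
      by (rule completion_dense[OF x, of "max m1 m2"])
    then have "x \<ominus>\<^bsub>Ahat\<^esub> to b \<in> nhd m1" "x \<ominus>\<^bsub>Ahat\<^esub> to b \<in> nhd m2"
      using hatf.filtration_antimono[of m1 "max m1 m2"] hatf.filtration_antimono[of m2 "max m1 m2"] by auto
    then have "f (x \<ominus>\<^bsub>Ahat\<^esub> to b) \<in> G n" "g (x \<ominus>\<^bsub>Ahat\<^esub> to b) \<in> G n" using m by blast+
    then have 1: "f x \<ominus>\<^bsub>C\<^esub> f (to b) \<in> G n" "g x \<ominus>\<^bsub>C\<^esub> g (to b) \<in> G n"
      using x b by (simp_all add: f.hom_minus g.hom_minus)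
    then have "f (to b) \<ominus>\<^bsub>C\<^esub> g x \<in> G n"
      using C.filtration_cong_sym[OF _ _ 1(2)] x b eq by simp
    then show "f x \<ominus>\<^bsub>C\<^esub> g x \<in> G n"
      using C.filtration_cong_trans[OF _ _ _ 1(1)] x b by simp
  qed (use x in auto)
qed

text \<open>The value at x is the limit of \<open>h\<close> along representatives. The last
  conclusion records the approximation for every representative, so that values on limits can later
  be estimated from the uncompleted ring.\<close>

lemma completion_hom_extend:
  assumes "complete_filtered_ring C G" "h \<in> ring_hom A C" "\<And>n. h ` P n \<subseteq> G n"
  obtains f where "f \<in> ring_hom Ahat C" "f \<in> extensional (carrier Ahat)"
    "\<And>a. a \<in> carrier A \<Longrightarrow> f (to a) = h a"
    "\<And>n. f ` nhd n \<subseteq> G n"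
    "\<And>x a n. \<lbrakk>x \<in> carrier Ahat; a \<in> x n\<rbrakk> \<Longrightarrow> f x \<ominus>\<^bsub>C\<^esub> h a \<in> G n"
proof -
  interpret C: complete_filtered_ring C G by fact
  interpret h: ring_hom_ring A C h
    using assms C.ring_axioms ring_axioms by (intro ring_hom_ringI2)
  have hP: "h a \<ominus>\<^bsub>C\<^esub> h b \<in> G n" if "a \<in> carrier A" "b \<in> carrier A" "a \<ominus> b \<in> P n" for a b n
    using h.hom_minus[OF that(1,2)] that(3) assms(3)[of n] by auto
  have "\<exists>c\<in>carrier C. \<forall>n. \<forall>b\<in>x n. c \<ominus>\<^bsub>C\<^esub> h b \<in> G n" if x: "x \<in> carrier Ahat" for x
  proof -
    obtain a where a: "cauchy a" "x = lim a" using completionE[OF x] .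
    note ac = cauchyD(1)[OF a(1)]
    have "\<exists>c\<in>carrier C. \<forall>n. h (a n) \<ominus>\<^bsub>C\<^esub> c \<in> G n"
      using C.filtration_complete[of "\<lambda>n. h (a n)"] ac hP[OF ac ac cauchyD(2)[OF a(1)]] by simp
    then obtain c where c: "c \<in> carrier C" "\<And>n. h (a n) \<ominus>\<^bsub>C\<^esub> c \<in> G n" by blast
    have "c \<ominus>\<^bsub>C\<^esub> h b \<in> G n" if "b \<in> x n" for b n
    proof -
      have b: "b \<in> carrier A" using that a lim_subset_carrier by blast
      then have "h b \<ominus>\<^bsub>C\<^esub> h (a n) \<in> G n" using hP[OF b ac] that a ac lim_mem_iff by simp
      then have "h (a n) \<ominus>\<^bsub>C\<^esub> h b \<in> G n"
        by (rule C.filtration_cong_sym[OF h.hom_closed[OF b] h.hom_closed[OF ac]])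
      then show ?thesis
        by (rule C.filtration_cong_trans[OF c(1) h.hom_closed[OF ac] h.hom_closed[OF b]
          C.filtration_cong_sym[OF h.hom_closed[OF ac] c]])
    qed
    then show ?thesis using c(1) by blast
  qed
  then have "\<forall>x\<in>carrier Ahat. \<exists>c. c \<in> carrier C \<and> (\<forall>n. \<forall>b\<in>x n. c \<ominus>\<^bsub>C\<^esub> h b \<in> G n)"
    by blast
  from bchoice[OF this] obtain f0 where f0: "\<forall>x\<in>carrier Ahat. f0 x \<in> carrier C \<and>
    (\<forall>n. \<forall>b\<in>x n. f0 x \<ominus>\<^bsub>C\<^esub> h b \<in> G n)" ..
  define f where "f = restrict f0 (carrier Ahat)"
  have f: "x \<in> carrier Ahat \<Longrightarrow> f x \<in> carrier C"
    "x \<in> carrier Ahat \<Longrightarrow> b \<in> x n \<Longrightarrow> f x \<ominus>\<^bsub>C\<^esub> h b \<in> G n" for x n b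
    using f0 by (simp_all add: f_def)
  \<comment> \<open>One representative per level with the right approximation determines the value,
    so each ring law reduces to a congruence between representatives.\<close>
  have f_eqI: "f x = c" if wit: "x \<in> carrier Ahat" "c \<in> carrier C"
    "\<And>n. \<exists>b\<in>carrier A. b \<in> x n \<and> c \<ominus>\<^bsub>C\<^esub> h b \<in> G n" for x c
  proof (rule C.filtration_eqI)
    fix n
    obtain b where b: "b \<in> carrier A" "b \<in> x n" "c \<ominus>\<^bsub>C\<^esub> h b \<in> G n" using wit(3)[of n] by auto
    show "f x \<ominus>\<^bsub>C\<^esub> c \<in> G n"
      by (rule C.filtration_cong_trans2[OF f(1)[OF wit(1)] h.hom_closed[OF b(1)] wit(2)
        f(2)[OF wit(1) b(2)] b(3)])
  qed (rule f(1)[OF wit(1)], rule wit(2))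
  have f_to: "f (to a) = h a" if a: "a \<in> carrier A" for a
  proof (rule f_eqI)
    show "\<exists>b\<in>carrier A. b \<in> to a n \<and> h a \<ominus>\<^bsub>C\<^esub> h b \<in> G n" for n
      using a mem_to[OF a] C.filtration_cong_refl[OF h.hom_closed[OF a]] by blast
  qed (use a in simp_all)
  have f_hom: "f \<in> ring_hom Ahat C"
  proof (rule ring_hom_memI)
    fix x y assume xy: "x \<in> carrier Ahat" "y \<in> carrier Ahat"
    obtain a where a: "cauchy a" "x = lim a" by (rule completionE[OF xy(1)])
    obtain b where b: "cauchy b" "y = lim b" by (rule completionE[OF xy(2)])
    note ab = a(1) b(1) a(2) b(2)
    note ac = cauchyD(1)[OF ab(1)] and bc = cauchyD(1)[OF ab(2)]
    have fa: "f x \<ominus>\<^bsub>C\<^esub> h (a n) \<in> G n" and fb: "f y \<ominus>\<^bsub>C\<^esub> h (b n) \<in> G n" for n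
      using f(2)[OF xy(1)] f(2)[OF xy(2)] mem_lim[OF ab(1)] mem_lim[OF ab(2)] ab(3,4) by blast+
    show "f (x \<otimes>\<^bsub>Ahat\<^esub> y) = f x \<otimes>\<^bsub>C\<^esub> f y"
    proof (rule f_eqI)
      fix n
      have "f x \<otimes>\<^bsub>C\<^esub> f y \<ominus>\<^bsub>C\<^esub> h (a n \<otimes> b n) \<in> G n"
        using C.filtration_cong_mult[OF f(1)[OF xy(1)] f(1)[OF xy(2)] h.hom_closed[OF ac] h.hom_closed[OF bc] fa fb] ac bc by simp
      moreover have "a n \<otimes> b n \<in> (x \<otimes>\<^bsub>Ahat\<^esub> y) n"
        using mem_lim[OF cauchy_mult[OF ab(1,2)]] unfolding ab(3,4) lim_mult[OF ac bc] .
      ultimately show "\<exists>c\<in>carrier A. c \<in> (x \<otimes>\<^bsub>Ahat\<^esub> y) n \<and> f x \<otimes>\<^bsub>C\<^esub> f y \<ominus>\<^bsub>C\<^esub> h c \<in> G n"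
        using ac bc by blast
    qed (use xy f(1) in simp_all)
    show "f (x \<oplus>\<^bsub>Ahat\<^esub> y) = f x \<oplus>\<^bsub>C\<^esub> f y"
    proof (rule f_eqI)
      fix n
      have "f x \<oplus>\<^bsub>C\<^esub> f y \<ominus>\<^bsub>C\<^esub> h (a n \<oplus> b n) \<in> G n"
        using C.filtration_cong_add[OF f(1)[OF xy(1)] f(1)[OF xy(2)] h.hom_closed[OF ac] h.hom_closed[OF bc] fa fb] ac bc by simp
      moreover have "a n \<oplus> b n \<in> (x \<oplus>\<^bsub>Ahat\<^esub> y) n"
        using mem_lim[OF cauchy_add[OF ab(1,2)]] unfolding ab(3,4) lim_add[OF ac bc] .
      ultimately show "\<exists>c\<in>carrier A. c \<in> (x \<oplus>\<^bsub>Ahat\<^esub> y) n \<and> f x \<oplus>\<^bsub>C\<^esub> f y \<ominus>\<^bsub>C\<^esub> h c \<in> G n"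
        using ac bc by blast
    qed (use xy f(1) in simp_all)
  next
    show "f \<one>\<^bsub>Ahat\<^esub> = \<one>\<^bsub>C\<^esub>" using f_to[of \<one>] by simp
  qed (rule f(1))
  have f_nhd: "f ` nhd n \<subseteq> G n" for n
  proof clarify
    fix x assume x: "x \<in> nhd n"
    then have xc: "x \<in> carrier Ahat" using nhd_subset by blast
    obtain a where a: "cauchy a" "x = lim a" by (rule completionE[OF xc])
    then have "a n \<in> P n" using x lim_nhd_iff by blast
    then have "h (a n) \<in> G n" using assms(3) by blast
    moreover have "f x \<ominus>\<^bsub>C\<^esub> h (a n) \<in> G n"
      using f(2)[OF xc] mem_lim[OF a(1)] a(2) by blast
    ultimately show "f x \<in> G n"
      using C.filtration_cong_mem[OF f(1)[OF xc] h.hom_closed[OF cauchyD(1)[OF a(1)]]] by blast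
  qed
  show ?thesis
    by (rule that[OF f_hom _ f_to f_nhd f(2)]) (simp_all add: f_def extensional_def)
qed

lemma adically_complete_imp_complete_filtered:
  assumes "adically_complete A I" shows "complete_filtered_ring A P"
proof (intro complete_filtered_ring.intro complete_filtered_ring_axioms.intro adic.filtered_ring_axioms)
  have bij: "bij_betw to (carrier A) (carrier Ahat)" using assms by (simp add: adically_complete_def)
  {
    fix x assume x: "x \<in> carrier A" "\<And>n. x \<in> P n"
    then have "x \<ominus> \<zero> \<in> P n" for n by (simp add: a_minus_def)
    then have "to x = to \<zero>"
      unfolding to_completion_eq_lim by (subst lim_eq_iff) (use x(1) in auto)
    then show "x = \<zero>" using bij x(1) inj_onD[of to "carrier A" x \<zero>] by (simp add: bij_betw_def)
  next
    fix c assume "\<And>n. c n \<in> carrier A" "\<And>n. c (Suc n) \<ominus> c n \<in> P n"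
    then have c: "cauchy c" by (simp add: cauchy_def)
    have "lim c \<in> to ` carrier A"
      using lim_carrier[OF c] bij by (simp add: bij_betw_def)
    then obtain x where x: "x \<in> carrier A" "lim c = lim (\<lambda>n. x)"
      by (auto simp: to_completion_eq_lim)
    then have "\<forall>n. c n \<ominus> x \<in> P n"
      using lim_eq_iff[of c "\<lambda>n. x"] cauchyD(1)[OF c] by blast
    then show "\<exists>x\<in>carrier A. \<forall>n. c n \<ominus> x \<in> P n"
      using x(1) by blast
  }
qed

end

section \<open>Power series in complete rings\<close>

lemma type_ring_simps [simp]:
  "carrier (ring_of_type_algebra :: 'a::ring_1 ring) = UNIV"
  "monoid.mult (ring_of_type_algebra :: 'a ring) x y = x * y"
  "monoid.one (ring_of_type_algebra :: 'a ring) = 1"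
  "ring.zero (ring_of_type_algebra :: 'a ring) = 0"
  "ring.add (ring_of_type_algebra :: 'a ring) x y = x + y"
  by (simp_all add: ring_of_type_algebra_def)

lemma type_ring_uminus [simp]: "a_inv (ring_of_type_algebra :: 'a::comm_ring_1 ring) x = - x"
proof -
  interpret ring "ring_of_type_algebra :: 'a ring" by (rule ring_from_type_algebra)
  show ?thesis by (rule minus_equality) simp_all
qed

lemma type_ring_minus [simp]: "a_minus (ring_of_type_algebra :: 'a::comm_ring_1 ring) x y = x - y"
  by (simp add: a_minus_def)

section \<open>Neighbourhoods of zero when the ideal has two generators\<close>

context adic_ring
begin

text \<open>A sequence representing z is divided by the two generators step by step: each increment
  lies in a power of the ideal and splits into cofactors one power lower, which are added to the
  cofactors found so far. The cofactors form Cauchy sequences, and their limits solve the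
  equation.\<close>

lemma nhd_pair_Suc:
  assumes ab: "a \<in> carrier A" "b \<in> carrier A" and I: "I = Idl {a, b}"
    and z: "z \<in> nhd (Suc n)"
  shows "\<exists>x\<in>nhd n. \<exists>y\<in>nhd n. z = to a \<otimes>\<^bsub>Ahat\<^esub> x \<oplus>\<^bsub>Ahat\<^esub> to b \<otimes>\<^bsub>Ahat\<^esub> y"
proof -
  obtain c where c: "cauchy c" "z = lim c" "c (Suc n) \<in> P (Suc n)" by (rule nhdE[OF z])
  note cc = cauchyD(1)[OF c(1)]
  have Pc: "x \<in> carrier A" if "x \<in> P k" for x k using adic.filtration_carrier[OF that] .
  \<comment> \<open>The construction stands still until stage n: the splitting of
    \<open>c (Suc n)\<close> already has cofactors in \<open>P n\<close>, and only the later
    increments are small enough to keep them there.\<close>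
  define good where "good N w \<longleftrightarrow> fst w \<in> P n \<and> snd w \<in> P n \<and>
    a \<otimes> fst w \<oplus> b \<otimes> snd w = c (Suc (max n N))" for N w
  define step where "step N w w' \<longleftrightarrow> fst w' \<ominus> fst w \<in> P N \<and> snd w' \<ominus> snd w \<in> P N" for N w w'
  have "\<exists>f. \<forall>N. good N (f N) \<and> step N (f N) (f (Suc N))"
  proof (rule dependent_nat_choice)
    obtain s t where "s \<in> P n" "t \<in> P n" "c (Suc n) = a \<otimes> s \<oplus> b \<otimes> t"
      using ideal_power_pair_Suc_mem[OF ab] c(3) unfolding I by metis
    then have "good 0 (s, t)" by (simp add: good_def)
    then show "\<exists>w. good 0 w" by blast
  next
    fix w N assume w: "good N w"
    then have wP: "fst w \<in> P n" "snd w \<in> P n" by (simp_all add: good_def)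
    then have wc: "fst w \<in> carrier A" "snd w \<in> carrier A" using Pc by blast+
    show "\<exists>w'. good (Suc N) w' \<and> step N w w'"
    proof (cases "N < n")
      case True
      then have "good (Suc N) w" "step N w w"
        using w wc adic.filtration_cong_refl by (simp_all add: good_def step_def max.absorb1)
      then show ?thesis by blast
    next
      case False
      have "c (Suc (Suc N)) \<ominus> c (Suc N) \<in> P (Suc N)" by (rule cauchyD(2)[OF c(1)])
      then obtain d e where de: "d \<in> P N" "e \<in> P N" "c (Suc (Suc N)) \<ominus> c (Suc N) = a \<otimes> d \<oplus> b \<otimes> e"
        using ideal_power_pair_Suc_mem[OF ab] unfolding I by metis
      have dec: "d \<in> carrier A" "e \<in> carrier A" using Pc de by blast+
      have "a \<otimes> fst w \<oplus> b \<otimes> snd w = c (Suc N)" using w False by (simp add: good_def max_def)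
      moreover have "c (Suc (Suc N)) = c (Suc N) \<oplus> (c (Suc (Suc N)) \<ominus> c (Suc N))"
        using cc[of "Suc N"] cc[of "Suc (Suc N)"] by algebra
      ultimately have "c (Suc (Suc N)) = (a \<otimes> fst w \<oplus> b \<otimes> snd w) \<oplus> (a \<otimes> d \<oplus> b \<otimes> e)"
        using de(3) by simp
      also have "\<dots> = a \<otimes> (fst w \<oplus> d) \<oplus> b \<otimes> (snd w \<oplus> e)"
        using ab wc dec by algebra
      finally have 1: "a \<otimes> (fst w \<oplus> d) \<oplus> b \<otimes> (snd w \<oplus> e) = c (Suc (Suc N))" ..
      have "d \<in> P n" "e \<in> P n" using de adic.filtration_antimono[of n N] False by auto
      then have "good (Suc N) (fst w \<oplus> d, snd w \<oplus> e)"
        using 1 wP False adic.filtration_add by (simp add: good_def max_def)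
      moreover have "(fst w \<oplus> d) \<ominus> fst w = d" "(snd w \<oplus> e) \<ominus> snd w = e"
        using wc dec by algebra+
      then have "step N w (fst w \<oplus> d, snd w \<oplus> e)" using de by (simp add: step_def)
      ultimately show ?thesis by blast
    qed
  qed
  then obtain f where f: "good N (f N)" "step N (f N) (f (Suc N))" for N by blast
  define s t where "s N = fst (f N)" and "t N = snd (f N)" for N
  have sP: "s N \<in> P n" "t N \<in> P n" for N using f(1)[of N] by (simp_all add: good_def s_def t_def)
  have sc: "s N \<in> carrier A" "t N \<in> carrier A" for N using Pc sP by blast+
  have eq: "a \<otimes> s N \<oplus> b \<otimes> t N = c (Suc (max n N))" for N
    using f(1)[of N] by (simp add: good_def s_def t_def)
  have cs: "cauchy s" "cauchy t"
    using f(2) sc by (simp_all add: cauchy_def step_def s_def t_def)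
  have "to a \<otimes>\<^bsub>Ahat\<^esub> lim s \<oplus>\<^bsub>Ahat\<^esub> to b \<otimes>\<^bsub>Ahat\<^esub> lim t = lim (\<lambda>N. c (Suc (max n N)))"
    using ab sc by (simp add: to_completion_eq_lim lim_mult lim_add eq)
  also have "\<dots> = z"
    unfolding c(2) lim_eq_iff[of "\<lambda>N. c (Suc (max n N))" c, OF cc cc]
    using cauchy_diff[OF c(1)] by simp
  finally have "z = to a \<otimes>\<^bsub>Ahat\<^esub> lim s \<oplus>\<^bsub>Ahat\<^esub> to b \<otimes>\<^bsub>Ahat\<^esub> lim t" ..
  moreover have "lim s \<in> nhd n" "lim t \<in> nhd n" using cs sP lim_nhd_iff by blast+
  ultimately show ?thesis by blast
qed

text \<open>Splitting off a generator n times shows that the kernel of the n-th projection is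
  generated by n-fold products. It makes every ring morphism that sends both generators into the
  first step of a filtration continuous.\<close>

lemma nhd_pair_subset:
  assumes ab: "a \<in> carrier A" "b \<in> carrier A" and I: "I = Idl {a, b}"
  shows "nhd n \<subseteq> ideal_power Ahat (genideal Ahat {to a, to b}) n"
proof (induction n)
  case 0
  then show ?case using nhd_subset by (simp add: ideal_power_0)
next
  case (Suc n)
  let ?J = "genideal Ahat {to a, to b}"
  have gen: "{to a, to b} \<subseteq> carrier Ahat" using ab by auto
  have J: "ideal ?J Ahat" by (rule hat.genideal_ideal[OF gen])
  have abJ: "to a \<in> ?J" "to b \<in> ?J" using hat.genideal_self[OF gen] by auto
  show ?case
  proof
    fix z assume "z \<in> nhd (Suc n)"
    then obtain x y where xy: "x \<in> nhd n" "y \<in> nhd n"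
      "z = to a \<otimes>\<^bsub>Ahat\<^esub> x \<oplus>\<^bsub>Ahat\<^esub> to b \<otimes>\<^bsub>Ahat\<^esub> y" using nhd_pair_Suc[OF ab I] by blast
    have xyc: "x \<in> carrier Ahat" "y \<in> carrier Ahat" using xy nhd_subset by blast+
    have "x \<otimes>\<^bsub>Ahat\<^esub> to a \<oplus>\<^bsub>Ahat\<^esub> y \<otimes>\<^bsub>Ahat\<^esub> to b \<in> ideal_prod Ahat (ideal_power Ahat ?J n) ?J"
      using Suc xy abJ by (intro ideal_prod.intros) auto
    then show "z \<in> ideal_power Ahat ?J (Suc n)"
      using xy(3) xyc ab by (simp add: ideal_power_Suc hat.m_comm)
  qed
qed

end

section \<open>Evaluation of power series at topologically nilpotent elements\<close>

lemma fps_shift_1_mult: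
  "fps_shift 1 (f * g) = fps_const (f $ 0) * fps_shift 1 g + fps_shift 1 f * (g :: 'a::comm_ring_1 fps)"
proof (rule fps_ext)
  fix n
  have "(f * g) $ Suc n = f $ 0 * g $ Suc n + (\<Sum>i=0..n. f $ Suc i * g $ (n - i))"
    unfolding fps_mult_nth by (subst sum.atLeast0_atMost_Suc_shift) simp
  then show "fps_shift 1 (f * g) $ n = (fps_const (f $ 0) * fps_shift 1 g + fps_shift 1 f * g) $ n"
    by (simp add: fps_mult_nth[of "fps_shift (Suc 0) f" g])
qed

lemma fps_decompose: "f = fps_const (f $ 0) + fps_X * fps_shift 1 (f :: 'a::comm_ring_1 fps)"
  by (rule fps_ext) (simp add: fps_X_mult_nth)

context complete_filtered_ring
begin

text \<open>The Horner scheme for the first n coefficients. Recursion along \<open>fps_shift\<close>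
  instead of a finite sum lets all identities be proved by induction on n from the decomposition of
  a series into constant term and shift.\<close>

primrec power_series_sum :: "('s::comm_ring_1 \<Rightarrow> 'a) \<Rightarrow> 'a \<Rightarrow> nat \<Rightarrow> 's fps \<Rightarrow> 'a" where
  "power_series_sum h b 0 f = \<zero>"
| "power_series_sum h b (Suc n) f = h (f $ 0) \<oplus> b \<otimes> power_series_sum h b n (fps_shift 1 f)"

text \<open>The truncated values are additive exactly but multiplicative only modulo
  \<open>G n\<close>, since each Horner step multiplies the error by b, an element of
  \<open>G 1\<close>. The limit is a ring morphism.\<close>

lemma power_series_hom_exists:
  fixes \<sigma> :: "'s::comm_ring_1 \<Rightarrow> 'a"
  assumes \<sigma>: "\<sigma> \<in> ring_hom ring_of_type_algebra C" and b: "b \<in> G 1"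
  shows "\<exists>F \<in> ring_hom ring_of_type_algebra C. (\<forall>s. F (fps_const s) = \<sigma> s) \<and> F fps_X = b"
proof -
  let ?S = "power_series_sum \<sigma> b"
  interpret \<sigma>: ring_hom_ring "ring_of_type_algebra :: 's ring" C \<sigma>
    using \<sigma> ring_axioms ring_from_type_algebra by (intro ring_hom_ringI2)
  have \<sigma>_simps: "\<sigma> x \<in> carrier C" "\<sigma> (x + y) = \<sigma> x \<oplus> \<sigma> y" "\<sigma> (x * y) = \<sigma> x \<otimes> \<sigma> y"
    "\<sigma> 0 = \<zero>" "\<sigma> 1 = \<one>" for x y
    using \<sigma>.hom_closed[of x] \<sigma>.hom_add[of x y] \<sigma>.hom_mult[of x y] \<sigma>.hom_zero \<sigma>.hom_one by simp_all
  have bc: "b \<in> carrier C" using filtration_carrier[OF b] .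
  have Sc: "?S n f \<in> carrier C" for n f
    by (induction n arbitrary: f) (simp_all add: bc \<sigma>_simps)
  have bG: "b \<otimes> x \<in> G (Suc n)" if "x \<in> G n" for x n
    using filtration_mult[OF b that] by simp
  have S_add: "?S n (f + g) = ?S n f \<oplus> ?S n g" for n f g
  proof (induction n arbitrary: f g)
    case (Suc n)
    have "\<sigma> (f $ 0) \<oplus> \<sigma> (g $ 0) \<oplus> b \<otimes> (?S n (fps_shift 1 f) \<oplus> ?S n (fps_shift 1 g)) =
      (\<sigma> (f $ 0) \<oplus> b \<otimes> ?S n (fps_shift 1 f)) \<oplus> (\<sigma> (g $ 0) \<oplus> b \<otimes> ?S n (fps_shift 1 g))"
      using \<sigma>_simps(1)[of "f $ 0"] \<sigma>_simps(1)[of "g $ 0"] bc Sc[of n "fps_shift 1 f"]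
        Sc[of n "fps_shift 1 g"] by algebra
    then show ?case
      using Suc[of "fps_shift 1 f" "fps_shift 1 g"] fps_shift_add[of 1 f g] by (simp add: \<sigma>_simps)
  qed simp
  have S_smult: "?S n (fps_const c * f) = \<sigma> c \<otimes> ?S n f" for n c f
  proof (induction n arbitrary: f)
    case (Suc n)
    have "fps_shift 1 (fps_const c * f) = fps_const c * fps_shift 1 f" by (rule fps_ext) simp
    moreover have "\<sigma> c \<otimes> \<sigma> (f $ 0) \<oplus> b \<otimes> (\<sigma> c \<otimes> ?S n (fps_shift 1 f)) =
      \<sigma> c \<otimes> (\<sigma> (f $ 0) \<oplus> b \<otimes> ?S n (fps_shift 1 f))"
      using \<sigma>_simps(1)[of "f $ 0"] \<sigma>_simps(1)[of c] bc Sc[of n "fps_shift 1 f"] by algebra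
    ultimately show ?case by (simp add: \<sigma>_simps Suc)
  qed (simp add: \<sigma>_simps)
  have S_0: "?S n 0 = \<zero>" for n using S_smult[of n 0 0] by (simp add: \<sigma>_simps Sc)
  have shift_const: "fps_shift (Suc 0) (fps_const s) = 0" for s :: 's by (rule fps_ext) simp
  have shift_one: "fps_shift (Suc 0) 1 = (0 :: 's fps)" by (rule fps_ext) simp
  have S_Suc: "?S (Suc n) f \<ominus> ?S n f \<in> G n" for n f
  proof (induction n arbitrary: f)
    case 0
    then show ?case using Sc[of 1 f] by (simp add: filtration_0)
  next
    case (Suc n)
    let ?f = "fps_shift 1 f"
    have "(\<sigma> (f $ 0) \<oplus> b \<otimes> ?S (Suc n) ?f) \<ominus> (\<sigma> (f $ 0) \<oplus> b \<otimes> ?S n ?f) = b \<otimes> (?S (Suc n) ?f \<ominus> ?S n ?f)"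
      using \<sigma>_simps(1)[of "f $ 0"] bc Sc[of n ?f] Sc[of "Suc n" ?f] by algebra
    then show ?case using bG[OF Suc.IH[of ?f]] by (subst (1 2) power_series_sum.simps(2)) simp
  qed
  have S_mult: "?S n (f * g) \<ominus> ?S n f \<otimes> ?S n g \<in> G n" for n f g
  proof (induction n arbitrary: f g)
    case 0
    then show ?case by (simp add: filtration_0)
  next
    case (Suc n)
    let ?f = "fps_shift 1 f" and ?g = "fps_shift 1 g"
    define f0 g0 where "f0 = \<sigma> (f $ 0)" and "g0 = \<sigma> (g $ 0)"
    have c: "f0 \<in> carrier C" "g0 \<in> carrier C" by (simp_all add: f0_def g0_def \<sigma>_simps)
    \<comment> \<open>In the shift of a product one summand contains g unshifted. The induction
      hypothesis gives its truncation at n, whereas the product needs the truncation at n + 1; the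
      two agree modulo \<open>G n\<close>.\<close>
    have "?S n (?f * g) \<ominus> ?S n ?f \<otimes> ?S n g \<in> G n" by (rule Suc.IH)
    moreover have "?S n ?f \<otimes> ?S n g \<ominus> ?S n ?f \<otimes> ?S (Suc n) g \<in> G n"
      by (rule filtration_cong_mult[OF Sc Sc Sc Sc filtration_cong_refl[OF Sc]
        filtration_cong_sym[OF Sc Sc S_Suc]])
    ultimately have d: "?S n (?f * g) \<ominus> ?S n ?f \<otimes> ?S (Suc n) g \<in> G n"
      by (rule filtration_cong_trans[OF Sc m_closed[OF Sc Sc] m_closed[OF Sc Sc]])
    define x where "x = ?S n (?f * g)"
    define y where "y = ?S n ?g"
    define z where "z = ?S n ?f"
    have xyz: "x \<in> carrier C" "y \<in> carrier C" "z \<in> carrier C" by (simp_all add: x_def y_def z_def Sc)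
    have Sg: "?S (Suc n) g = g0 \<oplus> b \<otimes> y" by (simp add: y_def g0_def)
    have "?S (Suc n) (f * g) = f0 \<otimes> g0 \<oplus> b \<otimes> (f0 \<otimes> y \<oplus> x)"
      by (simp add: fps_shift_1_mult S_add S_smult \<sigma>_simps f0_def g0_def x_def y_def del: One_nat_def)
    moreover have "?S (Suc n) f \<otimes> ?S (Suc n) g = (f0 \<oplus> b \<otimes> z) \<otimes> (g0 \<oplus> b \<otimes> y)"
      by (simp add: f0_def g0_def y_def z_def)
    moreover have "(f0 \<otimes> g0 \<oplus> b \<otimes> (f0 \<otimes> y \<oplus> x)) \<ominus> (f0 \<oplus> b \<otimes> z) \<otimes> (g0 \<oplus> b \<otimes> y) =
      b \<otimes> (x \<ominus> z \<otimes> (g0 \<oplus> b \<otimes> y))"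
      using c xyz bc by algebra
    ultimately show ?case using bG[OF d] unfolding Sg by (simp add: x_def z_def)
  qed
  have "\<exists>x\<in>carrier C. \<forall>n. ?S n f \<ominus> x \<in> G n" for f
    using filtration_complete[of "\<lambda>n. ?S n f", OF Sc S_Suc] .
  then have "\<forall>f. \<exists>x. x \<in> carrier C \<and> (\<forall>n. ?S n f \<ominus> x \<in> G n)" by blast
  from choice[OF this] obtain F where F: "\<forall>f. F f \<in> carrier C \<and> (\<forall>n. ?S n f \<ominus> F f \<in> G n)" ..
  have Fc: "F f \<in> carrier C" and FS: "?S n f \<ominus> F f \<in> G n" for f n using F by simp_all
  have FS': "F f \<ominus> ?S n f \<in> G n" for f n by (rule filtration_cong_sym[OF Sc Fc FS])
  have F_eqI: "F f = x" if x: "x \<in> carrier C" "\<And>n. ?S n f \<ominus> x \<in> G n" for f x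
  proof (rule filtration_eqI[OF Fc x(1)])
    show "F f \<ominus> x \<in> G n" for n by (rule filtration_cong_trans[OF Fc Sc x(1) FS' x(2)])
  qed
  have "F \<in> ring_hom ring_of_type_algebra C"
  proof (rule ring_hom_memI)
    fix f g
    have "?S n (f * g) \<ominus> F f \<otimes> F g \<in> G n" for n
      by (rule filtration_cong_trans[OF Sc m_closed[OF Sc Sc] m_closed[OF Fc Fc] S_mult
        filtration_cong_mult[OF Sc Sc Fc Fc FS FS]])
    then have "F (f * g) = F f \<otimes> F g" using Fc by (intro F_eqI) simp_all
    then show "F (f \<otimes>\<^bsub>ring_of_type_algebra\<^esub> g) = F f \<otimes> F g" by simp
    have "?S n (f + g) \<ominus> (F f \<oplus> F g) \<in> G n" for n
      unfolding S_add by (rule filtration_cong_add[OF Sc Sc Fc Fc FS FS])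
    then have "F (f + g) = F f \<oplus> F g" using Fc by (intro F_eqI) simp_all
    then show "F (f \<oplus>\<^bsub>ring_of_type_algebra\<^esub> g) = F f \<oplus> F g" by simp
  next
    have S1: "?S (Suc n) 1 = \<one>" for n
      using bc by (simp add: \<sigma>_simps S_0 shift_const shift_one)
    have "?S n 1 \<ominus> \<one> \<in> G n" for n
      by (cases n) (simp_all add: S1 filtration_0 filtration_cong_refl del: power_series_sum.simps(2))
    then show "F \<one>\<^bsub>ring_of_type_algebra\<^esub> = \<one>" by (intro F_eqI) simp_all
  qed (simp add: Fc)
  moreover have "F (fps_const s) = \<sigma> s" for s
  proof (rule F_eqI)
    have S1: "?S (Suc n) (fps_const s) = \<sigma> s" for n
      using bc by (simp add: \<sigma>_simps S_0 shift_const shift_one)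
    show "?S n (fps_const s) \<ominus> \<sigma> s \<in> G n" for n
      by (cases n) (simp_all add: S1 filtration_0 filtration_cong_refl \<sigma>_simps del: power_series_sum.simps(2))
  qed (simp add: \<sigma>_simps)
  moreover have "F fps_X = b"
  proof (rule F_eqI)
    have "fps_shift 1 (fps_X :: 's fps) = 1" by (rule fps_ext) (simp add: fps_X_def)
    then have S1: "?S (Suc (Suc n)) fps_X = b" for n
      using bc by (simp add: \<sigma>_simps S_0 shift_one)
    show "?S n fps_X \<ominus> b \<in> G n" for n
    proof (cases n)
      case (Suc m)
      show ?thesis
      proof (cases m)
        case 0
        have "\<zero> \<oplus> \<zero> \<ominus> b \<in> G 1" using filtration_uminus[OF b] bc by (simp add: a_minus_def)
        then show ?thesis using 0 Suc bc by (simp add: \<sigma>_simps)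
      next
        case (Suc k)
        then show ?thesis using S1 \<open>n = Suc m\<close>
          by (simp add: filtration_cong_refl bc del: power_series_sum.simps(2))
      qed
    qed (simp add: filtration_0 bc)
  qed (rule bc)
  ultimately show ?thesis by blast
qed

text \<open>No continuity has to be assumed: it follows from the fact that the image of \<^term>\<open>fps_X\<close> is
  topologically nilpotent.\<close>

lemma power_series_hom_unique:
  fixes F F' :: "'s::comm_ring_1 fps \<Rightarrow> 'a"
  assumes "F \<in> ring_hom ring_of_type_algebra C" "F' \<in> ring_hom ring_of_type_algebra C"
    and const: "\<And>s. F (fps_const s) = F' (fps_const s)" and X: "F fps_X = F' fps_X" "F fps_X \<in> G 1"
  shows "F = F'"
proof
  fix f
  interpret F: ring_hom_ring "ring_of_type_algebra :: 's fps ring" C F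
    using assms(1) ring_axioms ring_from_type_algebra by (intro ring_hom_ringI2)
  interpret F': ring_hom_ring "ring_of_type_algebra :: 's fps ring" C F'
    using assms(2) ring_axioms ring_from_type_algebra by (intro ring_hom_ringI2)
  have c: "F f \<in> carrier C" "F' f \<in> carrier C" for f
    using F.hom_closed[of f] F'.hom_closed[of f] by simp_all
  have "F f \<ominus> F' f \<in> G n" for n
  proof (induction n arbitrary: f)
    case 0
    then show ?case by (simp add: filtration_0 c)
  next
    case (Suc n)
    let ?f = "fps_shift 1 f"
    have dec: "f = fps_const (f $ 0) + fps_X * ?f" by (rule fps_decompose)
    have 1: "F f = F (fps_const (f $ 0)) \<oplus> F fps_X \<otimes> F ?f"
      using F.hom_add[of "fps_const (f $ 0)" "fps_X * ?f"] F.hom_mult[of fps_X ?f] dec by simp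
    have 2: "F' f = F (fps_const (f $ 0)) \<oplus> F fps_X \<otimes> F' ?f"
      using F'.hom_add[of "fps_const (f $ 0)" "fps_X * ?f"] F'.hom_mult[of fps_X ?f] dec const X by simp
    have "F f \<ominus> F' f = F fps_X \<otimes> (F ?f \<ominus> F' ?f)"
      unfolding 1 2 using c[of ?f] c[of fps_X] c[of "fps_const (f $ 0)"] by algebra
    then show ?case using filtration_mult[OF X(2) Suc] by simp
  qed
  then show "F f = F' f" by (intro filtration_eqI c)
qed

end

lemma (in ideal) quotient_hom_lift:
  assumes "ring C" "h \<in> ring_hom R C" "\<And>x. x \<in> I \<Longrightarrow> h x = \<zero>\<^bsub>C\<^esub>"
  obtains f where "f \<in> ring_hom (R Quot I) C" "\<And>a. a \<in> carrier R \<Longrightarrow> f (I +> a) = h a"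
proof -
  interpret C: ring C by fact
  interpret h: ring_hom_ring R C h
    using assms(2) ring_axioms C.ring_axioms by (intro ring_hom_ringI2)
  have eq: "h a = h b" if ab: "a \<in> carrier R" "b \<in> carrier R" "I +> a = I +> b" for a b
  proof -
    have "a \<ominus> b \<in> I" using ab quotient_eq_iff_same_a_r_cos[OF is_ideal] by simp
    then have "h a \<ominus>\<^bsub>C\<^esub> h b = \<zero>\<^bsub>C\<^esub>" using assms(3) ab h.hom_minus by metis
    then show ?thesis using ab by simp
  qed
  define f where "f Z = h (SOME a. a \<in> carrier R \<and> I +> a = Z)" for Z
  have f: "f (I +> a) = h a" if a: "a \<in> carrier R" for a
  proof -
    have "\<exists>b. b \<in> carrier R \<and> I +> b = I +> a" using a by blast
    from someI_ex[OF this] show ?thesis unfolding f_def using eq a by blast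
  qed
  have rep: "\<exists>a\<in>carrier R. Z = I +> a" if "Z \<in> carrier (R Quot I)" for Z
    using that by (auto simp: FactRing_def A_RCOSETS_def')
  have "f \<in> ring_hom (R Quot I) C"
  proof (rule ring_hom_memI)
    fix Z Y assume "Z \<in> carrier (R Quot I)" "Y \<in> carrier (R Quot I)"
    then obtain a b where ab: "a \<in> carrier R" "b \<in> carrier R" "Z = I +> a" "Y = I +> b"
      using rep by blast
    show "f (Z \<otimes>\<^bsub>R Quot I\<^esub> Y) = f Z \<otimes>\<^bsub>C\<^esub> f Y"
      using ab f by (simp add: FactRing_def rcoset_mult_add)
    show "f (Z \<oplus>\<^bsub>R Quot I\<^esub> Y) = f Z \<oplus>\<^bsub>C\<^esub> f Y"
      using ab f by (simp add: FactRing_def a_rcos_sum)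
  next
    show "f \<one>\<^bsub>R Quot I\<^esub> = \<one>\<^bsub>C\<^esub>" using f by (simp add: FactRing_def)
  next
    fix Z assume "Z \<in> carrier (R Quot I)"
    then show "f Z \<in> carrier C" using rep f by force
  qed
  then show ?thesis using that f by blast
qed

context complete_filtered_ring
begin

lemma power_series_continuous_hom:
  fixes h :: "'s::comm_ring_1 \<Rightarrow> 'a"
  assumes h: "h \<in> ring_hom ring_of_type_algebra C" and b: "b \<in> G 1" and S: "h ` S \<subseteq> G 1"
  defines "J \<equiv> ideal_power ring_of_type_algebra (genideal ring_of_type_algebra (insert fps_X (fps_const ` S)))"
  obtains F where "continuous_algebra_hom ring_of_type_algebra J fps_const C G h F" "F fps_X = b"
    "\<And>n. F ` J n \<subseteq> G n"
    "\<And>F'. \<lbrakk>F' \<in> ring_hom ring_of_type_algebra C; \<And>s. F' (fps_const s) = h s; F' fps_X = b\<rbrakk> \<Longrightarrow> F' = F"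
proof -
  interpret S: cring "ring_of_type_algebra :: 's fps ring" by (rule cring_from_type_algebra)
  obtain F where F: "F \<in> ring_hom ring_of_type_algebra C" "\<And>s. F (fps_const s) = h s" "F fps_X = b"
    using power_series_hom_exists[OF h b] by blast
  have "F ` genideal ring_of_type_algebra (insert fps_X (fps_const ` S)) \<subseteq> G 1"
    using F S b
    by (intro ring_hom_genideal_subset[OF S.ring_axioms ring_axioms F(1) _ filtration_ideal]) auto
  then have J: "F ` J n \<subseteq> G n" for n
    unfolding J_def
    by (intro ring_hom_ideal_power_subset[OF S.is_cring filtered_ring_axioms F(1)] S.genideal_ideal) simp_all
  show ?thesis
  proof (rule that)
    show "continuous_algebra_hom ring_of_type_algebra J fps_const C G h F"
      unfolding continuous_algebra_hom_def using F J by (intro conjI allI exI) (simp_all add: extensional_def)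
    show "F' = F" if "F' \<in> ring_hom ring_of_type_algebra C" "\<And>s. F' (fps_const s) = h s" "F' fps_X = b" for F'
      using power_series_hom_unique[OF that(1) F(1)] that F b by simp
  qed (use F J in auto)
qed

end

section \<open>The adic filtration of a power series ring\<close>

locale type_filtration = filtered_ring "ring_of_type_algebra :: 's::comm_ring_1 ring" G for G
begin

lemma G_0 [simp]: "x \<in> G 0" using filtration_0 by simp
lemma G_zero [simp]: "0 \<in> G n" using filtration_zero[of n] by simp
lemma G_add: "\<lbrakk>x \<in> G n; y \<in> G n\<rbrakk> \<Longrightarrow> x + y \<in> G n" using filtration_add[of x n y] by simp
lemma G_uminus: "x \<in> G n \<Longrightarrow> - x \<in> G n" using filtration_uminus[of x n] by simp
lemma G_diff: "\<lbrakk>x \<in> G n; y \<in> G n\<rbrakk> \<Longrightarrow> x - y \<in> G n" using filtration_diff[of x n y] by simp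
lemma G_mult_left: "y \<in> G n \<Longrightarrow> x * y \<in> G n" using filtration_mult_left[of x y n] by simp
lemma G_mult_right: "x \<in> G n \<Longrightarrow> x * y \<in> G n" using filtration_mult_right[of x n y] by simp
lemma G_mult: "\<lbrakk>x \<in> G m; y \<in> G n\<rbrakk> \<Longrightarrow> x * y \<in> G (m + n)" using filtration_mult[of x m y n] by simp
lemma G_antimono: "\<lbrakk>x \<in> G n; m \<le> n\<rbrakk> \<Longrightarrow> x \<in> G m" using filtration_antimono by blast

lemma G_sum: "(\<And>i. i \<in> A \<Longrightarrow> f i \<in> G n) \<Longrightarrow> sum f A \<in> G n"
  by (induction A rule: infinite_finite_induct) (auto intro: G_add)

text \<open>The filtration in which the variable has weight one. Truncated subtraction leaves the
  coefficients from index n on unrestricted.\<close>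

definition fps_filtration :: "nat \<Rightarrow> 's fps set"
  where "fps_filtration n = {f. \<forall>i. f $ i \<in> G (n - i)}"

lemma fps_filtered: "filtered_ring ring_of_type_algebra fps_filtration"
proof (intro filtered_ring.intro filtered_ring_axioms.intro cring_from_type_algebra)
  fix n
  interpret R: ring "ring_of_type_algebra :: 's fps ring" by (rule ring_from_type_algebra)
  show "ideal (fps_filtration n) ring_of_type_algebra"
  proof (rule idealI)
    show "subgroup (fps_filtration n) (add_monoid ring_of_type_algebra)"
    proof (rule group.subgroupI)
      show "group (add_monoid (ring_of_type_algebra :: 's fps ring))" by (rule R.a_group)
      have "0 \<in> fps_filtration n" by (simp add: fps_filtration_def)
      then show "fps_filtration n \<noteq> {}" by blast
      fix f assume f: "f \<in> fps_filtration n"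
      then have "- f \<in> fps_filtration n" by (simp add: fps_filtration_def G_uminus)
      then show "inv\<^bsub>add_monoid ring_of_type_algebra\<^esub> f \<in> fps_filtration n"
        using type_ring_uminus[of f] by (simp add: a_inv_def)
      fix g assume "g \<in> fps_filtration n"
      with f show "f \<otimes>\<^bsub>add_monoid ring_of_type_algebra\<^esub> g \<in> fps_filtration n"
        by (simp add: fps_filtration_def G_add)
    qed simp
    fix f g :: "'s fps" assume "f \<in> fps_filtration n"
    then have f: "f $ i \<in> G (n - i)" for i by (simp add: fps_filtration_def)
    have "(f * g) $ i \<in> G (n - i)" for i
      unfolding fps_mult_nth by (intro G_sum G_mult_right G_antimono[OF f]) auto
    then have "f * g \<in> fps_filtration n" by (simp add: fps_filtration_def)
    then show "g \<otimes>\<^bsub>ring_of_type_algebra\<^esub> f \<in> fps_filtration n" "f \<otimes>\<^bsub>ring_of_type_algebra\<^esub> g \<in> fps_filtration n"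
      by (simp_all add: mult.commute)
  qed (rule R.ring_axioms)
  show "fps_filtration (Suc n) \<subseteq> fps_filtration n"
    by (auto simp: fps_filtration_def intro: G_antimono)
next
  fix f g m n assume fg: "f \<in> fps_filtration m" "g \<in> fps_filtration n"
  have "f $ j * g $ (i - j) \<in> G (m + n - i)" if "j \<le> i" for i j
  proof -
    have "f $ j * g $ (i - j) \<in> G ((m - j) + (n - (i - j)))"
      using fg by (intro G_mult) (auto simp: fps_filtration_def)
    then show ?thesis by (rule G_antimono) (use that in simp)
  qed
  then have "(f * g) $ i \<in> G (m + n - i)" for i
    unfolding fps_mult_nth by (intro G_sum) simp
  then have "f * g \<in> fps_filtration (m + n)" by (simp add: fps_filtration_def)
  then show "f \<otimes>\<^bsub>ring_of_type_algebra\<^esub> g \<in> fps_filtration (m + n)" by simp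
qed (simp add: fps_filtration_def)

end

lemma complete_filtered_ring_fps:
  fixes G :: "nat \<Rightarrow> 's::comm_ring_1 set"
  assumes "complete_filtered_ring ring_of_type_algebra G"
  shows "complete_filtered_ring ring_of_type_algebra (type_filtration.fps_filtration G)"
proof -
  interpret complete_filtered_ring "ring_of_type_algebra :: 's ring" G by fact
  interpret type_filtration G by unfold_locales
  show ?thesis
  proof (intro complete_filtered_ring.intro complete_filtered_ring_axioms.intro fps_filtered)
    fix f :: "'s fps" assume f: "\<And>n. f \<in> fps_filtration n"
    have "f $ i = 0" for i
    proof -
      have "f $ i \<in> G n" for n using f[of "n + i"] by (auto simp: fps_filtration_def dest: spec[of _ i])
      then show ?thesis using filtration_separated[of "f $ i"] by simp
    qed
    then show "f = \<zero>\<^bsub>ring_of_type_algebra\<^esub>" by (simp add: fps_eq_iff)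
  next
    fix c :: "nat \<Rightarrow> 's fps"
    assume c: "\<And>n. c (Suc n) \<ominus>\<^bsub>ring_of_type_algebra\<^esub> c n \<in> fps_filtration n"
    \<comment> \<open>A congruence of level n + i on series gives one of level n on the i-th
      coefficient, so the coefficient sequence is read from index i onwards to restore the required
      rate.\<close>
    have "c (Suc (n + i)) $ i - c (n + i) $ i \<in> G n" for n i
      using c[of "n + i"] by (auto simp: fps_filtration_def dest: spec[of _ i])
    then have "\<exists>x. \<forall>n. c (n + i) $ i - x \<in> G n" for i
      using filtration_complete[of "\<lambda>n. c (n + i) $ i"] by simp
    then obtain x where x: "c (n + i) $ i - x i \<in> G n" for n i by metis
    have "c n - Abs_fps x \<in> fps_filtration n" for n
    proof -
      have "c n $ i - x i \<in> G (n - i)" for i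
        using x[of "n - i" i] by (cases "i \<le> n") simp_all
      then show ?thesis by (simp add: fps_filtration_def)
    qed
    then show "\<exists>f\<in>carrier ring_of_type_algebra. \<forall>n. c n \<ominus>\<^bsub>ring_of_type_algebra\<^esub> f \<in> fps_filtration n"
      by auto
  qed
qed

text \<open>One inclusion is checked on the generators. For the other, peeling off the constant
  coefficient lowers every remaining condition by one level and uses up one factor
  \<open>fps_X\<close>. Applied over W and then over R, it describes the topologies of R and of
  R[[\<xi>]] by coefficients.\<close>

lemma ideal_power_fps:
  fixes S :: "'s::comm_ring_1 set"
  defines "I \<equiv> genideal ring_of_type_algebra S"
  defines "J \<equiv> genideal ring_of_type_algebra (insert fps_X (fps_const ` S))"
  shows "ideal_power ring_of_type_algebra J n =
    type_filtration.fps_filtration (ideal_power ring_of_type_algebra I) n"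
proof -
  interpret s: cring "ring_of_type_algebra :: 's ring" by (rule cring_from_type_algebra)
  interpret f: cring "ring_of_type_algebra :: 's fps ring" by (rule cring_from_type_algebra)
  have I: "ideal I ring_of_type_algebra" and J: "ideal J ring_of_type_algebra"
    unfolding I_def J_def by (intro s.genideal_ideal f.genideal_ideal; simp)+
  interpret filtered_ring "ring_of_type_algebra :: 's ring" "ideal_power ring_of_type_algebra I"
    by (rule s.filtered_ring_ideal_power[OF I])
  interpret type_filtration "ideal_power ring_of_type_algebra I" by unfold_locales
  interpret J: filtered_ring "ring_of_type_algebra :: 's fps ring" "ideal_power ring_of_type_algebra J"
    by (rule f.filtered_ring_ideal_power[OF J])
  interpret J: type_filtration "ideal_power ring_of_type_algebra J" by unfold_locales
  let ?c = "fps_const :: 's \<Rightarrow> 's fps"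
  have SI: "S \<subseteq> I" and SJ: "insert fps_X (fps_const ` S) \<subseteq> J"
    unfolding I_def J_def using s.genideal_self[of S] f.genideal_self by auto
  have c_hom: "?c \<in> ring_hom ring_of_type_algebra ring_of_type_algebra"
    by (rule ring_hom_memI) simp_all
  have "?c ` I \<subseteq> J"
    unfolding I_def using SJ J
    by (intro ring_hom_genideal_subset[OF s.ring_axioms f.ring_axioms c_hom]) auto
  then have cP: "?c ` ideal_power ring_of_type_algebra I n \<subseteq> ideal_power ring_of_type_algebra J n" for n
    using ring_hom_ideal_power_subset[OF s.is_cring J.filtered_ring_axioms c_hom I]
      f.ideal_power_1[OF J] by (simp del: One_nat_def)
  have X: "fps_X \<in> ideal_power ring_of_type_algebra J 1"
    using SJ f.ideal_power_1[OF J] by (simp del: One_nat_def)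
  show ?thesis
  proof
    have "J \<subseteq> fps_filtration 1"
      unfolding J_def
    proof (rule f.genideal_minimal)
      show "ideal (fps_filtration 1) ring_of_type_algebra"
        using filtered_ring.filtration_ideal[OF fps_filtered] .
      have "i \<noteq> 0 \<Longrightarrow> 1 - i = 0" for i :: nat by simp
      then show "insert fps_X (fps_const ` S) \<subseteq> fps_filtration 1"
        using SI s.ideal_power_1[OF I] by (auto simp: fps_filtration_def fps_X_def simp del: One_nat_def)
    qed
    then have "(\<lambda>x. x) ` ideal_power ring_of_type_algebra J n \<subseteq> fps_filtration n"
      by (intro ring_hom_ideal_power_subset[OF f.is_cring fps_filtered _ J]) (auto intro!: ring_hom_memI)
    then show "ideal_power ring_of_type_algebra J n \<subseteq> fps_filtration n" by simp
    show "fps_filtration n \<subseteq> ideal_power ring_of_type_algebra J n"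
    proof
      fix f :: "'s fps" assume "f \<in> fps_filtration n"
      then show "f \<in> ideal_power ring_of_type_algebra J n"
      proof (induction n arbitrary: f)
        case (Suc n)
        have "f $ 0 \<in> ideal_power ring_of_type_algebra I (Suc n)"
          using Suc.prems by (auto simp: fps_filtration_def dest: spec[of _ 0])
        then have 1: "?c (f $ 0) \<in> ideal_power ring_of_type_algebra J (Suc n)" using cP by blast
        have "fps_shift 1 f $ i \<in> ideal_power ring_of_type_algebra I (n - i)" for i
          using Suc.prems by (auto simp: fps_filtration_def dest: spec[of _ "Suc i"])
        then have "fps_shift 1 f \<in> ideal_power ring_of_type_algebra J n"
          by (intro Suc.IH) (simp add: fps_filtration_def)
        then have "fps_X * fps_shift 1 f \<in> ideal_power ring_of_type_algebra J (Suc n)"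
          using J.G_mult[OF X] by simp
        then show ?case using J.G_add[OF 1] by (subst fps_decompose) blast
      qed simp
    qed
  qed
qed

text \<open>The geometric series, obtained by evaluating the inverse of 1 - X at y.\<close>

lemma one_minus_unit:
  fixes G :: "nat \<Rightarrow> 's::comm_ring_1 set"
  assumes "complete_filtered_ring ring_of_type_algebra G" "y \<in> G 1"
  shows "\<exists>z. (1 - y) * z = 1"
proof -
  interpret complete_filtered_ring "ring_of_type_algebra :: 's ring" G by fact
  have "(\<lambda>x::'s. x) \<in> ring_hom ring_of_type_algebra ring_of_type_algebra"
    by (rule ring_hom_memI) simp_all
  from power_series_hom_exists[OF this assms(2)] obtain F :: "'s fps \<Rightarrow> 's"
    where F: "F \<in> ring_hom ring_of_type_algebra ring_of_type_algebra" "F fps_X = y" by blast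
  interpret F: ring_hom_ring "ring_of_type_algebra :: 's fps ring" "ring_of_type_algebra :: 's ring" F
    using F(1) ring_axioms ring_from_type_algebra by (intro ring_hom_ringI2)
  have "(1 - fps_X) * fps_right_inverse (1 - fps_X) 1 = (1 :: 's fps)"
    by (rule fps_right_inverse) simp
  then have "F ((1 - fps_X) * fps_right_inverse (1 - fps_X) 1) = 1"
    using F.hom_one by simp
  then have "F (1 - fps_X) * F (fps_right_inverse (1 - fps_X) 1) = 1"
    using F.hom_mult[of "1 - fps_X"] by simp
  moreover have "F (1 - fps_X) = 1 - y"
    using F.hom_minus[of 1 fps_X] F.hom_one F(2) by simp
  ultimately show ?thesis by auto
qed

lemma binomial_fps_nth: "(1 + fps_X :: 's::comm_ring_1 fps) ^ N $ i = of_nat (N choose i)"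
proof (induction N arbitrary: i)
  case 0
  then show ?case by (cases i) simp_all
next
  case (Suc N)
  then show ?case by (cases i) (simp_all add: algebra_simps)
qed

section \<open>Tensor products\<close>

lemma frag_extend_fun_diff: "frag_extend (\<lambda>k. f k - g k) c = frag_extend f c - frag_extend g c"
  using subset_UNIV
  by (induction c rule: frag_induction) (auto simp: frag_extend_diff)

lemma pair_ring_simps [simp]:
  "x \<in> carrier (pair_ring A B) \<longleftrightarrow> Poly_Mapping.keys x \<subseteq> carrier A \<times> carrier B"
  "\<one>\<^bsub>pair_ring A B\<^esub> = frag_of (\<one>\<^bsub>A\<^esub>, \<one>\<^bsub>B\<^esub>)"
  "\<zero>\<^bsub>pair_ring A B\<^esub> = 0"
  "x \<oplus>\<^bsub>pair_ring A B\<^esub> y = x + y"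
  by (simp_all add: pair_ring_def)

lemma pair_ring_mult_of [simp]:
  "frag_of (a, b) \<otimes>\<^bsub>pair_ring A B\<^esub> frag_of (a', b') = frag_of (a \<otimes>\<^bsub>A\<^esub> a', b \<otimes>\<^bsub>B\<^esub> b')"
  by (simp add: pair_ring_def)

lemma pair_ring_mult_0 [simp]: "0 \<otimes>\<^bsub>pair_ring A B\<^esub> y = 0" "x \<otimes>\<^bsub>pair_ring A B\<^esub> 0 = 0"
  by (simp_all add: pair_ring_def case_prod_unfold frag_extend_eq_0)

lemma pair_ring_mult_diff:
  "(x - x') \<otimes>\<^bsub>pair_ring A B\<^esub> y = x \<otimes>\<^bsub>pair_ring A B\<^esub> y - x' \<otimes>\<^bsub>pair_ring A B\<^esub> y"
  "x \<otimes>\<^bsub>pair_ring A B\<^esub> (y - y') = x \<otimes>\<^bsub>pair_ring A B\<^esub> y - x \<otimes>\<^bsub>pair_ring A B\<^esub> y'"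
  by (simp_all add: pair_ring_def frag_extend_diff case_prod_unfold frag_extend_fun_diff)

lemma pair_ring_mult_uminus: "(- x) \<otimes>\<^bsub>pair_ring A B\<^esub> y = - (x \<otimes>\<^bsub>pair_ring A B\<^esub> y)"
  using pair_ring_mult_diff(1)[where x = 0 and x' = x and A = A and B = B and y = y] by simp

lemma pair_ring_mult_add:
  "(x + x') \<otimes>\<^bsub>pair_ring A B\<^esub> y = x \<otimes>\<^bsub>pair_ring A B\<^esub> y + x' \<otimes>\<^bsub>pair_ring A B\<^esub> y"
  using pair_ring_mult_diff(1)[where x = x and x' = "- x'" and A = A and B = B and y = y] by (simp add: pair_ring_mult_uminus)

lemma pair_ring_carrier_diff:
  "\<lbrakk>Poly_Mapping.keys x \<subseteq> S; Poly_Mapping.keys y \<subseteq> S\<rbrakk> \<Longrightarrow> Poly_Mapping.keys (x - y :: 'c \<Rightarrow>\<^sub>0 int) \<subseteq> S"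
  using keys_diff[of x y] by blast

locale ring_pair = A: cring A + B: cring B
  for A :: "('a, 'm) ring_scheme" and B :: "('b, 'n) ring_scheme"
begin

abbreviation PR where "PR \<equiv> pair_ring A B"
abbreviation "S \<equiv> carrier A \<times> carrier B"

lemma pair_mult_closed:
  assumes "Poly_Mapping.keys x \<subseteq> S" "Poly_Mapping.keys y \<subseteq> S"
  shows "Poly_Mapping.keys (x \<otimes>\<^bsub>PR\<^esub> y) \<subseteq> S"
  using assms(1)
proof (induction x rule: frag_induction)
  case (one z)
  obtain a b where z: "z = (a, b)" by (cases z)
  show ?case using assms(2)
  proof (induction y rule: frag_induction)
    case (one w)
    then show ?case using \<open>z \<in> S\<close> z by (cases w) simp
  qed (simp_all add: pair_ring_mult_diff pair_ring_carrier_diff)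
qed (simp_all add: pair_ring_mult_diff pair_ring_carrier_diff)

lemma pair_mult_comm:
  assumes "Poly_Mapping.keys x \<subseteq> S" "Poly_Mapping.keys y \<subseteq> S"
  shows "x \<otimes>\<^bsub>PR\<^esub> y = y \<otimes>\<^bsub>PR\<^esub> x"
  using assms(1)
proof (induction x rule: frag_induction)
  case (one z)
  obtain a b where z: "z = (a, b)" by (cases z)
  show ?case using assms(2)
  proof (induction y rule: frag_induction)
    case (one w)
    then show ?case using \<open>z \<in> S\<close> z by (cases w) (simp add: A.m_comm B.m_comm)
  qed (simp_all add: pair_ring_mult_diff)
qed (simp_all add: pair_ring_mult_diff)

lemma pair_mult_assoc:
  assumes "Poly_Mapping.keys x \<subseteq> S" "Poly_Mapping.keys y \<subseteq> S" "Poly_Mapping.keys z \<subseteq> S"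
  shows "(x \<otimes>\<^bsub>PR\<^esub> y) \<otimes>\<^bsub>PR\<^esub> z = x \<otimes>\<^bsub>PR\<^esub> (y \<otimes>\<^bsub>PR\<^esub> z)"
  using assms(1)
proof (induction x rule: frag_induction)
  case (one k)
  note k = this
  show ?case using assms(2)
  proof (induction y rule: frag_induction)
    case (one l)
    note l = this
    show ?case using assms(3)
    proof (induction z rule: frag_induction)
      case (one m)
      then show ?case using k l by (cases k; cases l; cases m) (simp add: A.m_assoc B.m_assoc)
    qed (simp_all add: pair_ring_mult_diff)
  qed (simp_all add: pair_ring_mult_diff)
qed (simp_all add: pair_ring_mult_diff)

lemma pair_mult_one:
  assumes "Poly_Mapping.keys x \<subseteq> S"
  shows "frag_of (\<one>\<^bsub>A\<^esub>, \<one>\<^bsub>B\<^esub>) \<otimes>\<^bsub>PR\<^esub> x = x"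
  using assms
proof (induction x rule: frag_induction)
  case (one k)
  then show ?case by (cases k) simp
qed (simp_all add: pair_ring_mult_diff)

lemma pair_ring_cring: "cring PR"
proof (rule cringI)
  show "abelian_group PR"
  proof (rule abelian_groupI)
    fix x y assume "x \<in> carrier PR" "y \<in> carrier PR"
    then show "x \<oplus>\<^bsub>PR\<^esub> y \<in> carrier PR" using keys_add[of x y] by auto
  next
    fix x assume "x \<in> carrier PR"
    then show "\<exists>y\<in>carrier PR. y \<oplus>\<^bsub>PR\<^esub> x = \<zero>\<^bsub>PR\<^esub>"
      by (intro bexI[of _ "- x"]) simp_all
  qed (simp_all add: ac_simps)
  show "comm_monoid PR"
    by (rule comm_monoidI)
      (simp_all add: pair_mult_closed pair_mult_assoc pair_mult_one, simp add: pair_mult_comm)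
qed (simp add: pair_ring_mult_add)

sublocale PR: cring PR by (rule pair_ring_cring)

lemma pair_ring_uminus: "x \<in> carrier PR \<Longrightarrow> \<ominus>\<^bsub>PR\<^esub> x = - x"
  by (rule PR.minus_equality) simp_all

lemma pair_ring_minus: "y \<in> carrier PR \<Longrightarrow> x \<ominus>\<^bsub>PR\<^esub> y = x - y"
  by (simp add: a_minus_def pair_ring_uminus)

end

section \<open>Tensor products of algebras and their universal property\<close>

locale tensor_product = ring_pair A B
  for A :: "('a, 'm) ring_scheme" and B :: "('b, 'n) ring_scheme" +
  fixes K :: "('k, 'l) ring_scheme" and f :: "'k \<Rightarrow> 'a" and g :: "'k \<Rightarrow> 'b"
  assumes f_closed: "r \<in> carrier K \<Longrightarrow> f r \<in> carrier A"
    and g_closed: "r \<in> carrier K \<Longrightarrow> g r \<in> carrier B"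
begin

abbreviation TI where "TI \<equiv> tensor_ideal K A f B g"
abbreviation TR where "TR \<equiv> tensor_ring K A f B g"
abbreviation pt where "pt \<equiv> pure_tensor K A f B g"

lemma tensor_relations_carrier: "tensor_relations K A f B g \<subseteq> carrier PR"
proof
  fix x assume "x \<in> tensor_relations K A f B g"
  then show "x \<in> carrier PR"
    unfolding tensor_relations_def
    by (elim UnE CollectE exE conjE) (simp_all add: pair_ring_carrier_diff f_closed g_closed)
qed

sublocale TI: ideal TI PR
  unfolding tensor_ideal_def by (rule PR.genideal_ideal[OF tensor_relations_carrier])

sublocale TR: cring TR
  unfolding tensor_ring_def by (rule TI.quotient_is_cring[OF pair_ring_cring])

lemma relation_mem: "x \<in> tensor_relations K A f B g \<Longrightarrow> x \<in> TI"
  unfolding tensor_ideal_def using PR.genideal_self[OF tensor_relations_carrier] by blast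

lemma pt_closed [simp]: "\<lbrakk>a \<in> carrier A; b \<in> carrier B\<rbrakk> \<Longrightarrow> pt a b \<in> carrier TR"
  using PR.a_rcosetsI[OF TI.a_subset, of "frag_of (a, b)"]
  by (simp add: tensor_ring_def pure_tensor_def FactRing_def)

lemma coset_eqI:
  assumes "x \<in> carrier PR" "y \<in> carrier PR" "x - y \<in> TI"
  shows "TI +>\<^bsub>PR\<^esub> x = TI +>\<^bsub>PR\<^esub> y"
  using PR.quotient_eq_iff_same_a_r_cos[OF TI.is_ideal assms(1,2)] assms
  by (simp add: pair_ring_minus)

lemma pt_mult:
  "\<lbrakk>a \<in> carrier A; b \<in> carrier B; a' \<in> carrier A; b' \<in> carrier B\<rbrakk>
    \<Longrightarrow> pt a b \<otimes>\<^bsub>TR\<^esub> pt a' b' = pt (a \<otimes>\<^bsub>A\<^esub> a') (b \<otimes>\<^bsub>B\<^esub> b')"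
  by (simp add: tensor_ring_def pure_tensor_def FactRing_def TI.rcoset_mult_add)

lemma coset_add:
  "\<lbrakk>x \<in> carrier PR; y \<in> carrier PR\<rbrakk>
    \<Longrightarrow> (TI +>\<^bsub>PR\<^esub> x) \<oplus>\<^bsub>TR\<^esub> (TI +>\<^bsub>PR\<^esub> y) = TI +>\<^bsub>PR\<^esub> (x + y)"
  using TI.a_rcos_sum[of x y] by (simp add: tensor_ring_def FactRing_def)

lemma pt_add_left:
  assumes "a \<in> carrier A" "a' \<in> carrier A" "b \<in> carrier B"
  shows "pt (a \<oplus>\<^bsub>A\<^esub> a') b = pt a b \<oplus>\<^bsub>TR\<^esub> pt a' b"
proof -
  have "frag_of (a \<oplus>\<^bsub>A\<^esub> a', b) - frag_of (a, b) - frag_of (a', b) \<in> TI"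
    by (rule relation_mem) (use assms in \<open>auto simp: tensor_relations_def\<close>)
  moreover have "Poly_Mapping.keys (frag_of (a, b) + frag_of (a', b)) \<subseteq> S"
    using keys_add[of "frag_of (a, b)" "frag_of (a', b)"] assms by auto
  ultimately show ?thesis
    using assms coset_eqI[of "frag_of (a \<oplus>\<^bsub>A\<^esub> a', b)" "frag_of (a, b) + frag_of (a', b)"]
    by (simp add: pure_tensor_def coset_add diff_diff_eq)
qed

lemma pt_add_right:
  assumes "a \<in> carrier A" "b \<in> carrier B" "b' \<in> carrier B"
  shows "pt a (b \<oplus>\<^bsub>B\<^esub> b') = pt a b \<oplus>\<^bsub>TR\<^esub> pt a b'"
proof -
  have "frag_of (a, b \<oplus>\<^bsub>B\<^esub> b') - frag_of (a, b) - frag_of (a, b') \<in> TI"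
    by (rule relation_mem) (use assms in \<open>auto simp: tensor_relations_def\<close>)
  moreover have "Poly_Mapping.keys (frag_of (a, b) + frag_of (a, b')) \<subseteq> S"
    using keys_add[of "frag_of (a, b)" "frag_of (a, b')"] assms by auto
  ultimately show ?thesis
    using assms coset_eqI[of "frag_of (a, b \<oplus>\<^bsub>B\<^esub> b')" "frag_of (a, b) + frag_of (a, b')"]
    by (simp add: pure_tensor_def coset_add diff_diff_eq)
qed

lemma pt_balance:
  assumes "a \<in> carrier A" "r \<in> carrier K" "b \<in> carrier B"
  shows "pt (a \<otimes>\<^bsub>A\<^esub> f r) b = pt a (g r \<otimes>\<^bsub>B\<^esub> b)"
proof -
  have "frag_of (a \<otimes>\<^bsub>A\<^esub> f r, b) - frag_of (a, g r \<otimes>\<^bsub>B\<^esub> b) \<in> TI"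
    by (rule relation_mem) (use assms in \<open>auto simp: tensor_relations_def\<close>)
  then show ?thesis
    using assms coset_eqI[of "frag_of (a \<otimes>\<^bsub>A\<^esub> f r, b)" "frag_of (a, g r \<otimes>\<^bsub>B\<^esub> b)"] f_closed g_closed
    by (simp add: pure_tensor_def)
qed

lemma pt_one: "pt \<one>\<^bsub>A\<^esub> \<one>\<^bsub>B\<^esub> = \<one>\<^bsub>TR\<^esub>"
  by (simp add: tensor_ring_def pure_tensor_def FactRing_def)

lemma pt_left_hom: "(\<lambda>a. pt a \<one>\<^bsub>B\<^esub>) \<in> ring_hom A TR"
  by (rule ring_hom_memI) (simp_all add: pt_mult pt_add_left pt_one)

lemma pt_right_hom: "pt \<one>\<^bsub>A\<^esub> \<in> ring_hom B TR"
  by (rule ring_hom_memI) (simp_all add: pt_mult pt_add_right pt_one)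

lemma pt_eq_mult:
  "\<lbrakk>a \<in> carrier A; b \<in> carrier B\<rbrakk> \<Longrightarrow> pt a b = pt a \<one>\<^bsub>B\<^esub> \<otimes>\<^bsub>TR\<^esub> pt \<one>\<^bsub>A\<^esub> b"
  by (simp add: pt_mult)

text \<open>Closure under differences also yields zero and negatives, which matches the induction
  principle for the free abelian group behind the quotient.\<close>

lemma tensor_induct [consumes 1, case_names pure diff]:
  assumes t: "t \<in> carrier TR"
    and pure: "\<And>a b. \<lbrakk>a \<in> carrier A; b \<in> carrier B\<rbrakk> \<Longrightarrow> Q (pt a b)"
    and diff: "\<And>s t. \<lbrakk>s \<in> carrier TR; t \<in> carrier TR; Q s; Q t\<rbrakk> \<Longrightarrow> Q (s \<ominus>\<^bsub>TR\<^esub> t)"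
  shows "Q t"
proof -
  have hom: "(+>\<^bsub>PR\<^esub>) TI \<in> ring_hom PR TR"
    using TI.rcos_ring_hom by (simp add: tensor_ring_def)
  interpret h: ring_hom_ring PR TR "(+>\<^bsub>PR\<^esub>) TI"
    using hom PR.ring_axioms TR.ring_axioms by (intro ring_hom_ringI2)
  obtain x where x: "x \<in> carrier PR" "t = TI +>\<^bsub>PR\<^esub> x"
    using t by (auto simp: tensor_ring_def FactRing_def A_RCOSETS_def')
  have "Poly_Mapping.keys x \<subseteq> S" using x by simp
  then have "Poly_Mapping.keys x \<subseteq> S \<and> Q (TI +>\<^bsub>PR\<^esub> x)"
  proof (induction x rule: frag_induction)
    case zero
    have "Q (pt \<one>\<^bsub>A\<^esub> \<one>\<^bsub>B\<^esub> \<ominus>\<^bsub>TR\<^esub> pt \<one>\<^bsub>A\<^esub> \<one>\<^bsub>B\<^esub>)" by (intro diff pure) simp_all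
    then show ?case using h.hom_zero by (simp add: TR.r_neg TR.minus_eq)
  next
    case (one k)
    then show ?case using pure by (cases k) (simp add: pure_tensor_def)
  next
    case (diff x y)
    then have "TI +>\<^bsub>PR\<^esub> (x - y) = (TI +>\<^bsub>PR\<^esub> x) \<ominus>\<^bsub>TR\<^esub> (TI +>\<^bsub>PR\<^esub> y)"
      using h.hom_minus[of x y] by (simp add: pair_ring_minus)
    then show ?case using diff assms(3) h.hom_closed pair_ring_carrier_diff[of x S y] by simp
  qed
  then show ?thesis using x by simp
qed

text \<open>The additive map comes from the universal property of the free abelian group on pairs;
  it is multiplicative by induction in both arguments, and it kills the three kinds of relations by
  distributivity and by the balancing hypothesis.\<close>

lemma tensor_hom_exists:
  assumes "cring C" "\<alpha> \<in> ring_hom A C" "\<beta> \<in> ring_hom B C"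
    and bal: "\<And>r. r \<in> carrier K \<Longrightarrow> \<alpha> (f r) = \<beta> (g r)"
  obtains h where "h \<in> ring_hom TR C"
    "\<And>a b. \<lbrakk>a \<in> carrier A; b \<in> carrier B\<rbrakk> \<Longrightarrow> h (pt a b) = \<alpha> a \<otimes>\<^bsub>C\<^esub> \<beta> b"
proof -
  interpret C: cring C by fact
  interpret \<alpha>: ring_hom_ring A C \<alpha>
    using assms(2) A.ring_axioms C.ring_axioms by (intro ring_hom_ringI2)
  interpret \<beta>: ring_hom_ring B C \<beta>
    using assms(3) B.ring_axioms C.ring_axioms by (intro ring_hom_ringI2)
  have "comm_group (add_monoid C)" by (rule C.a_comm_group)
  moreover have "(\<lambda>(a, b). \<alpha> a \<otimes>\<^bsub>C\<^esub> \<beta> b) ` S \<subseteq> carrier (add_monoid C)" by auto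
  ultimately obtain h where h: "h \<in> hom (free_Abelian_group S) (add_monoid C)"
    "\<And>x. x \<in> S \<Longrightarrow> h (frag_of x) = (\<lambda>(a, b). \<alpha> a \<otimes>\<^bsub>C\<^esub> \<beta> b) x"
    using comm_group.free_Abelian_group_universal by blast
  have hc: "h x \<in> carrier C" if "Poly_Mapping.keys x \<subseteq> S" for x
    using h(1) that by (auto simp: hom_def)
  have h_add: "h (x + y) = h x \<oplus>\<^bsub>C\<^esub> h y"
    if "Poly_Mapping.keys x \<subseteq> S" "Poly_Mapping.keys y \<subseteq> S" for x y
    using h(1) that by (auto simp: hom_def)
  have h_diff: "h (x - y) = h x \<ominus>\<^bsub>C\<^esub> h y"
    if xy: "Poly_Mapping.keys x \<subseteq> S" "Poly_Mapping.keys y \<subseteq> S" for x y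
  proof -
    have k: "Poly_Mapping.keys (x - y) \<subseteq> S" by (rule pair_ring_carrier_diff[OF xy])
    have "h x = h (x - y) \<oplus>\<^bsub>C\<^esub> h y" using h_add[OF k xy(2)] by simp
    then have "h x \<ominus>\<^bsub>C\<^esub> h y = (h (x - y) \<oplus>\<^bsub>C\<^esub> h y) \<ominus>\<^bsub>C\<^esub> h y" by simp
    also have "\<dots> = h (x - y)" using hc[OF k] hc[OF xy(2)] by algebra
    finally show ?thesis ..
  qed
  have h0: "h 0 = \<zero>\<^bsub>C\<^esub>" using h_diff[of 0 0] hc[of 0] by (simp add: C.r_neg C.minus_eq)
  have h_of: "h (frag_of (a, b)) = \<alpha> a \<otimes>\<^bsub>C\<^esub> \<beta> b" if "a \<in> carrier A" "b \<in> carrier B" for a b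
    using h(2)[of "(a, b)"] that by simp
  have h_mult: "h (x \<otimes>\<^bsub>PR\<^esub> y) = h x \<otimes>\<^bsub>C\<^esub> h y"
    if x: "Poly_Mapping.keys x \<subseteq> S" and y: "Poly_Mapping.keys y \<subseteq> S" for x y
  proof -
    have "Poly_Mapping.keys x \<subseteq> S \<and> h (x \<otimes>\<^bsub>PR\<^esub> y) = h x \<otimes>\<^bsub>C\<^esub> h y"
      using x
    proof (induction x rule: frag_induction)
      case (one k)
      obtain a b where k: "k = (a, b)" "a \<in> carrier A" "b \<in> carrier B" using one by auto
      have "Poly_Mapping.keys y \<subseteq> S \<and> h (frag_of k \<otimes>\<^bsub>PR\<^esub> y) = h (frag_of k) \<otimes>\<^bsub>C\<^esub> h y"
        using y
      proof (induction y rule: frag_induction)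
        case zero
        then show ?case using k by (simp add: h0 h_of)
      next
        case (one l)
        then obtain a' b' where l: "l = (a', b')" "a' \<in> carrier A" "b' \<in> carrier B" by auto
        have "\<alpha> a \<otimes>\<^bsub>C\<^esub> \<alpha> a' \<otimes>\<^bsub>C\<^esub> (\<beta> b \<otimes>\<^bsub>C\<^esub> \<beta> b') = \<alpha> a \<otimes>\<^bsub>C\<^esub> \<beta> b \<otimes>\<^bsub>C\<^esub> (\<alpha> a' \<otimes>\<^bsub>C\<^esub> \<beta> b')"
          using k l by (simp add: C.m_ac)
        then show ?case using k l by (simp add: h_of)
      next
        case (diff x y)
        have kk: "Poly_Mapping.keys (frag_of k) \<subseteq> S" using k by simp
        have "h (frag_of k \<otimes>\<^bsub>PR\<^esub> (x - y)) = h (frag_of k \<otimes>\<^bsub>PR\<^esub> x) \<ominus>\<^bsub>C\<^esub> h (frag_of k \<otimes>\<^bsub>PR\<^esub> y)"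
          unfolding pair_ring_mult_diff using diff pair_mult_closed[OF kk] by (intro h_diff) auto
        also have "\<dots> = h (frag_of k) \<otimes>\<^bsub>C\<^esub> (h x \<ominus>\<^bsub>C\<^esub> h y)"
          using diff hc kk by (simp add: C.minus_eq C.r_distr C.r_minus)
        finally show ?case using diff h_diff pair_ring_carrier_diff[of x S y] by simp
      qed
      then show ?case using one by simp
    next
      case (diff u v)
      have "h ((u - v) \<otimes>\<^bsub>PR\<^esub> y) = h (u \<otimes>\<^bsub>PR\<^esub> y) \<ominus>\<^bsub>C\<^esub> h (v \<otimes>\<^bsub>PR\<^esub> y)"
        unfolding pair_ring_mult_diff using diff pair_mult_closed y by (intro h_diff) auto
      also have "\<dots> = (h u \<ominus>\<^bsub>C\<^esub> h v) \<otimes>\<^bsub>C\<^esub> h y"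
        using diff hc y by (simp add: C.minus_eq C.l_distr C.l_minus)
      finally show ?case using diff h_diff pair_ring_carrier_diff[of u S v] by simp
    qed (use y hc in \<open>simp add: h0\<close>)
    then show ?thesis ..
  qed
  have h_hom: "h \<in> ring_hom PR C"
    by (rule ring_hom_memI) (simp_all add: hc h_mult h_add h_of)
  have rel: "h x = \<zero>\<^bsub>C\<^esub>" if "x \<in> tensor_relations K A f B g" for x
    using that unfolding tensor_relations_def
  proof (elim UnE CollectE exE conjE, goal_cases)
    case (1 a a' b)
    have "(\<alpha> a \<oplus>\<^bsub>C\<^esub> \<alpha> a') \<otimes>\<^bsub>C\<^esub> \<beta> b \<ominus>\<^bsub>C\<^esub> \<alpha> a \<otimes>\<^bsub>C\<^esub> \<beta> b \<ominus>\<^bsub>C\<^esub> \<alpha> a' \<otimes>\<^bsub>C\<^esub> \<beta> b = \<zero>\<^bsub>C\<^esub>"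
      using 1 \<alpha>.hom_closed[of a] \<alpha>.hom_closed[of a'] \<beta>.hom_closed[of b] by algebra
    then show ?case using 1 by (simp add: h_diff h_of pair_ring_carrier_diff)
  next
    case (2 a b b')
    have "\<alpha> a \<otimes>\<^bsub>C\<^esub> (\<beta> b \<oplus>\<^bsub>C\<^esub> \<beta> b') \<ominus>\<^bsub>C\<^esub> \<alpha> a \<otimes>\<^bsub>C\<^esub> \<beta> b \<ominus>\<^bsub>C\<^esub> \<alpha> a \<otimes>\<^bsub>C\<^esub> \<beta> b' = \<zero>\<^bsub>C\<^esub>"
      using 2 \<alpha>.hom_closed[of a] \<beta>.hom_closed[of b'] \<beta>.hom_closed[of b] by algebra
    then show ?case using 2 by (simp add: h_diff h_of pair_ring_carrier_diff)
  next
    case (3 a r b)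
    then have "(\<alpha> a \<otimes>\<^bsub>C\<^esub> \<alpha> (f r)) \<otimes>\<^bsub>C\<^esub> \<beta> b = \<alpha> a \<otimes>\<^bsub>C\<^esub> (\<beta> (g r) \<otimes>\<^bsub>C\<^esub> \<beta> b)"
      using bal f_closed g_closed by (simp add: C.m_assoc)
    then show ?case using 3 f_closed g_closed by (simp add: h_diff h_of C.r_neg C.minus_eq)
  qed
  have "h ` TI \<subseteq> {\<zero>\<^bsub>C\<^esub>}"
    unfolding tensor_ideal_def
    by (rule ring_hom_genideal_subset[OF PR.ring_axioms C.ring_axioms h_hom tensor_relations_carrier C.zeroideal])
      (use rel in auto)
  then obtain h' where "h' \<in> ring_hom TR C" "\<And>x. x \<in> carrier PR \<Longrightarrow> h' (TI +>\<^bsub>PR\<^esub> x) = h x"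
    using TI.quotient_hom_lift[OF C.ring_axioms h_hom] unfolding tensor_ring_def by blast
  then show ?thesis using that h_of by (simp add: pure_tensor_def)
qed

end

section \<open>Completed tensor products\<close>

locale completed_tensor_product = tensor_product A B K f g
  for A :: "('a, 'm) ring_scheme" and B :: "('b, 'n) ring_scheme"
    and K :: "('k, 'l) ring_scheme" and f :: "'k \<Rightarrow> 'a" and g :: "'k \<Rightarrow> 'b" +
  fixes I :: "'a set" and J :: "'b set"
  assumes I_ideal: "ideal I A" and J_ideal: "ideal J B"
begin

abbreviation TJ where "TJ \<equiv> tensor_adic_ideal K A I f B J g"

lemma TJ_generators: "(\<lambda>a. pt a \<one>\<^bsub>B\<^esub>) ` I \<union> pt \<one>\<^bsub>A\<^esub> ` J \<subseteq> carrier TR"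
  using ideal.Icarr[OF I_ideal] ideal.Icarr[OF J_ideal] by auto

sublocale CT: adic_ring TR TJ
  unfolding tensor_adic_ideal_def
  by (intro adic_ring.intro adic_ring_axioms.intro TR.is_cring TR.genideal_ideal[OF TJ_generators])

lemma pt_left_TJ: "(\<lambda>a. pt a \<one>\<^bsub>B\<^esub>) ` I \<subseteq> TJ" and pt_right_TJ: "pt \<one>\<^bsub>A\<^esub> ` J \<subseteq> TJ"
  unfolding tensor_adic_ideal_def using TR.genideal_self[OF TJ_generators] by auto

abbreviation cpt where "cpt \<equiv> completed_pure_tensor K A I f B J g"

lemma cpt_eq: "cpt a b = CT.to (pt a b)"
  by (simp add: completed_pure_tensor_def)

lemma cpt_left_hom: "(\<lambda>a. cpt a \<one>\<^bsub>B\<^esub>) \<in> ring_hom A CT.Ahat"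
  using ring_hom_trans[OF pt_left_hom CT.to_completion_hom] by (simp add: cpt_eq comp_def)

lemma cpt_right_hom: "cpt \<one>\<^bsub>A\<^esub> \<in> ring_hom B CT.Ahat"
proof -
  have "cpt \<one>\<^bsub>A\<^esub> = CT.to \<circ> pt \<one>\<^bsub>A\<^esub>" by (rule ext) (simp add: cpt_eq)
  then show ?thesis using ring_hom_trans[OF pt_right_hom CT.to_completion_hom] by simp
qed

lemma cpt_left_nhd: "(\<lambda>a. cpt a \<one>\<^bsub>B\<^esub>) ` I \<subseteq> CT.nhd 1"
  and cpt_right_nhd: "cpt \<one>\<^bsub>A\<^esub> ` J \<subseteq> CT.nhd 1"
  using pt_left_TJ pt_right_TJ ideal.Icarr[OF I_ideal] ideal.Icarr[OF J_ideal]
  by (auto simp: cpt_eq CT.to_nhd_iff TR.ideal_power_1[OF CT.I_ideal] simp del: One_nat_def)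

lemma completed_tensor_hom_unique:
  assumes C: "complete_filtered_ring C G" and F: "F \<in> ring_hom CT.Ahat C" "F' \<in> ring_hom CT.Ahat C"
    and eq: "\<And>a b. \<lbrakk>a \<in> carrier A; b \<in> carrier B\<rbrakk> \<Longrightarrow> F (cpt a b) = F' (cpt a b)"
    and cont: "\<And>n. \<exists>m. F ` CT.nhd m \<subseteq> G n" "\<And>n. \<exists>m. F' ` CT.nhd m \<subseteq> G n"
    and x: "x \<in> carrier CT.Ahat"
  shows "F x = F' x"
proof (rule CT.completion_hom_unique[OF C F _ cont x])
  interpret C: complete_filtered_ring C G by fact
  interpret F: ring_hom_ring CT.Ahat C F
    using F C.ring_axioms CT.hat.ring_axioms by (intro ring_hom_ringI2)
  interpret F': ring_hom_ring CT.Ahat C F'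
    using F C.ring_axioms CT.hat.ring_axioms by (intro ring_hom_ringI2)
  fix t assume "t \<in> carrier TR"
  then show "F (CT.to t) = F' (CT.to t)"
  proof (induction rule: tensor_induct)
    case (pure a b)
    then show ?case using eq by (simp add: cpt_eq)
  next
    case (diff s t)
    then show ?case by (simp add: CT.toh.hom_minus F.hom_minus F'.hom_minus)
  qed
qed

text \<open>The uncompleted map \<open>h\<close> is exported together with \<open>F\<close>:
  elements of the completion are reached only through representatives in the tensor product, and on
  these it is \<open>h\<close> that can be computed.\<close>

lemma completed_tensor_hom_exists:
  assumes C: "complete_filtered_ring C G" and \<alpha>: "\<alpha> \<in> ring_hom A C" and \<beta>: "\<beta> \<in> ring_hom B C"
    and bal: "\<And>r. r \<in> carrier K \<Longrightarrow> \<alpha> (f r) = \<beta> (g r)"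
    and adic: "\<alpha> ` I \<subseteq> G 1" "\<beta> ` J \<subseteq> G 1"
  obtains F h where "F \<in> ring_hom CT.Ahat C" "F \<in> extensional (carrier CT.Ahat)"
    "\<And>a b. \<lbrakk>a \<in> carrier A; b \<in> carrier B\<rbrakk> \<Longrightarrow> F (cpt a b) = \<alpha> a \<otimes>\<^bsub>C\<^esub> \<beta> b"
    "\<And>n. F ` CT.nhd n \<subseteq> G n"
    "h \<in> ring_hom TR C" "\<And>a b. \<lbrakk>a \<in> carrier A; b \<in> carrier B\<rbrakk> \<Longrightarrow> h (pt a b) = \<alpha> a \<otimes>\<^bsub>C\<^esub> \<beta> b"
    "\<And>n. h ` CT.P n \<subseteq> G n"
    "\<And>x t n. \<lbrakk>x \<in> carrier CT.Ahat; t \<in> x n\<rbrakk> \<Longrightarrow> F x \<ominus>\<^bsub>C\<^esub> h t \<in> G n"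
    "\<And>t. t \<in> carrier TR \<Longrightarrow> F (CT.to t) = h t"
proof -
  interpret C: complete_filtered_ring C G by fact
  interpret \<alpha>: ring_hom_ring A C \<alpha>
    using \<alpha> A.ring_axioms C.ring_axioms by (intro ring_hom_ringI2)
  interpret \<beta>: ring_hom_ring B C \<beta>
    using \<beta> B.ring_axioms C.ring_axioms by (intro ring_hom_ringI2)
  obtain h where h: "h \<in> ring_hom TR C"
    "\<And>a b. \<lbrakk>a \<in> carrier A; b \<in> carrier B\<rbrakk> \<Longrightarrow> h (pt a b) = \<alpha> a \<otimes>\<^bsub>C\<^esub> \<beta> b"
    using tensor_hom_exists[OF C.is_cring \<alpha> \<beta> bal] by blast
  have "h ` TJ \<subseteq> G 1"
    unfolding tensor_adic_ideal_def
  proof (rule ring_hom_genideal_subset[OF TR.ring_axioms C.ring_axioms h(1) TJ_generators C.filtration_ideal])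
    show "h ` ((\<lambda>a. pt a \<one>\<^bsub>B\<^esub>) ` I \<union> pt \<one>\<^bsub>A\<^esub> ` J) \<subseteq> G 1"
      using adic ideal.Icarr[OF I_ideal] ideal.Icarr[OF J_ideal] by (auto simp: h(2))
  qed
  then have hP: "h ` CT.P n \<subseteq> G n" for n
    by (rule ring_hom_ideal_power_subset[OF TR.is_cring C.filtered_ring_axioms h(1) CT.I_ideal])
  obtain F where F: "F \<in> ring_hom CT.Ahat C" "F \<in> extensional (carrier CT.Ahat)"
    "\<And>t. t \<in> carrier TR \<Longrightarrow> F (CT.to t) = h t" "\<And>n. F ` CT.nhd n \<subseteq> G n"
    "\<And>x t n. \<lbrakk>x \<in> carrier CT.Ahat; t \<in> x n\<rbrakk> \<Longrightarrow> F x \<ominus>\<^bsub>C\<^esub> h t \<in> G n"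
    using CT.completion_hom_extend[OF C h(1) hP] by blast
  have cpt: "F (cpt a b) = \<alpha> a \<otimes>\<^bsub>C\<^esub> \<beta> b" if "a \<in> carrier A" "b \<in> carrier B" for a b
    using that F(3) h(2) by (simp add: cpt_eq)
  show ?thesis
    by (rule that[OF F(1,2) cpt F(4) h hP F(5,3)])
qed

end

section \<open>Gaussian integers and binomials\<close>

lemma gauss_integer_0 [simp]: "gauss_integer x 0 = 0"
  and gauss_integer_Suc: "gauss_integer x (Suc n) = gauss_integer x n + x ^ n"
  by (simp_all add: gauss_integer_def)

lemma gauss_integer_add: "gauss_integer x (m + n) = gauss_integer x m + x ^ m * gauss_integer x n"
  by (induction n) (simp_all add: gauss_integer_Suc algebra_simps power_add)

lemma gauss_integer_Suc': "gauss_integer x (Suc n) = 1 + x * gauss_integer x n"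
  using gauss_integer_add[of x 1 n] by (simp add: gauss_integer_Suc)

lemma gauss_integer_telescope: "(x - 1) * gauss_integer x n = x ^ n - 1"
  by (induction n) (simp_all add: gauss_integer_Suc algebra_simps)

lemma gauss_integer_mult: "gauss_integer x (m * n) = gauss_integer x m * gauss_integer (x ^ m) n"
  by (induction n)
    (simp_all add: gauss_integer_Suc gauss_integer_add[of x m] add.commute[of m] distrib_left power_mult
      mult.commute[of "gauss_integer x m"] gauss_integer_add)

lemma gauss_binomial_eq_0: "n < k \<Longrightarrow> gauss_binomial x n k = 0"
  by (induction x n k rule: gauss_binomial.induct) auto

lemma gauss_binomial_self [simp]: "gauss_binomial x n n = 1"
  by (induction n) (simp_all add: gauss_binomial_eq_0)

text \<open>The analogue of (n - k) C(n, k) = (k + 1) C(n, k + 1). The difference of Gaussian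
  integers stands for x^k (n - k)_x, so that no subtraction of exponents occurs and k > n is
  included.\<close>

lemma gauss_binomial_absorb:
  "(gauss_integer x n - gauss_integer x k) * gauss_binomial x n k =
    x ^ k * gauss_integer x (Suc k) * gauss_binomial x n (Suc k)"
proof (induction n arbitrary: k)
  case 0
  then show ?case by (cases k) simp_all
next
  case (Suc n)
  show ?case
  proof (cases k)
    case 0
    then show ?thesis using Suc[of 0] by (simp add: gauss_integer_Suc' gauss_integer_Suc[of x 0])
  next
    case (Suc j)
    let ?g = "gauss_integer x" and ?b = "gauss_binomial x n"
    have 1: "?g (Suc (Suc j)) = ?g (Suc j) + x ^ Suc j" "?g (Suc j) = ?g j + x ^ j"
      by (rule gauss_integer_Suc)+
    have "(?g (Suc n) - ?g (Suc j)) * gauss_binomial x (Suc n) (Suc j) =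
      x * ((?g n - ?g j) * ?b j) + x ^ Suc (Suc j) * (?g n - ?g j) * ?b (Suc j)"
      by (simp add: gauss_integer_Suc' algebra_simps)
    also have "\<dots> = x * (x ^ j * ?g (Suc j) * ?b (Suc j)) + x ^ Suc (Suc j) * (?g n - ?g j) * ?b (Suc j)"
      by (simp only: Suc.IH)
    also have "\<dots> = x ^ Suc j * ?g (Suc (Suc j)) * ?b (Suc j) +
        x ^ Suc (Suc j) * ((?g n - ?g (Suc j)) * ?b (Suc j))"
      unfolding 1 by (simp add: algebra_simps)
    also have "\<dots> = x ^ Suc j * ?g (Suc (Suc j)) * ?b (Suc j) +
        x ^ Suc (Suc j) * (x ^ Suc j * ?g (Suc (Suc j)) * ?b (Suc (Suc j)))"
      by (simp only: Suc.IH)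
    also have "\<dots> = x ^ Suc j * ?g (Suc (Suc j)) * gauss_binomial x (Suc n) (Suc (Suc j))"
      by (simp add: algebra_simps)
    finally show ?thesis using Suc by simp
  qed
qed

text \<open>The second Pascal recurrence, whose coefficient would be x^(n - k); it is cleared by the
  factor x^k. The proof compares absorption with the defining recurrence.\<close>

lemma gauss_binomial_difference:
  "x ^ k * (gauss_binomial x (Suc n) (Suc k) - gauss_binomial x n (Suc k)) = x ^ n * gauss_binomial x n k"
proof -
  let ?g = "gauss_integer x" and ?b = "gauss_binomial x n"
  have "x ^ k * (x ^ Suc k - 1) * ?b (Suc k) = (x - 1) * (x ^ k * ?g (Suc k) * ?b (Suc k))"
    unfolding gauss_integer_telescope[symmetric] by (simp add: algebra_simps)
  also have "\<dots> = ((x - 1) * ?g n - (x - 1) * ?g k) * ?b k"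
    unfolding gauss_binomial_absorb[symmetric] by (simp add: algebra_simps)
  also have "\<dots> = (x ^ n - x ^ k) * ?b k" unfolding gauss_integer_telescope by simp
  finally show ?thesis by (simp add: algebra_simps)
qed

section \<open>Triangular exponents, falling products and the q-Vandermonde identity\<close>

lemma triangle_Suc: "Suc n * n div 2 = n * (n - 1) div 2 + n"
proof -
  have "Suc n * n = n * (n - 1) + n * 2" by (cases n) simp_all
  then show ?thesis by simp
qed

lemma triangle_add: "(a + b) * (a + b - 1) div 2 = a * (a - 1) div 2 + b * (b - 1) div 2 + a * (b :: nat)"
proof (induction b)
  case (Suc b)
  have "(a + Suc b) * (a + Suc b - 1) div 2 = Suc (a + b) * (a + b) div 2" by simp
  also have "\<dots> = a * (a - 1) div 2 + b * (b - 1) div 2 + a * b + (a + b)"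
    unfolding triangle_Suc Suc ..
  also have "\<dots> = a * (a - 1) div 2 + Suc b * (Suc b - 1) div 2 + a * Suc b"
    using triangle_Suc[of b] by simp
  finally show ?case .
qed simp

text \<open>The analogue of n (n - 1) ... (n - r + 1) = r! C(n, r), by repeated absorption. The
  triangular power of x accumulates from the factors x^j in the steps.\<close>

lemma gauss_falling_product:
  "(\<Prod>j<r. gauss_integer x n - gauss_integer x j) =
    x ^ (r * (r - 1) div 2) * gauss_binomial x n r * (\<Prod>j<r. gauss_integer x (Suc j))"
proof (induction r)
  case (Suc r)
  have "(\<Prod>j<Suc r. gauss_integer x n - gauss_integer x j) =
    x ^ (r * (r - 1) div 2) * ((gauss_integer x n - gauss_integer x r) * gauss_binomial x n r) *
    (\<Prod>j<r. gauss_integer x (Suc j))"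
    using Suc by (simp add: ac_simps)
  also have "\<dots> = x ^ (r * (r - 1) div 2 + r) * gauss_binomial x n (Suc r) * (\<Prod>j<Suc r. gauss_integer x (Suc j))"
    unfolding gauss_binomial_absorb by (simp add: power_add ac_simps)
  also have "r * (r - 1) div 2 + r = Suc r * (Suc r - 1) div 2" using triangle_Suc[of r] by simp
  finally show ?case .
qed simp

text \<open>By the q-binomial theorem this is the coefficient of z^n in the product of the factors 1
  + u x^i z over i < m. The triangular power of x is what makes the difference in m a multiple of
  the previous term by u x^m, independently of n.\<close>

definition gauss_term :: "'a::comm_ring_1 \<Rightarrow> 'a \<Rightarrow> nat \<Rightarrow> nat \<Rightarrow> 'a"
  where "gauss_term u x n m = u ^ n * x ^ (n * (n - 1) div 2) * gauss_binomial x m n"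

lemma gauss_term_0 [simp]: "gauss_term u x 0 m = 1"
  by (simp add: gauss_term_def)

lemma gauss_term_eq_0: "m < n \<Longrightarrow> gauss_term u x n m = 0"
  by (simp add: gauss_term_def gauss_binomial_eq_0)

lemma gauss_term_Suc_Suc:
  "gauss_term u x (Suc n) (Suc m) = gauss_term u x (Suc n) m + u * x ^ m * gauss_term u x n m"
proof -
  have "gauss_term u x (Suc n) (Suc m) - gauss_term u x (Suc n) m =
    u ^ Suc n * x ^ (n * (n - 1) div 2) * (x ^ n * (gauss_binomial x (Suc m) (Suc n) - gauss_binomial x m (Suc n)))"
    using triangle_Suc[of n] by (simp add: gauss_term_def power_add algebra_simps)
  also have "\<dots> = u * x ^ m * gauss_term u x n m"
    unfolding gauss_binomial_difference by (simp add: gauss_term_def ac_simps)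
  finally show ?thesis by (simp add: algebra_simps)
qed

lemma gauss_term_sum: "(\<Sum>i<m. u * x ^ i * gauss_term u x n i) = gauss_term u x (Suc n) m"
  by (induction m) (simp_all add: gauss_term_eq_0 gauss_term_Suc_Suc)

text \<open>The q-Vandermonde identity: the product of 1 + u x^i z over i < k + m is cut at k, and
  in the second block z is replaced by x^k z. The induction on m adds one factor at a time.\<close>

lemma gauss_term_add:
  "gauss_term u x n (k + m) = (\<Sum>i\<le>n. gauss_term u x (n - i) k * x ^ (k * i) * gauss_term u x i m)"
proof (induction m arbitrary: n)
  case 0
  have "(\<Sum>i\<le>n. gauss_term u x (n - i) k * x ^ (k * i) * gauss_term u x i 0) =
    (\<Sum>i\<in>{0}. gauss_term u x (n - i) k * x ^ (k * i) * gauss_term u x i 0)"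
    by (rule sum.mono_neutral_right) (auto simp: gauss_term_eq_0)
  then show ?case by simp
next
  case (Suc m)
  let ?t = "gauss_term u x"
  show ?case
  proof (cases n)
    case (Suc j)
    have "(\<Sum>i\<le>Suc j. ?t (Suc j - i) k * x ^ (k * i) * ?t i (Suc m)) =
      ?t (Suc j) k + (\<Sum>i\<le>j. ?t (j - i) k * x ^ (k * Suc i) * ?t (Suc i) (Suc m))"
      by (subst sum.atMost_Suc_shift) simp
    also have "\<dots> = ?t (Suc j) k + (\<Sum>i\<le>j. ?t (j - i) k * x ^ (k * Suc i) * ?t (Suc i) m) +
        u * x ^ (k + m) * (\<Sum>i\<le>j. ?t (j - i) k * x ^ (k * i) * ?t i m)"
      by (simp add: gauss_term_Suc_Suc sum.distrib sum_distrib_left power_add algebra_simps)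
    also have "?t (Suc j) k + (\<Sum>i\<le>j. ?t (j - i) k * x ^ (k * Suc i) * ?t (Suc i) m) =
      (\<Sum>i\<le>Suc j. ?t (Suc j - i) k * x ^ (k * i) * ?t i m)"
      by (subst sum.atMost_Suc_shift) simp
    also have "\<dots> + u * x ^ (k + m) * (\<Sum>i\<le>j. ?t (j - i) k * x ^ (k * i) * ?t i m) = ?t (Suc j) (k + Suc m)"
      by (simp add: gauss_term_Suc_Suc Suc.IH[symmetric])
    finally show ?thesis using Suc by simp
  qed simp
qed

lemma poly_mapping_add_induct [case_names zero single add]:
  fixes c :: "'a \<Rightarrow>\<^sub>0 'b::comm_monoid_add"
  assumes "P 0" "\<And>k v. P (Poly_Mapping.single k v)" "\<And>x y. \<lbrakk>P x; P y\<rbrakk> \<Longrightarrow> P (x + y)"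
  shows "P c"
proof (induction c rule: update_induct)
  case (update c k v)
  have "Poly_Mapping.update k v c = c + Poly_Mapping.single k v"
    using update(1) by (intro poly_mapping_eqI) (auto simp: lookup_update lookup_add lookup_single in_keys_iff when_def)
  then show ?case using assms update by simp
qed (rule assms(1))

section \<open>Regular elements of \<open>R\<close>\<close>

locale prismatic_base =
  fixes p :: nat and W :: "'w::comm_ring_1 itself"
  assumes prime_p: "Factorial_Ring.prime p"
    and complete_W: "adically_complete (ring_of_type_algebra :: 'w ring) (p_ideal p)"
begin

abbreviation GW :: "nat \<Rightarrow> 'w set"
  where "GW \<equiv> ideal_power ring_of_type_algebra (p_ideal p)"

sublocale W: cring "ring_of_type_algebra :: 'w ring" by (rule cring_from_type_algebra)

lemma p_ideal_ideal: "ideal (p_ideal p :: 'w set) ring_of_type_algebra"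
  unfolding p_ideal_def by (rule W.genideal_ideal) simp

lemma complete_GW: "complete_filtered_ring ring_of_type_algebra GW"
  by (rule adic_ring.adically_complete_imp_complete_filtered[OF _ complete_W])
    (intro adic_ring.intro adic_ring_axioms.intro W.is_cring p_ideal_ideal)

sublocale W: complete_filtered_ring "ring_of_type_algebra :: 'w ring" GW
  by (rule complete_GW)
sublocale W: type_filtration GW by unfold_locales

lemma p_mem_GW: "of_nat p \<in> GW 1"
  unfolding W.ideal_power_1[OF p_ideal_ideal] unfolding p_ideal_def by (rule W.genideal_self') simp

text \<open>By Bezout some multiple of n is 1 plus a multiple of p, and such an element is
  invertible in the p-adically complete ring W.\<close>

lemma of_nat_unit_W:
  assumes "\<not> p dvd n" obtains z :: 'w where "of_nat n * z = 1"
proof -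
  have "gcd n p = 1"
    using prime_imp_coprime[OF prime_p assms] by (simp add: coprime_commute flip: coprime_iff_gcd_eq_1)
  moreover have "n \<noteq> 0" using assms by (metis dvd_0_right)
  ultimately obtain a k where "n * a = p * k + 1" using bezout_nat[of n p] by auto
  then have eq: "(of_nat n * of_nat a :: 'w) = 1 - (- (of_nat p * of_nat k))"
    by (simp flip: of_nat_mult)
  have "- (of_nat p * of_nat k) \<in> GW 1" by (intro W.G_uminus W.G_mult_right p_mem_GW)
  then obtain z where "(1 - (- (of_nat p * of_nat k))) * z = (1 :: 'w)"
    using one_minus_unit[OF complete_GW] by blast
  then have "of_nat n * (of_nat a * z) = 1" by (simp only: mult.assoc[symmetric] eq)
  then show ?thesis using that by blast
qed

definition regular :: "'w fps \<Rightarrow> bool" where "regular a \<longleftrightarrow> (\<forall>f. a * f = 0 \<longrightarrow> f = 0)"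

lemma regular_mult:
  assumes "regular a" "regular b" shows "regular (a * b)"
  unfolding regular_def
proof (intro allI impI)
  fix f assume "a * b * f = 0"
  then have "a * (b * f) = 0" by (simp only: mult.assoc)
  then have "b * f = 0" using assms(1) unfolding regular_def by blast
  then show "f = 0" using assms(2) unfolding regular_def by blast
qed

lemma regular_factor: "regular (a * b) \<Longrightarrow> regular a"
  unfolding regular_def
proof (intro allI impI)
  fix f assume "\<forall>f. a * b * f = 0 \<longrightarrow> f = 0" "a * f = 0"
  moreover have "a * b * f = b * (a * f)" by (simp add: ac_simps)
  ultimately show "f = 0" by simp
qed

lemma regular_cancel: "\<lbrakk>regular a; a * f = a * g\<rbrakk> \<Longrightarrow> f = g"
  using spec[of "\<lambda>f. a * f = 0 \<longrightarrow> f = 0" "f - g"] by (simp add: regular_def right_diff_distrib)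

lemma regular_one [simp]: "regular 1" by (simp add: regular_def)

lemma regular_power: "regular a \<Longrightarrow> regular (a ^ n)"
  by (induction n) (auto intro: regular_mult)

lemma regular_prod: "(\<And>i. i \<in> A \<Longrightarrow> regular (f i)) \<Longrightarrow> regular (prod f A)"
  by (induction A rule: infinite_finite_induct) (auto intro: regular_mult)

text \<open>Let \<open>c\<close> be least such that \<open>p\<close> does not divide the coefficient of \<open>X\<^sup>c\<close> in
  \<open>(1 + X)\<^sup>N - 1\<close>. Comparing coefficients of \<open>X\<^bsup>i + c\<^esup>\<close> shows inductively that the coefficients of an
  annihilated series lie in all powers of the ideal of \<open>p\<close>.\<close>

lemma regular_q_power_minus_1:
  assumes "N > 0" shows "regular (q ^ N - 1)"
  unfolding regular_def
proof (intro allI impI)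
  fix f :: "'w fps" assume f: "(q ^ N - 1) * f = 0"
  let ?g = "q ^ N - 1 :: 'w fps"
  have g: "?g $ i = of_nat (if i = 0 then 0 else N choose i)" for i
    by (simp add: q_def binomial_fps_nth)
  define c where "c = (LEAST c. c > 0 \<and> \<not> p dvd (N choose c))"
  have "N > 0 \<and> \<not> p dvd (N choose N)" using assms prime_p by (auto simp: prime_nat_iff)
  then have "c > 0 \<and> \<not> p dvd (N choose c)" unfolding c_def by (rule LeastI)
  then have c: "c > 0" "\<not> p dvd (N choose c)" by simp_all
  have least: "p dvd (N choose i)" if "0 < i" "i < c" for i
    using not_less_Least[of i "\<lambda>c. c > 0 \<and> \<not> p dvd (N choose c)"] that unfolding c_def by blast
  have g_c: "?g $ i \<in> GW 1" if "i < c" for i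
  proof (cases "i = 0")
    case False
    then obtain k where "N choose i = p * k" using least[of i] \<open>i < c\<close> by (auto elim: dvdE)
    then show ?thesis
      unfolding g using False W.G_mult_right[OF p_mem_GW] by (simp del: One_nat_def)
  qed (use g[of 0] in simp)
  obtain z where z: "?g $ c * z = 1" using of_nat_unit_W[OF c(2)] c(1) g[of c] by auto
  have "f $ i \<in> GW k" for i k
  proof (induction k arbitrary: i)
    case (Suc k)
    show ?case
    proof (induction i rule: less_induct)
      case (less i)
      have "(\<Sum>j\<in>{0..c+i}. ?g $ j * f $ (c + i - j)) = 0"
        unfolding fps_mult_nth[symmetric] f by simp
      then have "?g $ c * f $ i + (\<Sum>j\<in>{0..c+i} - {c}. ?g $ j * f $ (c + i - j)) = 0"
        by (subst (asm) sum.remove[of _ c]) simp_all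
      \<comment> \<open>For j < c the binomial coefficient contributes one factor p and the outer
        induction the remaining k; for j > c the coefficient of f has index below i, and the inner
        induction applies.\<close>
      moreover have "(\<Sum>j\<in>{0..c+i} - {c}. ?g $ j * f $ (c + i - j)) \<in> GW (Suc k)"
      proof (rule W.G_sum)
        fix j assume j: "j \<in> {0..c+i} - {c}"
        show "?g $ j * f $ (c + i - j) \<in> GW (Suc k)"
        proof (cases "j < c")
          case True
          then show ?thesis using W.G_mult[OF g_c[OF True] Suc] by simp
        next
          case False
          then have "f $ (c + i - j) \<in> GW (Suc k)" using j by (intro less.IH) auto
          then show ?thesis by (rule W.G_mult_left)
        qed
      qed
      ultimately have "?g $ c * f $ i \<in> GW (Suc k)"
        using W.G_uminus by (simp add: eq_neg_iff_add_eq_0[symmetric])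
      then have "z * (?g $ c * f $ i) \<in> GW (Suc k)" by (rule W.G_mult_left)
      then show ?case using z by (simp add: mult.assoc[symmetric] mult.commute[of z])
    qed
  qed simp
  then have "f $ i = 0" for i using W.filtration_separated[of "f $ i"] by simp
  then show "f = 0" by (simp add: fps_eq_iff)
qed

lemma unit_of_nth_0:
  assumes "(f :: 'w fps) $ 0 * z = 1" obtains g where "f * g = 1"
  using that fps_right_inverse[OF assms] by blast

section \<open>The adic filtrations of R and R[[\<xi>]]\<close>

abbreviation GR :: "nat \<Rightarrow> 'w fps set" where "GR \<equiv> ideal_power R_ring (R_ideal p)"
abbreviation GRxi :: "nat \<Rightarrow> 'w fps fps set" where "GRxi \<equiv> ideal_power Rxi_ring (Rxi_ideal p)"

lemma q_minus_1: "q - 1 = (fps_X :: 'w fps)" by (simp add: q_def)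

lemma R_ideal_eq: "R_ideal p = genideal ring_of_type_algebra (insert fps_X (fps_const ` {of_nat p :: 'w}))"
  by (simp add: R_ideal_def R_ring_def q_minus_1 fps_of_nat insert_commute)

lemma Rxi_ideal_eq: "Rxi_ideal p =
  genideal ring_of_type_algebra (insert fps_X (fps_const ` insert fps_X (fps_const ` {of_nat p :: 'w})))"
  by (simp add: Rxi_ideal_def Rxi_ring_def q_minus_1 xi_def fps_of_nat[symmetric] insert_commute)

lemma GR_eq: "GR = type_filtration.fps_filtration GW"
  unfolding R_ideal_eq R_ring_def p_ideal_def by (rule ext) (rule ideal_power_fps)

lemma GRxi_eq: "GRxi = type_filtration.fps_filtration GR"
  unfolding R_ideal_eq Rxi_ideal_eq R_ring_def Rxi_ring_def by (rule ext) (rule ideal_power_fps)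

lemma complete_GR: "complete_filtered_ring ring_of_type_algebra GR"
  unfolding GR_eq by (rule complete_filtered_ring_fps[OF complete_GW])

lemma complete_GRxi: "complete_filtered_ring ring_of_type_algebra GRxi"
  unfolding GRxi_eq by (rule complete_filtered_ring_fps[OF complete_GR])

sublocale R: complete_filtered_ring "ring_of_type_algebra :: 'w fps ring" GR
  by (rule complete_GR)
sublocale R: type_filtration GR by unfold_locales

section \<open>Evaluation of the divided powers\<close>


abbreviation Q :: "'w fps" where "Q \<equiv> q ^ p"
abbreviation U :: "'w fps" where "U \<equiv> (q - 1) * q"
abbreviation D :: "'w fps" where "D \<equiv> gauss_integer q p"

definition qinv :: "'w fps" where "qinv = (SOME z. q * z = 1)"

lemma q_qinv: "q * qinv = 1"
proof -
  obtain z where "q * z = (1 :: 'w fps)" by (rule unit_of_nth_0[of q 1]) (simp add: q_def)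
  then have "\<exists>z. q * z = (1 :: 'w fps)" ..
  then show ?thesis unfolding qinv_def by (rule someI_ex)
qed

lemma regular_unit: "a * b = 1 \<Longrightarrow> regular a"
  using regular_factor[of a b] by simp

lemma regular_q: "regular q" by (rule regular_unit[OF q_qinv])

lemma p_pos: "p > 0" using prime_gt_0_nat[OF prime_p] .

lemma D_telescope: "(q - 1) * D = Q - 1" by (rule gauss_integer_telescope)

text \<open>The Gaussian integer divides q^(a n) - 1, which is a nonzerodivisor, and factors of
  nonzerodivisors are nonzerodivisors.\<close>

lemma regular_gauss_integer: "\<lbrakk>a > 0; n > 0\<rbrakk> \<Longrightarrow> regular (gauss_integer (q ^ a) n)"
proof -
  assume "a > 0" "n > 0"
  then have "regular (gauss_integer (q ^ a) n * (q ^ a - 1))"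
    using regular_q_power_minus_1[of "a * n"]
    unfolding mult.commute[of "gauss_integer (q ^ a) n"] gauss_integer_telescope power_mult[symmetric]
    by simp
  then show ?thesis by (rule regular_factor)
qed

lemma regular_D: "regular D"
  using regular_gauss_integer[of 1 p] p_pos by simp

lemma regular_U: "regular U"
  using regular_mult[OF _ regular_q] regular_q_power_minus_1[of 1] by simp

text \<open>\<open>bas n m\<close> is the value of the \<open>n\<close>-th divided power of \<open>\<omega>\<close> at \<open>\<theta>(q) = q\<^bsup>p m + 1\<^esup>\<close>, where \<open>\<theta>(q)\<close>
  stands for \<open>q + (p)\<^sub>q \<omega>\<close>.\<close>

definition bas :: "nat \<Rightarrow> nat \<Rightarrow> 'w fps" where "bas = gauss_term U Q"

lemma bas_eq_0: "m < n \<Longrightarrow> bas n m = 0" by (simp add: bas_def gauss_term_eq_0)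
lemma bas_0 [simp]: "bas 0 m = 1" by (simp add: bas_def)
lemma bas_self: "bas n n = U ^ n * Q ^ (n * (n - 1) div 2)" by (simp add: bas_def gauss_term_def)

lemma regular_bas_self: "regular (bas n n)"
  unfolding bas_self by (intro regular_mult regular_power regular_U regular_q)

lemma gauss_integer_eq_binomial: "gauss_integer x m = gauss_binomial x m 1"
  using gauss_binomial_absorb[of x m 0] by (simp add: gauss_integer_Suc)

lemma bas_1: "bas 1 m = U * gauss_integer Q m"
  by (simp add: bas_def gauss_term_def gauss_integer_eq_binomial)

section \<open>Gaussian factorials and the multiplication table\<close>

lemma gauss_binomial_factorial:
  "gauss_binomial Q (k + m) k * ((\<Prod>j<k. gauss_integer Q (Suc j)) * (\<Prod>j<m. gauss_integer Q (Suc j))) =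
    (\<Prod>j<k + m. gauss_integer Q (Suc j))"
proof (induction k arbitrary: m)
  case (Suc k)
  let ?g = "gauss_integer Q"
  let ?F = "\<lambda>n. \<Prod>j<n. ?g (Suc j)"
  have "?g (k + Suc m) - ?g k = Q ^ k * ?g (Suc m)" by (simp only: gauss_integer_add add_diff_cancel_left')
  then have *: "Q ^ k * ?g (Suc k) * gauss_binomial Q (k + Suc m) (Suc k) = Q ^ k * ?g (Suc m) * gauss_binomial Q (k + Suc m) k"
    using gauss_binomial_absorb[of Q "k + Suc m" k] by simp
  have "Q ^ k * (gauss_binomial Q (k + Suc m) (Suc k) * (?F (Suc k) * ?F m)) =
    Q ^ k * ?g (Suc k) * gauss_binomial Q (k + Suc m) (Suc k) * (?F k * ?F m)"
    by (simp add: ac_simps)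
  also have "\<dots> = Q ^ k * (gauss_binomial Q (k + Suc m) k * (?F k * ?F (Suc m)))"
    unfolding * by (simp add: ac_simps)
  also have "\<dots> = Q ^ k * ?F (k + Suc m)" unfolding Suc.IH ..
  finally show ?case
    using regular_cancel[OF regular_power[OF regular_power[OF regular_q]]] by simp
qed simp

text \<open>With y = j + r, both sides are the same quotient of Gaussian factorials. Instead of
  dividing, they are multiplied by the factorials of a, j and r, which are nonzerodivisors.\<close>

lemma gauss_binomial_trinomial:
  assumes "j \<le> y"
  shows "gauss_binomial Q (a + y) (a + j) * gauss_binomial Q (a + j) a =
    gauss_binomial Q (a + y) a * gauss_binomial Q y j"
proof -
  let ?g = "gauss_integer Q"
  let ?F = "\<lambda>n. \<Prod>j<n. ?g (Suc j)"
  obtain r where y: "y = j + r" using assms le_Suc_ex by blast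
  have reg: "regular (?F a * (?F j * ?F r))"
    by (intro regular_mult regular_prod regular_gauss_integer p_pos) simp_all
  have "(?F a * (?F j * ?F r)) * (gauss_binomial Q (a + y) (a + j) * gauss_binomial Q (a + j) a) =
    gauss_binomial Q ((a + j) + r) (a + j) * ((gauss_binomial Q (a + j) a * (?F a * ?F j)) * ?F r)"
    unfolding y by (simp add: ac_simps)
  also have "\<dots> = ?F (a + y)" unfolding gauss_binomial_factorial y by (simp add: ac_simps)
  also have "\<dots> = gauss_binomial Q (a + y) a * (?F a * (gauss_binomial Q (j + r) j * (?F j * ?F r)))"
    unfolding gauss_binomial_factorial y ..
  also have "\<dots> = (?F a * (?F j * ?F r)) * (gauss_binomial Q (a + y) a * gauss_binomial Q y j)"
    unfolding y by (simp add: ac_simps)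
  finally show ?thesis by (rule regular_cancel[OF reg])
qed

text \<open>Only the second factor is expanded: for m = a + y the q-Vandermonde identity splits b
  between a and y. In each summand the two Gaussian binomials with upper arguments m and y are
  regrouped by the trinomial identity, and the triangular exponents combine by
  \<open>triangle_add\<close>. For m < a every term vanishes.\<close>

lemma bas_product:
  "(\<Sum>i\<in>{0..min a b}. (q ^ (p * i * (i - 1) div 2) * gauss_binomial Q (a + b - i) a *
      gauss_binomial Q a i * (q - 1) ^ i * q ^ i) * bas (a + b - i) m) = bas a m * bas b m"
proof (cases "m < a")
  case True
  then have "bas (a + b - i) m = 0" if "i \<in> {0..min a b}" for i using that by (intro bas_eq_0) auto
  then show ?thesis using True by (simp add: bas_eq_0)
next
  case False
  then obtain y where m: "m = a + y" using le_Suc_ex by (metis not_le_imp_less)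
  have div: "p * i * (i - 1) div 2 = p * (i * (i - 1) div 2)" for i
    unfolding mult.assoc by (rule div_mult_swap[symmetric]) (cases i; simp)
  have "bas b m = (\<Sum>i\<le>b. bas (b - i) a * Q ^ (a * i) * bas i y)"
    unfolding m bas_def by (rule gauss_term_add)
  also have "\<dots> = (\<Sum>i\<le>b. bas i a * Q ^ (a * (b - i)) * bas (b - i) y)"
    by (rule sum.reindex_bij_witness[of _ "\<lambda>i. b - i" "\<lambda>i. b - i"]) auto
  also have "\<dots> = (\<Sum>i\<in>{0..min a b}. bas i a * Q ^ (a * (b - i)) * bas (b - i) y)"
    by (rule sum.mono_neutral_right) (auto simp: bas_eq_0)
  finally have "bas a m * bas b m = (\<Sum>i\<in>{0..min a b}. bas a m * (bas i a * Q ^ (a * (b - i)) * bas (b - i) y))"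
    by (simp add: sum_distrib_left)
  also have "\<dots> = (\<Sum>i\<in>{0..min a b}. (q ^ (p * i * (i - 1) div 2) * gauss_binomial Q (a + b - i) a *
      gauss_binomial Q a i * (q - 1) ^ i * q ^ i) * bas (a + b - i) m)"
  proof (rule sum.cong[OF refl])
    fix i assume i: "i \<in> {0..min a b}"
    define j where "j = b - i"
    have ab: "a + b - i = a + j" using i by (simp add: j_def)
    have tri: "gauss_binomial Q m (a + j) * gauss_binomial Q (a + j) a = gauss_binomial Q m a * gauss_binomial Q y j"
    proof (cases "j \<le> y")
      case True then show ?thesis unfolding m by (rule gauss_binomial_trinomial)
    qed (simp add: gauss_binomial_eq_0 m)
    have "bas a m * (bas i a * Q ^ (a * j) * bas j y) =
      U ^ i * U ^ (a + j) * Q ^ (i * (i - 1) div 2) * gauss_binomial Q a i *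
      Q ^ (a * (a - 1) div 2 + j * (j - 1) div 2 + a * j) * (gauss_binomial Q m a * gauss_binomial Q y j)"
      by (simp only: bas_def gauss_term_def power_add mult.assoc mult.left_commute mult.commute)
    also have "\<dots> = (q ^ (p * i * (i - 1) div 2) * gauss_binomial Q (a + j) a *
      gauss_binomial Q a i * (q - 1) ^ i * q ^ i) * bas (a + j) m"
      unfolding tri[symmetric] triangle_add[symmetric] div
      by (simp only: bas_def gauss_term_def power_mult power_mult_distrib mult.assoc mult.left_commute mult.commute)
    finally show "bas a m * (bas i a * Q ^ (a * (b - i)) * bas (b - i) y) = (q ^ (p * i * (i - 1) div 2) *
      gauss_binomial Q (a + b - i) a * gauss_binomial Q a i * (q - 1) ^ i * q ^ i) * bas (a + b - i) m"
      unfolding ab j_def .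
  qed
  finally show ?thesis ..
qed

section \<open>The evaluation embedding of the algebra of divided powers\<close>

definition omega_eval :: "(nat \<Rightarrow>\<^sub>0 'w fps) \<Rightarrow> nat \<Rightarrow> 'w fps"
  where "omega_eval x m = (\<Sum>n\<in>Poly_Mapping.keys x. Poly_Mapping.lookup x n * bas n m)"

lemma omega_eval_superset:
  assumes "finite S" "Poly_Mapping.keys x \<subseteq> S"
  shows "omega_eval x m = (\<Sum>n\<in>S. Poly_Mapping.lookup x n * bas n m)"
  unfolding omega_eval_def
  by (rule sum.mono_neutral_left) (use assms in \<open>auto simp: in_keys_iff\<close>)

lemma omega_eval_0 [simp]: "omega_eval 0 m = 0" by (simp add: omega_eval_def)

lemma omega_eval_add: "omega_eval (x + y) m = omega_eval x m + omega_eval y m"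
proof -
  let ?S = "Poly_Mapping.keys x \<union> Poly_Mapping.keys y"
  have "omega_eval (x + y) m = (\<Sum>n\<in>?S. Poly_Mapping.lookup (x + y) n * bas n m)"
    by (rule omega_eval_superset) (use keys_add[of x y] in auto)
  also have "\<dots> = omega_eval x m + omega_eval y m"
    using omega_eval_superset[of ?S x m] omega_eval_superset[of ?S y m]
    by (simp add: lookup_add distrib_right sum.distrib)
  finally show ?thesis .
qed

lemma omega_eval_sum: "omega_eval (sum f S) m = (\<Sum>i\<in>S. omega_eval (f i) m)"
  by (induction S rule: infinite_finite_induct) (simp_all add: omega_eval_add)

lemma omega_eval_single: "omega_eval (Poly_Mapping.single n r) m = r * bas n m"
  using omega_eval_superset[of "{n}" "Poly_Mapping.single n r" m] by (simp add: lookup_single)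

lemma omega_eval_mult:
  "omega_eval (x \<otimes>\<^bsub>omega_ring p\<^esub> y) m = omega_eval x m * omega_eval y m"
proof -
  have "omega_eval (x \<otimes>\<^bsub>omega_ring p\<^esub> y) m = (\<Sum>a\<in>Poly_Mapping.keys x. \<Sum>b\<in>Poly_Mapping.keys y.
    Poly_Mapping.lookup x a * Poly_Mapping.lookup y b *
    (\<Sum>i\<in>{0..min a b}. (q ^ (p * i * (i - 1) div 2) * gauss_binomial Q (a + b - i) a *
      gauss_binomial Q a i * (q - 1) ^ i * q ^ i) * bas (a + b - i) m))"
    by (simp add: omega_ring_def omega_eval_sum omega_eval_single sum_distrib_left mult.assoc)
  also have "\<dots> = omega_eval x m * omega_eval y m"
    unfolding bas_product omega_eval_def sum_product by (intro sum.cong refl) (simp add: ac_simps)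
  finally show ?thesis .
qed

text \<open>At n only the divided powers up to n have a nonzero value, and the diagonal value
  \<open>bas n n\<close> is a nonzerodivisor, so the coefficients are recovered one after the
  other.\<close>

lemma omega_eval_inject: "omega_eval x = omega_eval y \<longleftrightarrow> x = y"
proof
  assume eq: "omega_eval x = omega_eval y"
  have "Poly_Mapping.lookup x n = Poly_Mapping.lookup y n" for n
  proof (induction n rule: less_induct)
    case (less n)
    have *: "omega_eval z n = (\<Sum>k<n. Poly_Mapping.lookup z k * bas k n) + bas n n * Poly_Mapping.lookup z n" for z
    proof -
      have "omega_eval z n = (\<Sum>k\<in>Poly_Mapping.keys z \<union> {..n}. Poly_Mapping.lookup z k * bas k n)"
        by (rule omega_eval_superset) auto
      also have "\<dots> = (\<Sum>k\<in>{..n}. Poly_Mapping.lookup z k * bas k n)"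
        by (rule sum.mono_neutral_right) (auto simp: bas_eq_0)
      finally show ?thesis by (simp add: lessThan_Suc_atMost[symmetric] mult.commute)
    qed
    have "bas n n * Poly_Mapping.lookup x n = bas n n * Poly_Mapping.lookup y n"
      using fun_cong[OF eq, of n] less unfolding * by simp
    then show ?case by (rule regular_cancel[OF regular_bas_self])
  qed
  then show "x = y" by (simp add: poly_mapping_eqI)
qed simp

lemma omega_ring_simps [simp]:
  "carrier (omega_ring p) = UNIV" "\<one>\<^bsub>omega_ring p\<^esub> = Poly_Mapping.single 0 1"
  "\<zero>\<^bsub>omega_ring p\<^esub> = 0" "x \<oplus>\<^bsub>omega_ring p\<^esub> y = x + y"
  by (simp_all add: omega_ring_def)

text \<open>The ring laws are inherited from functions through the injective evaluation;
  associativity of the multiplication table in particular is never expanded.\<close>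

lemma omega_cring: "cring (omega_ring p :: (nat \<Rightarrow>\<^sub>0 'w fps) ring)"
proof (rule cringI)
  show "abelian_group (omega_ring p :: (nat \<Rightarrow>\<^sub>0 'w fps) ring)"
  proof (rule abelian_groupI)
    fix x :: "nat \<Rightarrow>\<^sub>0 'w fps"
    show "\<exists>y\<in>carrier (omega_ring p). y \<oplus>\<^bsub>omega_ring p\<^esub> x = \<zero>\<^bsub>omega_ring p\<^esub>"
      by (intro bexI[of _ "- x"]) simp_all
  qed (simp_all add: ac_simps)
  show "comm_monoid (omega_ring p :: (nat \<Rightarrow>\<^sub>0 'w fps) ring)"
    by (rule comm_monoidI; (subst omega_eval_inject[symmetric])?)
      (simp_all add: fun_eq_iff omega_eval_mult omega_eval_single[of 0 1, simplified] ac_simps)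
qed (simp flip: omega_eval_inject add: fun_eq_iff omega_eval_mult omega_eval_add algebra_simps)

text \<open>The algebra of divided powers, regarded as a ring of functions of the exponent \<open>m\<close>.\<close>

definition AF :: "(nat \<Rightarrow> 'w fps) set" where "AF = range omega_eval"

lemma AF_add: "\<lbrakk>f \<in> AF; g \<in> AF\<rbrakk> \<Longrightarrow> (\<lambda>m. f m + g m) \<in> AF"
  unfolding AF_def by (auto simp: fun_eq_iff omega_eval_add[symmetric])

lemma AF_mult: "\<lbrakk>f \<in> AF; g \<in> AF\<rbrakk> \<Longrightarrow> (\<lambda>m. f m * g m) \<in> AF"
  unfolding AF_def by (auto simp: fun_eq_iff omega_eval_mult[symmetric])

lemma AF_bas: "bas n \<in> AF"
  unfolding AF_def using omega_eval_single[of n 1] by (intro range_eqI[of _ _ "Poly_Mapping.single n 1"]) (simp add: fun_eq_iff)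

lemma AF_const: "(\<lambda>m. c) \<in> AF"
  unfolding AF_def using omega_eval_single[of 0 c] by (intro range_eqI[of _ _ "Poly_Mapping.single 0 c"]) (simp add: fun_eq_iff)

lemma AF_diff: "\<lbrakk>f \<in> AF; g \<in> AF\<rbrakk> \<Longrightarrow> (\<lambda>m. f m - g m) \<in> AF"
  using AF_add[of f "\<lambda>m. (-1) * g m"] AF_mult[OF AF_const[of "-1"], of g] by simp

lemma AF_sum: "(\<And>i. i \<in> S \<Longrightarrow> f i \<in> AF) \<Longrightarrow> (\<lambda>m. \<Sum>i\<in>S. f i m) \<in> AF"
  by (induction S rule: infinite_finite_induct) (simp_all add: AF_const AF_add)

lemma AF_prod: "(\<And>i. i \<in> S \<Longrightarrow> f i \<in> AF) \<Longrightarrow> (\<lambda>m. \<Prod>i\<in>S. f i m) \<in> AF"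
  by (induction S rule: infinite_finite_induct) (simp_all add: AF_const AF_mult)

lemma AF_power: "f \<in> AF \<Longrightarrow> (\<lambda>m. f m ^ n) \<in> AF"
  by (induction n) (simp_all add: AF_const AF_mult)

lemma AF_induct [consumes 1, case_names bas add]:
  assumes f: "f \<in> AF"
    and bas: "\<And>c n. P (\<lambda>m. c * bas n m)"
    and add: "\<And>f g. \<lbrakk>P f; P g\<rbrakk> \<Longrightarrow> P (\<lambda>m. f m + g m)"
  shows "P f"
proof -
  obtain x where x: "f = omega_eval x" using f by (auto simp: AF_def)
  have "P (\<lambda>m. \<Sum>n\<in>S. Poly_Mapping.lookup x n * bas n m)" if "finite S" for S
    using that
  proof (induction S)
    case empty
    then show ?case using bas[of 0 0] by simp
  next
    case (insert k S)
    then show ?case using add[OF bas[of "Poly_Mapping.lookup x k" k]] by simp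
  qed
  then show ?thesis unfolding x omega_eval_def by simp
qed

text \<open>Summing \<open>u Q\<^sup>i\<close> times the \<open>n\<close>-th divided power gives the next one.\<close>

lemma AF_summation: "f \<in> AF \<Longrightarrow> (\<lambda>m. \<Sum>i<m. U * Q ^ i * f i) \<in> AF"
proof (induction f rule: AF_induct)
  case (bas c n)
  have "(\<Sum>i<m. U * Q ^ i * (c * bas n i)) = c * bas (Suc n) m" for m
    unfolding bas_def gauss_term_sum[symmetric] by (simp add: sum_distrib_left ac_simps)
  then show ?case using AF_mult[OF AF_const AF_bas] by simp
next
  case (add f g)
  then show ?case using AF_add[OF add] by (simp add: sum.distrib distrib_left)
qed

text \<open>Q^m - 1 = (q - 1) (p)_q (m)_Q, while the first divided power has the value (q - 1) q
  (m)_Q; the inverse of q corrects the extra factor.\<close>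

lemma Q_power_eq: "Q ^ m = 1 + D * qinv * bas 1 m"
proof -
  have "D * qinv * bas 1 m = (q * qinv) * ((q - 1) * D * gauss_integer Q m)"
    unfolding bas_1 by (simp add: ac_simps)
  then show ?thesis
    unfolding q_qinv D_telescope gauss_integer_telescope by simp
qed

lemma AF_Q_power: "(\<lambda>m. Q ^ m) \<in> AF"
  unfolding Q_power_eq by (intro AF_add AF_mult AF_const AF_bas)

lemma Q_inverse_power: "qinv ^ (p * k) * Q ^ k = 1"
proof -
  have "qinv ^ (p * k) * Q ^ k = (q * qinv) ^ (p * k)"
    unfolding power_mult_distrib power_mult[of q, symmetric] by (rule mult.commute)
  then show ?thesis by (simp add: q_qinv)
qed

text \<open>Induction on k by summation. Up to the power (Q^p)^k, the difference of the next
  binomial at i is (Q^p)^i times the previous one. Here (Q^p)^i = Q^i (Q^i)^(p - 1): the first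
  factor is the weight of \<open>AF_summation\<close>, and the second is a function of the algebra.
  The remaining power of Q is constant and is removed by \<open>qinv\<close>.\<close>

lemma AF_binomial_Q_p: "(\<lambda>m. U ^ k * gauss_binomial (Q ^ p) m k) \<in> AF"
proof (induction k)
  case (Suc k)
  have "(\<lambda>m. \<Sum>i<m. U * Q ^ i * ((Q ^ i) ^ (p - 1) * (U ^ k * gauss_binomial (Q ^ p) i k))) \<in> AF"
    by (intro AF_summation AF_mult AF_power AF_Q_power Suc)
  then have *: "(\<lambda>m. qinv ^ (p * (p * k)) * (\<Sum>i<m. U * Q ^ i * ((Q ^ i) ^ (p - 1) * (U ^ k * gauss_binomial (Q ^ p) i k)))) \<in> AF"
    by (intro AF_mult AF_const)
  have pw: "Q ^ i * (Q ^ i) ^ (p - 1) = (Q ^ p) ^ i" for i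
    using p_pos by (metis Suc_diff_1 mult.commute power_Suc power_mult)
  have trm: "U * Q ^ i * ((Q ^ i) ^ (p - 1) * (U ^ k * gauss_binomial (Q ^ p) i k)) =
    U ^ Suc k * ((Q ^ p) ^ k * (gauss_binomial (Q ^ p) (Suc i) (Suc k) - gauss_binomial (Q ^ p) i (Suc k)))" for i
    unfolding gauss_binomial_difference unfolding pw[symmetric] by (simp only: power_Suc ac_simps)
  have sum: "(\<Sum>i<m. U * Q ^ i * ((Q ^ i) ^ (p - 1) * (U ^ k * gauss_binomial (Q ^ p) i k))) =
    Q ^ (p * k) * (U ^ Suc k * gauss_binomial (Q ^ p) m (Suc k))" for m
    unfolding trm
    by (induction m) (simp_all add: algebra_simps power_mult[symmetric] del: gauss_binomial.simps(3))
  have "qinv ^ (p * (p * k)) * (Q ^ (p * k) * z) = z" for z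
    using Q_inverse_power[of "p * k"] by (metis mult.assoc mult_1)
  then show ?case using * unfolding sum by simp
qed (simp add: AF_const)

text \<open>(p m)_Q factors as (m)_Q times the Gaussian integer of p at Q^m; with \<open>U\<close>
  the first becomes \<open>bas 1 m\<close>, and the second is a polynomial in Q^m.\<close>

lemma AF_U_gauss_integer_p: "(\<lambda>m. U * gauss_integer Q (p * m)) \<in> AF"
proof -
  have "U * gauss_integer Q (p * m) = bas 1 m * (\<Sum>k<p. (Q ^ m) ^ k)" for m
    unfolding bas_1 using gauss_integer_mult[of Q m p]
    by (simp add: mult.commute[of p m] mult.assoc gauss_integer_def[of "Q ^ m"])
  then show ?thesis
    by (simp add: AF_mult[OF AF_bas AF_sum] AF_power AF_Q_power)
qed

text \<open>At q = 1 the value is j, which is prime to p and hence a unit of W; a power series with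
  invertible constant term is invertible.\<close>

lemma gauss_integer_unit:
  assumes "\<not> p dvd j" obtains z where "gauss_integer Q j * z = 1"
proof -
  have "(q ^ n :: 'w fps) $ 0 = 1" for n by (simp add: q_def binomial_fps_nth)
  then have "gauss_integer Q j $ 0 = of_nat j" by (simp add: gauss_integer_def fps_sum_nth flip: power_mult)
  then show ?thesis using of_nat_unit_W[OF assms] unit_of_nth_0[of "gauss_integer Q j"] that by metis
qed

lemma prod_unit:
  assumes "finite S" "\<And>j. j \<in> S \<Longrightarrow> \<exists>z. f j * z = (1 :: 'w fps)"
  shows "\<exists>z. prod f S * z = 1"
  using assms
proof (induction S)
  case (insert j S)
  then obtain y z where "f j * y = 1" "prod f S * z = 1" by blast
  then have "prod f (insert j S) * (y * z) = (f j * y) * (prod f S * z)" "f j * y = 1" "prod f S * z = 1"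
    using insert by (simp_all add: ac_simps)
  then show ?case by (metis mult_1)
qed auto

section \<open>Integrality of the comultiplication\<close>


text \<open>The quotient is integral in \<open>j\<close>, although \<open>(i + 1)\<^sub>Q\<close> is not invertible: the factors of the
  falling product of \<open>(p m + 1)\<^sub>Q\<close> whose index is divisible by \<open>p\<close> combine to a Gaussian binomial
  at \<open>Q\<^sup>p\<close>, and the other denominators are units.\<close>

lemma AF_quotient:
  "\<exists>f\<in>AF. \<forall>m. gauss_integer Q (p * m + 1) * f m = U ^ i * gauss_binomial Q (p * m + 1) (Suc i)"
proof -
  let ?g = "gauss_integer Q"
  \<comment> \<open>This is the number of multiples of p among the denominators 1, ..., i + 1. The
    first k multiples of p among the numerator indices 0, ..., i - 1 are matched with them; one
    further multiple may be left over and is treated like the other factors.\<close>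
  define k where "k = Suc i div p"
  define T where "T = (\<lambda>t. p * t) ` {..<k}"
  have T: "T \<subseteq> {..<i}"
  proof
    fix j assume "j \<in> T"
    then obtain t where t: "j = p * t" "Suc t \<le> k" unfolding T_def using Suc_leI by blast
    have "p * Suc t \<le> p * k" by (rule mult_le_mono2[OF t(2)])
    also have "\<dots> \<le> Suc i" unfolding k_def by (rule times_div_less_eq_dividend)
    finally show "j \<in> {..<i}" using t prime_gt_1_nat[OF prime_p] by simp
  qed
  have inj: "inj_on (\<lambda>t. p * t) A" for A :: "nat set" using p_pos by (auto simp: inj_on_def)
  define T' where "T' = (\<lambda>t. p * Suc t) ` {..<k}"
  have T': "T' = {j \<in> {1..Suc i}. p dvd j}"
  proof (intro equalityI subsetI)
    fix j assume "j \<in> T'"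
    then obtain t where t: "j = p * Suc t" "Suc t \<le> k" unfolding T'_def using Suc_leI by blast
    have "p * Suc t \<le> p * k" by (rule mult_le_mono2[OF t(2)])
    also have "\<dots> \<le> Suc i" unfolding k_def by (rule times_div_less_eq_dividend)
    finally show "j \<in> {j \<in> {1..Suc i}. p dvd j}" using t p_pos by simp
  next
    fix j assume j: "j \<in> {j \<in> {1..Suc i}. p dvd j}"
    then obtain t where t: "j = p * t" by (auto elim: dvdE)
    with j have "t > 0" "p * t \<le> Suc i" by (auto intro: Nat.gr0I)
    then have "t \<le> k" using p_pos by (simp add: k_def less_eq_div_iff_mult_less_eq mult.commute)
    then show "j \<in> T'" using t \<open>t > 0\<close> unfolding T'_def by (intro image_eqI[of _ _ "t - 1"]) auto
  qed
  define V where "V = (\<Prod>j\<in>{1..Suc i} - T'. ?g j)"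
  define F where "F = (\<Prod>t<k. ?g (p * Suc t))"
  have "\<exists>z. V * z = 1"
    unfolding V_def
  proof (rule prod_unit)
    fix j assume "j \<in> {1..Suc i} - T'"
    then have "\<not> p dvd j" unfolding T' by blast
    then show "\<exists>z. ?g j * z = 1" using gauss_integer_unit by metis
  qed simp
  then obtain Vi where Vi: "V * Vi = 1" ..
  have regF: "regular F"
    unfolding F_def using p_pos by (intro regular_prod regular_gauss_integer) simp_all
  have F_eq: "F = D' ^ k * (\<Prod>t<k. gauss_integer (Q ^ p) (Suc t))" if "D' = ?g p" for D'
    unfolding F_def that gauss_integer_mult by (simp add: prod.distrib)
  have fact: "(\<Prod>j<Suc i. ?g (Suc j)) = F * V"
  proof -
    have "(\<Prod>j<Suc i. ?g (Suc j)) = (\<Prod>j\<in>{1..Suc i}. ?g j)"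
      by (rule prod.reindex_bij_witness[of _ "\<lambda>j. j - 1" Suc]) auto
    also have "\<dots> = V * prod ?g T'"
      unfolding V_def by (rule prod.subset_diff) (auto simp: T')
    also have "prod ?g T' = F"
      unfolding T'_def F_def using p_pos by (subst prod.reindex) (auto simp: inj_on_def)
    finally show ?thesis by (simp add: mult.commute)
  qed
  define h where "h m = (\<Prod>j\<in>{..<i} - T. ?g (p * m) - ?g j)" for m
  define B where "B m = gauss_binomial (Q ^ p) m k" for m
  \<comment> \<open>In the falling product of (p m + 1)_Q the factor of index 0 is (p m + 1)_Q
    itself, the desired divisor, and the others are Q ((p m)_Q - (j)_Q). The factors with j in
    \<open>T\<close> give (p)_Q^k times a falling product at Q^p, and the factorial in the latter
    combines with (p)_Q^k to the cancelled \<open>F\<close>.\<close>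
  have prod: "Q ^ (Suc i * i div 2) * gauss_binomial Q (p * m + 1) (Suc i) * V =
    ?g (p * m + 1) * (Q ^ i * (Q ^ p) ^ (k * (k - 1) div 2) * B m * h m)" for m
  proof (rule regular_cancel[OF regF])
    have "F * (Q ^ (Suc i * i div 2) * gauss_binomial Q (p * m + 1) (Suc i) * V) =
      (\<Prod>j<Suc i. ?g (p * m + 1) - ?g j)"
      unfolding gauss_falling_product fact by (simp add: ac_simps)
    also have "\<dots> = ?g (p * m + 1) * (\<Prod>j<i. Q * (?g (p * m) - ?g j))"
      unfolding prod.lessThan_Suc_shift using gauss_integer_Suc'[of Q] by (simp add: right_diff_distrib)
    also have "\<dots> = ?g (p * m + 1) * Q ^ i * (\<Prod>j<i. ?g (p * m) - ?g j)"
      by (simp add: prod.distrib mult.assoc)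
    also have "(\<Prod>j<i. ?g (p * m) - ?g j) = h m * (\<Prod>j\<in>T. ?g (p * m) - ?g j)"
      unfolding h_def by (rule prod.subset_diff[OF T]) simp
    also have "(\<Prod>j\<in>T. ?g (p * m) - ?g j) = (\<Prod>t<k. ?g (p * m) - ?g (p * t))"
      unfolding T_def by (subst prod.reindex[OF inj]) simp
    also have "\<dots> = ?g p ^ k * (\<Prod>t<k. gauss_integer (Q ^ p) m - gauss_integer (Q ^ p) t)"
      unfolding gauss_integer_mult by (simp add: right_diff_distrib[symmetric] prod.distrib)
    also have "\<dots> = (Q ^ p) ^ (k * (k - 1) div 2) * B m * F"
      unfolding gauss_falling_product F_eq[OF refl] B_def by (simp add: ac_simps)
    finally show "F * (Q ^ (Suc i * i div 2) * gauss_binomial Q (p * m + 1) (Suc i) * V) =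
      F * (?g (p * m + 1) * (Q ^ i * (Q ^ p) ^ (k * (k - 1) div 2) * B m * h m))"
      by (simp add: ac_simps)
  qed
  have kT: "card T = k" unfolding T_def by (simp add: card_image[OF inj])
  then have ki: "i = k + card ({..<i} - T)"
    using card_Diff_subset[OF finite_subset[OF T] T] card_mono[OF _ T] by simp
  \<comment> \<open>The constant inverts the power of Q and the unit \<open>V\<close>. Of the i
    factors \<open>U\<close>, k go to the Gaussian binomial at Q^p and one to each remaining factor
    of the falling product; \<open>ki\<close> says that this uses all of them.\<close>
  define c where "c = qinv ^ (p * (Suc i * i div 2)) * Vi * (Q ^ i * (Q ^ p) ^ (k * (k - 1) div 2))"
  define f where "f m = c * ((U ^ k * B m) * (\<Prod>j\<in>{..<i} - T. U * ?g (p * m) - U * ?g j))" for m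
  have "f \<in> AF"
    unfolding f_def B_def
    by (intro AF_mult AF_const AF_binomial_Q_p AF_prod AF_diff AF_U_gauss_integer_p)
  moreover have "?g (p * m + 1) * f m = U ^ i * gauss_binomial Q (p * m + 1) (Suc i)" for m
  proof -
    have "(\<Prod>j\<in>{..<i} - T. U * ?g (p * m) - U * ?g j) = U ^ card ({..<i} - T) * h m"
      unfolding h_def right_diff_distrib[symmetric] prod.distrib[of "\<lambda>_. U"] prod_constant ..
    then have "f m = c * (U ^ i * (B m * h m))"
      unfolding f_def by (subst ki) (simp add: power_add ac_simps)
    then have "?g (p * m + 1) * f m = qinv ^ (p * (Suc i * i div 2)) * Vi * U ^ i *
      (?g (p * m + 1) * (Q ^ i * (Q ^ p) ^ (k * (k - 1) div 2) * B m * h m))"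
      unfolding c_def by (simp add: ac_simps)
    also have "\<dots> = (qinv ^ (p * (Suc i * i div 2)) * Q ^ (Suc i * i div 2)) * (V * Vi) *
      (U ^ i * gauss_binomial Q (p * m + 1) (Suc i))"
      unfolding prod[symmetric] by (simp only: ac_simps)
    finally show ?thesis unfolding Q_inverse_power Vi by simp
  qed
  ultimately show ?thesis by blast
qed

text \<open>With y = q^(p m + 1), the function v is the quotient of (p)_y by (p)_q. Multiplied by
  (p)_q, both sides become y (y^p - 1), on the left because Q^(p m + 1) = y^p. The point is that v
  belongs to the algebra.\<close>

lemma AF_twist:
  "\<exists>v\<in>AF. \<forall>m. U * gauss_integer Q (p * m + 1) * Q ^ m = (q ^ (p * m + 1) - 1) * q ^ (p * m + 1) * v m"
proof
  \<comment> \<open>Each y^k - q^k = q^k ((Q^m)^k - 1) is (p)_q times a function of the algebra; the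
    sum over k < p is (p)_y - (p)_q, which is to be (p)_q (v - 1).\<close>
  define v where "v m = 1 + bas 1 m * (\<Sum>k<p. q ^ k * qinv * gauss_integer (Q ^ m) k)" for m
  have gi: "gauss_integer (Q ^ m) k = (\<Sum>j<k. (Q ^ m) ^ j)" for m k by (simp add: gauss_integer_def)
  show "v \<in> AF"
    unfolding v_def gi
    by (intro AF_add AF_mult AF_const AF_bas AF_sum AF_power AF_Q_power)
  show "\<forall>m. U * gauss_integer Q (p * m + 1) * Q ^ m = (q ^ (p * m + 1) - 1) * q ^ (p * m + 1) * v m"
  proof
    fix m
    define y where "y = q * Q ^ m"
    have y: "q ^ (p * m + 1) = y" by (simp add: y_def power_mult)
    have b: "D * bas 1 m * (q ^ k * qinv * gauss_integer (Q ^ m) k) = y ^ k - q ^ k" for k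
    proof -
      have "D * bas 1 m * (q ^ k * qinv * gauss_integer (Q ^ m) k) =
        (q * qinv) * q ^ k * (((q - 1) * D * gauss_integer Q m) * gauss_integer (Q ^ m) k)"
        unfolding bas_1 by (simp add: ac_simps)
      also have "\<dots> = q ^ k * ((Q ^ m) ^ k - 1)"
        unfolding q_qinv D_telescope gauss_integer_telescope by simp
      finally show ?thesis by (simp add: y_def right_diff_distrib power_mult_distrib)
    qed
    have "D * v m = D + (\<Sum>k<p. D * bas 1 m * (q ^ k * qinv * gauss_integer (Q ^ m) k))"
      unfolding v_def by (simp add: distrib_left sum_distrib_left mult.assoc)
    also have "\<dots> = gauss_integer y p"
      unfolding b sum_subtractf by (simp add: gauss_integer_def)
    finally have v: "D * v m = gauss_integer y p" .
    show "U * gauss_integer Q (p * m + 1) * Q ^ m = (q ^ (p * m + 1) - 1) * q ^ (p * m + 1) * v m"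
    proof (rule regular_cancel[OF regular_D])
      have "D * (U * gauss_integer Q (p * m + 1) * Q ^ m) =
        q * Q ^ m * (((q - 1) * D) * gauss_integer Q (p * m + 1))"
        by (simp only: ac_simps)
      also have "\<dots> = y * (Q ^ (p * m + 1) - 1)"
        unfolding D_telescope gauss_integer_telescope y_def ..
      also have "Q ^ (p * m + 1) = y ^ p"
        unfolding y[symmetric] power_mult[symmetric] by (simp add: mult.commute)
      also have "y * (y ^ p - 1) = D * ((y - 1) * y * v m)"
        unfolding gauss_integer_telescope[symmetric] v[symmetric] by (simp only: ac_simps)
      finally show "D * (U * gauss_integer Q (p * m + 1) * Q ^ m) =
        D * ((q ^ (p * m + 1) - 1) * q ^ (p * m + 1) * v m)" unfolding y .
    qed
  qed
qed

text \<open>The functions of two exponents that come from finite sums of pure tensors. A scalar r of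
  the right factor acts on the left one through \<theta>(r), hence at m as \<psi>(r); the
  endomorphisms are a parameter since they are constructed only from the Taylor map.\<close>

inductive_set tensor_functions :: "(nat \<Rightarrow> 'w fps \<Rightarrow> 'w fps) \<Rightarrow> (nat \<Rightarrow> nat \<Rightarrow> 'w fps) set"
  for \<psi> where
  pure: "\<lbrakk>a \<in> AF; b \<in> AF\<rbrakk> \<Longrightarrow> (\<lambda>m l. a m * \<psi> m (b l)) \<in> tensor_functions \<psi>"
| add: "\<lbrakk>F \<in> tensor_functions \<psi>; G \<in> tensor_functions \<psi>\<rbrakk> \<Longrightarrow> (\<lambda>m l. F m l + G m l) \<in> tensor_functions \<psi>"

text \<open>Here \<open>\<psi> m\<close> plays the role of the endomorphism \<open>q \<mapsto> q\<^bsup>p m + 1\<^esup>\<close> of \<open>R\<close>. The \<open>q\<close>-Vandermonde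
  identity gives the difference of the function in the direction of \<open>l\<close>, which is then summed up.\<close>

lemma bas_tensor_function:
  assumes \<psi>_add: "\<And>m x y. \<psi> m (x + y) = \<psi> m x + \<psi> m y"
    and \<psi>_mult: "\<And>m x y. \<psi> m (x * y) = \<psi> m x * \<psi> m y"
    and \<psi>_1: "\<And>m. \<psi> m 1 = 1" and \<psi>_q: "\<And>m. \<psi> m q = q ^ (p * m + 1)"
  shows "(\<lambda>m l. bas n (p * m * l + m + l)) \<in> tensor_functions \<psi>"
proof -
  let ?T = "tensor_functions \<psi>"
  have \<psi>_0: "\<psi> m 0 = 0" for m using \<psi>_add[of m 0 0] by simp
  have \<psi>_sum: "\<psi> m (sum f S) = (\<Sum>i\<in>S. \<psi> m (f i))" for m f and S :: "nat set"
    by (induction S rule: infinite_finite_induct) (simp_all add: \<psi>_0 \<psi>_add)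
  have \<psi>_power: "\<psi> m (x ^ k) = \<psi> m x ^ k" for m x k
    by (induction k) (simp_all add: \<psi>_1 \<psi>_mult)
  have \<psi>_diff: "\<psi> m (x - y) = \<psi> m x - \<psi> m y" for m x y
    using \<psi>_add[of m "x - y" y] by (simp add: algebra_simps)
  have left: "(\<lambda>m l. a m) \<in> ?T" if "a \<in> AF" for a
    using tensor_functions.pure[OF that AF_const[of 1], of \<psi>] by (simp add: \<psi>_1)
  have right: "(\<lambda>m l. \<psi> m (b l)) \<in> ?T" if "b \<in> AF" for b
    using tensor_functions.pure[OF AF_const[of 1] that, of \<psi>] by simp
  have T_mult: "(\<lambda>m l. F m l * G m l) \<in> ?T" if F: "F \<in> ?T" and G: "G \<in> ?T" for F G
    using F
  proof induction
    case (pure a b)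
    show ?case using G
    proof induction
      case (pure a' b')
      have "(\<lambda>m l. (a m * a' m) * \<psi> m (b l * b' l)) \<in> ?T"
        by (intro tensor_functions.pure AF_mult pure \<open>a \<in> AF\<close> \<open>b \<in> AF\<close>)
      then show ?case by (simp add: \<psi>_mult ac_simps)
    next
      case (add F G)
      then show ?case using tensor_functions.add by (simp add: distrib_left)
    qed
  next
    case (add F G)
    then show ?case using tensor_functions.add by (simp add: distrib_right)
  qed
  have T_power: "(\<lambda>m l. F m l ^ k) \<in> ?T" if "F \<in> ?T" for F k
    by (induction k) (simp_all add: T_mult that left[OF AF_const[of 1]])
  have T_sum: "(\<lambda>m l. \<Sum>i\<in>S. F i m l) \<in> ?T" if "\<And>i. i \<in> S \<Longrightarrow> F i \<in> ?T" for F and S :: "nat set"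
    using that by (induction S rule: infinite_finite_induct)
      (simp_all add: left[OF AF_const[of 0]] tensor_functions.add)
  define u :: "nat \<Rightarrow> 'w fps" where "u m = (q ^ (p * m + 1) - 1) * q ^ (p * m + 1)" for m
  have \<psi>_U: "\<psi> m U = u m" for m by (simp only: \<psi>_mult \<psi>_diff \<psi>_q \<psi>_1 u_def)
  define Qm :: "nat \<Rightarrow> 'w fps" where "Qm m = (q ^ (p * m + 1)) ^ p" for m
  have \<psi>_Q: "\<psi> m Q = Qm m" for m by (simp only: \<psi>_power \<psi>_q Qm_def)
  \<comment> \<open>The summation operator of the right factor, transported by
    \<open>\<psi> m\<close>: its weight \<open>U * Q ^ i\<close> turns into
    \<open>u m * Qm m ^ i\<close>. This fixes the shape that the differences in l must have.\<close>
  have T_summation: "(\<lambda>m l. \<Sum>i<l. u m * Qm m ^ i * F m i) \<in> ?T" if "F \<in> ?T" for F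
    using that
  proof induction
    case (pure a b)
    have "(\<lambda>m l. a m * \<psi> m (\<Sum>i<l. U * Q ^ i * b i)) \<in> ?T"
      by (intro tensor_functions.pure pure AF_summation)
    moreover have "\<psi> m (U * Q ^ i * b i) = u m * Qm m ^ i * \<psi> m (b i)" for m i
      by (simp only: \<psi>_mult[of m "U * Q ^ i" "b i"] \<psi>_mult[of m U "Q ^ i"] \<psi>_U \<psi>_power[of m Q i] \<psi>_Q)
    then have "a m * \<psi> m (\<Sum>i<l. U * Q ^ i * b i) = (\<Sum>i<l. u m * Qm m ^ i * (a m * \<psi> m (b i)))" for m l
      unfolding \<psi>_sum by (simp only: sum_distrib_left ac_simps)
    ultimately show ?case by simp
  next
    case (add F G)
    then show ?case using tensor_functions.add[OF add.IH] by (simp add: sum.distrib distrib_left)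
  qed
  obtain v where v: "v \<in> AF" "\<And>m. U * gauss_integer Q (p * m + 1) * Q ^ m = u m * v m"
    using AF_twist unfolding u_def by blast
  obtain f where f: "\<And>k. f k \<in> AF"
    "\<And>k m. gauss_integer Q (p * m + 1) * f k m = U ^ k * gauss_binomial Q (p * m + 1) (Suc k)"
    using AF_quotient by metis
  define g where "g k m = Q ^ (Suc k * (Suc k - 1) div 2) * (v m * ((Q ^ m) ^ k * f k m))" for k m
  have g: "g k \<in> AF" for k
    unfolding g_def by (intro AF_mult AF_const v f AF_power AF_Q_power)
  \<comment> \<open>In this form one step in l adds p m + 1, so that the second argument in the
    q-Vandermonde identity depends on m alone.\<close>
  define M where "M m l = m + (p * m + 1) * l" for m l
  have QM: "Q ^ M m l = Q ^ m * Qm m ^ l" for m l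
  proof -
    have "Qm m = Q ^ (p * m + 1)" unfolding Qm_def power_mult[symmetric] by (simp only: mult.commute)
    then show ?thesis by (simp only: M_def power_add[of Q m] power_mult[of Q "p * m + 1" l])
  qed
  \<comment> \<open>One of the k + 1 factors Q^(M m l) is singled out: its part Q^m enters the
    twist, and its part in l is the summation weight. \<open>f\<close> extracts (p m + 1)_Q from the
    Gaussian binomial, and \<open>v\<close> converts that into \<open>u m\<close>.\<close>
  have step: "Q ^ (M m l * Suc k) * bas (Suc k) (p * m + 1) = u m * Qm m ^ l * (g k m * (Qm m ^ l) ^ k)" for m l k
  proof -
    have "Q ^ (M m l * Suc k) * bas (Suc k) (p * m + 1) =
      Qm m ^ l * (Qm m ^ l) ^ k * (Q ^ m) ^ k * Q ^ (Suc k * (Suc k - 1) div 2) *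
        (U * Q ^ m * (U ^ k * gauss_binomial Q (p * m + 1) (Suc k)))"
      unfolding power_mult[of Q "M m l"] QM bas_def gauss_term_def power_mult_distrib power_Suc
      by (simp only: ac_simps)
    also have "\<dots> = Qm m ^ l * (Qm m ^ l) ^ k * (Q ^ m) ^ k * Q ^ (Suc k * (Suc k - 1) div 2) *
        ((U * gauss_integer Q (p * m + 1) * Q ^ m) * f k m)"
      unfolding f(2)[symmetric] by (simp only: ac_simps)
    also have "\<dots> = u m * Qm m ^ l * (g k m * (Qm m ^ l) ^ k)"
      unfolding v(2) g_def by (simp only: ac_simps)
    finally show ?thesis .
  qed
  have "(\<lambda>m l. bas n (M m l)) \<in> ?T"
  proof (induction n rule: less_induct)
    case (less n)
    show ?case
    proof (cases n)
      case 0
      then show ?thesis using left[OF AF_const[of 1]] by simp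
    next
      case (Suc j)
      \<comment> \<open>The difference in l divided by the summation weight. Only divided powers of
        index below n occur, so the induction hypothesis makes \<open>H\<close> a tensor
        function.\<close>
      define H where "H m l = (\<Sum>k\<le>j. (g k m * (Qm m ^ l) ^ k) * bas (j - k) (M m l))" for m l
      have "(\<lambda>m l. Qm m ^ l) \<in> ?T"
        using right[OF AF_Q_power] by (simp add: \<psi>_power[of _ Q] \<psi>_Q)
      then have "H \<in> ?T"
        unfolding H_def using Suc
        by (intro T_sum T_mult left g T_power less) auto
      from T_summation[OF this] have sumT: "(\<lambda>m l. bas n m + (\<Sum>i<l. u m * Qm m ^ i * H m i)) \<in> ?T"
        by (intro tensor_functions.add left AF_bas)
      have diff: "bas n (M m (Suc l)) = bas n (M m l) + u m * Qm m ^ l * H m l" for m l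
      proof -
        have M: "M m (Suc l) = M m l + (p * m + 1)" by (simp add: M_def)
        have "bas n (M m (Suc l)) = (\<Sum>i\<le>Suc j. bas (Suc j - i) (M m l) * Q ^ (M m l * i) * bas i (p * m + 1))"
          unfolding M bas_def Suc by (rule gauss_term_add)
        also have "\<dots> = bas n (M m l) + (\<Sum>k\<le>j. bas (j - k) (M m l) * (Q ^ (M m l * Suc k) * bas (Suc k) (p * m + 1)))"
          by (subst sum.atMost_Suc_shift) (simp add: Suc mult.assoc)
        also have "\<dots> = bas n (M m l) + u m * Qm m ^ l * H m l"
          unfolding step H_def by (simp add: sum_distrib_left ac_simps)
        finally show ?thesis .
      qed
      have "bas n (M m l) = bas n m + (\<Sum>i<l. u m * Qm m ^ i * H m i)" for m l
      proof (induction l)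
        case (Suc l)
        then show ?case unfolding diff by simp
      qed (simp add: M_def)
      then show ?thesis using sumT by simp
    qed
  qed
  moreover have "M m l = p * m * l + m + l" for m l by (simp add: M_def algebra_simps)
  ultimately show ?thesis by simp
qed

section \<open>Maps out of \<open>R\<close> and \<open>R[[\<xi>]]\<close>\<close>


sublocale A: cring "omega_ring p :: (nat \<Rightarrow>\<^sub>0 'w fps) ring" by (rule omega_cring)

sublocale Om: adic_ring "omega_ring p :: (nat \<Rightarrow>\<^sub>0 'w fps) ring" "omega_ideal p"
  rewrites hat_eq: "adic_completion (omega_ring p) (omega_ideal p) = omega_hat p"
    and nhd_eq: "completion_nhd (omega_ring p) (omega_ideal p) = omega_hat_nhd p"
proof -
  show "adic_ring (omega_ring p :: (nat \<Rightarrow>\<^sub>0 'w fps) ring) (omega_ideal p)"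
    unfolding omega_ideal_def
    by (intro adic_ring.intro adic_ring_axioms.intro omega_cring A.genideal_ideal) simp
qed (simp_all add: omega_hat_def omega_hat_nhd_def fun_eq_iff)

lemma single_hom: "Poly_Mapping.single 0 \<in> ring_hom ring_of_type_algebra (omega_ring p :: (nat \<Rightarrow>\<^sub>0 'w fps) ring)"
  by (rule ring_hom_memI)
    (simp_all add: single_add omega_eval_inject[symmetric] fun_eq_iff omega_eval_mult omega_eval_single)

lemma omega_hat_const_eq: "omega_hat_const p r = Om.to (Poly_Mapping.single 0 r)"
  by (simp add: omega_hat_const_def)

lemma omega_hat_const_hom: "omega_hat_const p \<in> ring_hom ring_of_type_algebra (omega_hat p :: (nat \<Rightarrow> (nat \<Rightarrow>\<^sub>0 'w fps) set) ring)"
proof -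
  have "omega_hat_const p = Om.to \<circ> Poly_Mapping.single 0" by (rule ext) (simp add: omega_hat_const_eq)
  then show ?thesis using ring_hom_trans[OF single_hom Om.to_completion_hom] by simp
qed

sublocale oc: ring_hom_ring "ring_of_type_algebra :: 'w fps ring" "omega_hat p" "omega_hat_const p"
  using omega_hat_const_hom R.ring_axioms Om.hat.ring_axioms by (intro ring_hom_ringI2)

lemma omega_hat_const_simps:
  "omega_hat_const p (r :: 'w fps) \<in> carrier (omega_hat p)"
  "omega_hat_const p (r + s) = omega_hat_const p r \<oplus>\<^bsub>omega_hat p\<^esub> omega_hat_const p s"
  "omega_hat_const p (r * s) = omega_hat_const p r \<otimes>\<^bsub>omega_hat p\<^esub> omega_hat_const p s"
  "omega_hat_const p (1 :: 'w fps) = \<one>\<^bsub>omega_hat p\<^esub>"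
  using oc.hom_closed[of r] oc.hom_add[of r s] oc.hom_mult[of r s] oc.hom_one by simp_all

lemma const_generators_nhd:
  "omega_hat_const p (of_nat p :: 'w fps) \<in> omega_hat_nhd p 1" "omega_hat_const p (fps_X :: 'w fps) \<in> omega_hat_nhd p 1"
proof -
  have "{Poly_Mapping.single 0 (of_nat p), Poly_Mapping.single 0 (q - 1 :: 'w fps)} \<subseteq> omega_ideal p"
    unfolding omega_ideal_def by (rule A.genideal_self) simp
  then show "omega_hat_const p (of_nat p :: 'w fps) \<in> omega_hat_nhd p 1" "omega_hat_const p (fps_X :: 'w fps) \<in> omega_hat_nhd p 1"
    unfolding omega_hat_const_eq
    by (simp_all add: Om.to_nhd_iff A.ideal_power_1[OF Om.I_ideal] q_minus_1 del: One_nat_def)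
qed

lemma R_ideal_generators: "{of_nat p, fps_X} \<subseteq> (R_ideal p :: 'w fps set)"
  unfolding R_ideal_def R_ring_def q_minus_1 by (rule R.genideal_self) simp

lemma R_ideal_ideal: "ideal (R_ideal p :: 'w fps set) ring_of_type_algebra"
  unfolding R_ideal_def R_ring_def by (rule R.genideal_ideal) simp

lemma GR_1: "GR 1 = R_ideal p"
  unfolding R_ring_def by (rule R.ideal_power_1[OF R_ideal_ideal])

lemma R_ideal_imageI:
  assumes "filtered_ring C G" "h \<in> ring_hom ring_of_type_algebra C"
    "h (of_nat p :: 'w fps) \<in> G 1" "h fps_X \<in> G 1"
  shows "h ` R_ideal p \<subseteq> G 1" "h ` GR n \<subseteq> G n"
proof -
  interpret C: filtered_ring C G by fact
  show *: "h ` R_ideal p \<subseteq> G 1"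
    unfolding R_ideal_def R_ring_def q_minus_1 using assms
    by (intro ring_hom_genideal_subset[OF R.ring_axioms C.ring_axioms assms(2) _ C.filtration_ideal]) auto
  show "h ` GR n \<subseteq> G n"
    unfolding R_ring_def
    by (rule ring_hom_ideal_power_subset[OF R.is_cring assms(1,2) R_ideal_ideal *])
qed

lemma omega_hat_const_GR: "omega_hat_const p ` GR n \<subseteq> omega_hat_nhd p n"
  by (rule R_ideal_imageI[OF Om.hatf.filtered_ring_axioms omega_hat_const_hom const_generators_nhd])

text \<open>The constant term of (p)_q at q = 1 is p. Hence (p)_q \<omega> is topologically
  nilpotent and power series may be evaluated at it.\<close>

lemma D_mem_GR: "D \<in> GR 1"
proof -
  have "D $ 0 = of_nat p" by (simp add: gauss_integer_def fps_sum_nth q_def binomial_fps_nth)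
  then have "D $ i \<in> GW (1 - i)" for i using p_mem_GW by (cases i) simp_all
  then show ?thesis by (simp add: GR_eq W.fps_filtration_def)
qed

lemma p_omega_eq: "p_omega p = Om.to (Poly_Mapping.single 1 D)"
proof -
  have "Poly_Mapping.single 0 D \<otimes>\<^bsub>omega_ring p\<^esub> Poly_Mapping.single 1 1 = Poly_Mapping.single 1 D"
    by (simp add: omega_eval_inject[symmetric] fun_eq_iff omega_eval_mult omega_eval_single)
  then show ?thesis
    using Om.toh.hom_mult[of "Poly_Mapping.single 0 D" "Poly_Mapping.single 1 1"]
    by (simp add: p_omega_def omega_hat_const_eq omega_def)
qed

lemma p_omega_nhd: "p_omega p \<in> (omega_hat_nhd p 1 :: (nat \<Rightarrow> (nat \<Rightarrow>\<^sub>0 'w fps) set) set)"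
proof -
  have "omega_hat_const p D \<in> omega_hat_nhd p 1" using omega_hat_const_GR D_mem_GR by blast
  then show ?thesis
    unfolding p_omega_def omega_def
    using Om.toh.hom_closed[of "Poly_Mapping.single 1 1"] by (intro Om.hatf.filtration_mult_right) simp_all
qed

lemma p_omega_carrier: "p_omega p \<in> carrier (omega_hat p :: (nat \<Rightarrow> (nat \<Rightarrow>\<^sub>0 'w fps) set) ring)"
  by (simp add: p_omega_eq)

lemma fps_const_hom: "fps_const \<in> ring_hom (ring_of_type_algebra :: 's::comm_ring_1 ring) ring_of_type_algebra"
  by (rule ring_hom_memI) simp_all

sublocale Rxi: complete_filtered_ring "ring_of_type_algebra :: 'w fps fps ring" GRxi
  by (rule complete_GRxi)
sublocale Rxi: type_filtration GRxi by unfold_locales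

lemma Rxi_ideal_ideal: "ideal (Rxi_ideal p :: 'w fps fps set) ring_of_type_algebra"
  unfolding Rxi_ideal_def Rxi_ring_def by (rule Rxi.genideal_ideal) simp

lemma GRxi_1: "GRxi 1 = Rxi_ideal p"
  unfolding Rxi_ring_def by (rule Rxi.ideal_power_1[OF Rxi_ideal_ideal])

lemma Rxi_generators: "of_nat p \<in> GRxi 1" "fps_const fps_X \<in> GRxi 1" "fps_X \<in> GRxi 1"
proof -
  have "{of_nat p, fps_const (q - 1), xi} \<subseteq> (Rxi_ideal p :: 'w fps fps set)"
    unfolding Rxi_ideal_def Rxi_ring_def by (rule Rxi.genideal_self) simp
  then show "of_nat p \<in> GRxi 1" "fps_const fps_X \<in> GRxi 1" "fps_X \<in> GRxi 1"
    unfolding GRxi_1 by (simp_all add: q_minus_1 xi_def)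
qed

text \<open>Stated about the definite description itself, so that the Taylor maps unfold directly to
  a map with known properties. The condition at q is translated to the variable by q = 1 +
  X.\<close>

lemma R_continuous_hom:
  fixes C :: "('c, 'd) ring_scheme"
  assumes C: "complete_filtered_ring C G" and h: "h \<in> ring_hom (ring_of_type_algebra :: 'w ring) C"
    and hp: "h (of_nat p) \<in> G 1" and b: "b \<in> G 1"
  shows "\<exists>F. (THE f. continuous_algebra_hom R_ring GR fps_const C G h f \<and> f q = \<one>\<^bsub>C\<^esub> \<oplus>\<^bsub>C\<^esub> b) = F \<and>
    F \<in> ring_hom ring_of_type_algebra C \<and> (\<forall>w. F (fps_const w) = h w) \<and> F fps_X = b \<and> (\<forall>n. F ` GR n \<subseteq> G n)"
proof -
  interpret C: complete_filtered_ring C G by fact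
  have bc: "b \<in> carrier C" using C.filtration_carrier[OF b] .
  obtain F where F: "continuous_algebra_hom ring_of_type_algebra GR fps_const C G h F" "F fps_X = b"
    "\<And>n. F ` GR n \<subseteq> G n"
    "\<And>F'. \<lbrakk>F' \<in> ring_hom ring_of_type_algebra C; \<And>s. F' (fps_const s) = h s; F' fps_X = b\<rbrakk> \<Longrightarrow> F' = F"
    using C.power_series_continuous_hom[OF h b, of "{of_nat p}"] hp
    unfolding R_ideal_eq[symmetric] R_ring_def by auto
  have q: "F' q = \<one>\<^bsub>C\<^esub> \<oplus>\<^bsub>C\<^esub> F' fps_X" if "F' \<in> ring_hom ring_of_type_algebra C" for F' :: "'w fps \<Rightarrow> 'c"
    using ring_hom_add[OF that, of 1 fps_X] ring_hom_one[OF that] by (simp add: q_def)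
  have "(THE f. continuous_algebra_hom R_ring GR fps_const C G h f \<and> f q = \<one>\<^bsub>C\<^esub> \<oplus>\<^bsub>C\<^esub> b) = F"
  proof (rule the_equality)
    show "continuous_algebra_hom R_ring GR fps_const C G h F \<and> F q = \<one>\<^bsub>C\<^esub> \<oplus>\<^bsub>C\<^esub> b"
      using F(1,2) q[of F] by (simp add: R_ring_def continuous_algebra_hom_def)
    fix f assume f: "continuous_algebra_hom R_ring GR fps_const C G h f \<and> f q = \<one>\<^bsub>C\<^esub> \<oplus>\<^bsub>C\<^esub> b"
    then have fh: "f \<in> ring_hom ring_of_type_algebra C" "\<And>s. f (fps_const s) = h s"
      by (simp_all add: continuous_algebra_hom_def R_ring_def)
    have fX: "f fps_X \<in> carrier C" using ring_hom_closed[OF fh(1), of fps_X] by simp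
    have "\<one>\<^bsub>C\<^esub> \<oplus>\<^bsub>C\<^esub> f fps_X = \<one>\<^bsub>C\<^esub> \<oplus>\<^bsub>C\<^esub> b" using f q[OF fh(1)] by simp
    then have "f fps_X = b" using fX bc by simp
    then show "f = F" using F(4)[OF fh] by simp
  qed
  then show ?thesis using F(1-3) by (auto simp: continuous_algebra_hom_def)
qed

lemma Rxi_continuous_hom:
  fixes C :: "('c, 'd) ring_scheme"
  assumes C: "complete_filtered_ring C G" and h: "h \<in> ring_hom (ring_of_type_algebra :: 'w fps ring) C"
    and hp: "h (of_nat p) \<in> G 1" "h fps_X \<in> G 1" and b: "b \<in> G 1"
  shows "\<exists>F. (THE f. continuous_algebra_hom Rxi_ring GRxi fps_const C G h f \<and> f xi = b) = F \<and>
    F \<in> ring_hom ring_of_type_algebra C \<and> (\<forall>r. F (fps_const r) = h r) \<and> F fps_X = b \<and> (\<forall>n. F ` GRxi n \<subseteq> G n)"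
proof -
  interpret C: complete_filtered_ring C G by fact
  obtain F where F: "continuous_algebra_hom ring_of_type_algebra GRxi fps_const C G h F" "F fps_X = b"
    "\<And>n. F ` GRxi n \<subseteq> G n"
    "\<And>F'. \<lbrakk>F' \<in> ring_hom ring_of_type_algebra C; \<And>s. F' (fps_const s) = h s; F' fps_X = b\<rbrakk> \<Longrightarrow> F' = F"
    using C.power_series_continuous_hom[OF h b, of "insert fps_X (fps_const ` {of_nat p})"] hp
    unfolding Rxi_ideal_eq[symmetric] Rxi_ring_def by (auto simp: fps_of_nat)
  have "(THE f. continuous_algebra_hom Rxi_ring GRxi fps_const C G h f \<and> f xi = b) = F"
  proof (rule the_equality)
    show "continuous_algebra_hom Rxi_ring GRxi fps_const C G h F \<and> F xi = b"
      using F(1,2) by (simp add: Rxi_ring_def xi_def)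
    fix f assume "continuous_algebra_hom Rxi_ring GRxi fps_const C G h f \<and> f xi = b"
    then show "f = F"
      by (intro F(4)) (simp_all add: continuous_algebra_hom_def Rxi_ring_def xi_def)
  qed
  then show ?thesis using F(1-3) by (auto simp: continuous_algebra_hom_def)
qed

lemma taylor_Rxi:
  "taylor_Rxi p \<in> ring_hom (ring_of_type_algebra :: 'w fps ring) ring_of_type_algebra"
  "taylor_Rxi p (fps_const w) = fps_const (fps_const (w :: 'w))"
  "taylor_Rxi p (fps_X :: 'w fps) = fps_const fps_X + fps_X"
proof -
  have h: "(\<lambda>w::'w. fps_const (fps_const w)) \<in> ring_hom ring_of_type_algebra ring_of_type_algebra"
    by (rule ring_hom_memI) simp_all
  have "fps_const (fps_const (of_nat p :: 'w)) \<in> GRxi 1"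
    using Rxi_generators(1) by (simp add: fps_of_nat del: One_nat_def)
  from R_continuous_hom[OF complete_GRxi h this Rxi.G_add[OF Rxi_generators(2,3)]]
  have "\<exists>F. taylor_Rxi p = F \<and> F \<in> ring_hom (ring_of_type_algebra :: 'w fps ring) ring_of_type_algebra \<and>
    (\<forall>w. F (fps_const w) = fps_const (fps_const w)) \<and> F fps_X = fps_const fps_X + fps_X"
    unfolding taylor_Rxi_def by (auto simp: Rxi_ring_def q_def xi_def add.assoc fps_const_add[symmetric] simp del: fps_const_add)
  then show "taylor_Rxi p \<in> ring_hom (ring_of_type_algebra :: 'w fps ring) ring_of_type_algebra"
    "taylor_Rxi p (fps_const w) = fps_const (fps_const (w :: 'w))"
    "taylor_Rxi p (fps_X :: 'w fps) = fps_const fps_X + fps_X"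
    by blast+
qed

lemma omega_const_const_hom:
  "(\<lambda>w. omega_hat_const p (fps_const (w :: 'w))) \<in> ring_hom ring_of_type_algebra (omega_hat p)"
  using ring_hom_trans[OF fps_const_hom omega_hat_const_hom] by (simp add: comp_def)

lemma taylor_omega:
  "taylor_omega p \<in> ring_hom (ring_of_type_algebra :: 'w fps ring) (omega_hat p)"
  "taylor_omega p (fps_const (w :: 'w)) = omega_hat_const p (fps_const w)"
  "taylor_omega p (fps_X :: 'w fps) = omega_hat_const p fps_X \<oplus>\<^bsub>omega_hat p\<^esub> p_omega p"
proof -
  have hp: "omega_hat_const p (fps_const (of_nat p :: 'w)) \<in> omega_hat_nhd p 1"
    using const_generators_nhd(1) by (simp add: fps_of_nat del: One_nat_def)
  have b: "omega_hat_const p (fps_X :: 'w fps) \<oplus>\<^bsub>omega_hat p\<^esub> p_omega p \<in> omega_hat_nhd p 1"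
    by (rule Om.hatf.filtration_add[OF const_generators_nhd(2) p_omega_nhd])
  have q: "\<one>\<^bsub>omega_hat p\<^esub> \<oplus>\<^bsub>omega_hat p\<^esub> (omega_hat_const p (fps_X :: 'w fps) \<oplus>\<^bsub>omega_hat p\<^esub> p_omega p) =
    omega_hat_const p q \<oplus>\<^bsub>omega_hat p\<^esub> p_omega p"
    using omega_hat_const_simps(1) p_omega_carrier
    by (simp add: q_def omega_hat_const_simps(2,4) Om.hat.a_assoc)
  from R_continuous_hom[OF Om.hatf.complete_filtered_ring_axioms omega_const_const_hom hp b]
  have "\<exists>F. taylor_omega p = F \<and> F \<in> ring_hom (ring_of_type_algebra :: 'w fps ring) (omega_hat p) \<and>
    (\<forall>w. F (fps_const w) = omega_hat_const p (fps_const w)) \<and> F fps_X = omega_hat_const p fps_X \<oplus>\<^bsub>omega_hat p\<^esub> p_omega p"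
    unfolding taylor_omega_def q by blast
  then show "taylor_omega p \<in> ring_hom (ring_of_type_algebra :: 'w fps ring) (omega_hat p)"
    "taylor_omega p (fps_const (w :: 'w)) = omega_hat_const p (fps_const w)"
    "taylor_omega p (fps_X :: 'w fps) = omega_hat_const p fps_X \<oplus>\<^bsub>omega_hat p\<^esub> p_omega p"
    by blast+
qed

lemma Rxi_to_omega:
  "Rxi_to_omega p \<in> ring_hom (ring_of_type_algebra :: 'w fps fps ring) (omega_hat p)"
  "Rxi_to_omega p (fps_const (r :: 'w fps)) = omega_hat_const p r"
  "Rxi_to_omega p (fps_X :: 'w fps fps) = p_omega p"
  "Rxi_to_omega p ` GRxi n \<subseteq> omega_hat_nhd p n"
proof -
  from Rxi_continuous_hom[OF Om.hatf.complete_filtered_ring_axioms omega_hat_const_hom const_generators_nhd p_omega_nhd]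
  have "\<exists>F. Rxi_to_omega p = F \<and> F \<in> ring_hom (ring_of_type_algebra :: 'w fps fps ring) (omega_hat p) \<and>
    (\<forall>r. F (fps_const r) = omega_hat_const p r) \<and> F fps_X = p_omega p \<and> (\<forall>n. F ` GRxi n \<subseteq> omega_hat_nhd p n)"
    unfolding Rxi_to_omega_def .
  then show "Rxi_to_omega p \<in> ring_hom (ring_of_type_algebra :: 'w fps fps ring) (omega_hat p)"
    "Rxi_to_omega p (fps_const (r :: 'w fps)) = omega_hat_const p r"
    "Rxi_to_omega p (fps_X :: 'w fps fps) = p_omega p"
    "Rxi_to_omega p ` GRxi n \<subseteq> omega_hat_nhd p n"
    by blast+
qed

text \<open>Both sides are ring morphisms on R that agree on constants and on q - 1. This is the
  balancing condition for mapping one completed tensor square to the other.\<close>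

lemma Rxi_to_omega_taylor: "Rxi_to_omega p (taylor_Rxi p r) = taylor_omega p (r :: 'w fps)"
proof -
  have F: "Rxi_to_omega p \<circ> taylor_Rxi p \<in> ring_hom (ring_of_type_algebra :: 'w fps ring) (omega_hat p)"
    by (rule ring_hom_trans[OF taylor_Rxi(1) Rxi_to_omega(1)])
  have X: "(Rxi_to_omega p \<circ> taylor_Rxi p) (fps_X :: 'w fps) = taylor_omega p fps_X"
    using ring_hom_add[OF Rxi_to_omega(1), of "fps_const fps_X" fps_X]
    by (simp add: taylor_Rxi taylor_omega Rxi_to_omega)
  have "(Rxi_to_omega p \<circ> taylor_Rxi p) (fps_X :: 'w fps) \<in> omega_hat_nhd p 1"
    unfolding X taylor_omega by (rule Om.hatf.filtration_add[OF const_generators_nhd(2) p_omega_nhd])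
  then have "Rxi_to_omega p \<circ> taylor_Rxi p = (taylor_omega p :: 'w fps \<Rightarrow> _)"
    by (intro Om.hatf.power_series_hom_unique[OF F taylor_omega(1) _ X])
      (simp_all add: taylor_Rxi taylor_omega Rxi_to_omega)
  then show ?thesis by (metis comp_apply)
qed

section \<open>Specialisation of the completed algebra at one exponent\<close>

definition hat_eval :: "nat \<Rightarrow> (nat \<Rightarrow> (nat \<Rightarrow>\<^sub>0 'w fps) set) \<Rightarrow> 'w fps" where
  "hat_eval m = (SOME f. f \<in> ring_hom (omega_hat p) ring_of_type_algebra \<and>
    (\<forall>x. f (Om.to x) = omega_eval x m))"

lemma hat_eval:
  "hat_eval m \<in> ring_hom (omega_hat p) ring_of_type_algebra"
  "hat_eval m (Om.to x) = omega_eval x m"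
proof -
  have h: "(\<lambda>x. omega_eval x m) \<in> ring_hom (omega_ring p) ring_of_type_algebra"
    by (rule ring_hom_memI) (simp_all add: omega_eval_add omega_eval_mult omega_eval_single[of 0 1, simplified])
  have "(\<lambda>x. omega_eval x m) ` omega_ideal p \<subseteq> GR 1"
    unfolding omega_ideal_def
  proof (rule ring_hom_genideal_subset[OF A.ring_axioms R.ring_axioms h _ R.filtration_ideal])
    show "(\<lambda>x. omega_eval x m) ` {Poly_Mapping.single 0 (of_nat p), Poly_Mapping.single 0 (q - 1)} \<subseteq> GR 1"
      using R_ideal_generators unfolding GR_1 q_minus_1 image_insert image_empty omega_eval_single by simp
  qed simp
  then have P: "(\<lambda>x. omega_eval x m) ` Om.P n \<subseteq> GR n" for n
    by (rule ring_hom_ideal_power_subset[OF A.is_cring R.filtered_ring_axioms h Om.I_ideal])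
  obtain f where "f \<in> ring_hom (omega_hat p) ring_of_type_algebra"
    "\<And>a. a \<in> carrier (omega_ring p) \<Longrightarrow> f (Om.to a) = omega_eval a m"
    by (rule Om.completion_hom_extend[OF complete_GR h P]) (rule that)
  then have "f \<in> ring_hom (omega_hat p) ring_of_type_algebra"
    "\<And>a. f (Om.to a) = omega_eval a m"
    by simp_all
  then have "\<exists>f. f \<in> ring_hom (omega_hat p) ring_of_type_algebra \<and>
    (\<forall>x. f (Om.to x) = omega_eval x m)" by blast
  from someI_ex[OF this, folded hat_eval_def]
  show "hat_eval m \<in> ring_hom (omega_hat p) ring_of_type_algebra"
    "hat_eval m (Om.to x) = omega_eval x m" by blast+
qed

text \<open>The Taylor map followed by the specialisation at m, that is, the endomorphism q -> q^(p
  m + 1) of R. Defined in this way, it satisfies the balancing condition for evaluating tensors by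
  construction.\<close>

definition psi :: "nat \<Rightarrow> 'w fps \<Rightarrow> 'w fps" where "psi m r = hat_eval m (taylor_omega p r)"

lemma psi_hom: "psi m \<in> ring_hom ring_of_type_algebra ring_of_type_algebra"
proof -
  have "psi m = hat_eval m \<circ> taylor_omega p" by (rule ext) (simp add: psi_def)
  then show ?thesis using ring_hom_trans[OF taylor_omega(1) hat_eval(1)] by simp
qed

lemma psi_simps: "psi m (x + y) = psi m x + psi m y" "psi m (x * y) = psi m x * psi m y" "psi m 1 = 1"
  using ring_hom_add[OF psi_hom, of x y m] ring_hom_mult[OF psi_hom, of x y m] ring_hom_one[OF psi_hom] by simp_all

lemma D_bas_1: "D * bas 1 m = q * (Q ^ m - 1)"
proof -
  have "D * bas 1 m = q * (((q - 1) * D) * gauss_integer Q m)" unfolding bas_1 by (simp only: ac_simps)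
  then show ?thesis unfolding D_telescope gauss_integer_telescope .
qed

lemma psi_X: "psi m fps_X = q ^ (p * m + 1) - 1"
proof -
  have "psi m fps_X = hat_eval m (omega_hat_const p fps_X) + hat_eval m (p_omega p)"
    using ring_hom_add[OF hat_eval(1)[of m] omega_hat_const_simps(1)[of fps_X] p_omega_carrier]
    by (simp add: psi_def taylor_omega)
  also have "\<dots> = fps_X + D * bas 1 m"
    unfolding omega_hat_const_eq p_omega_eq hat_eval(2) omega_eval_single by simp
  also have "\<dots> = q ^ (p * m + 1) - 1"
    unfolding D_bas_1 by (simp add: q_def[symmetric] right_diff_distrib power_mult) (simp add: q_def)
  finally show ?thesis .
qed

lemma psi_q: "psi m q = q ^ (p * m + 1)"
  using psi_simps(1)[of m 1 fps_X] psi_simps(3) psi_X by (simp add: q_def)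

section \<open>The two completed tensor squares and the maps between them\<close>

lemma R_ring_carrier [simp]: "carrier (R_ring :: 'w fps ring) = UNIV"
  by (simp add: R_ring_def)

lemma Rxi_ring_simps [simp]:
  "carrier (Rxi_ring :: 'w fps fps ring) = UNIV" "\<one>\<^bsub>Rxi_ring\<^esub> = (1 :: 'w fps fps)"
  by (simp_all add: Rxi_ring_def)

lemma omega_hat_generators: "{omega_hat_const p (of_nat p), omega_hat_const p (q - 1 :: 'w fps)} \<subseteq> carrier (omega_hat p)"
  by (simp add: omega_hat_const_simps)

lemma omega_hat_ideal_ideal: "ideal (omega_hat_ideal p :: (nat \<Rightarrow> (nat \<Rightarrow>\<^sub>0 'w fps) set) set) (omega_hat p)"
  unfolding omega_hat_ideal_def by (rule Om.hat.genideal_ideal[OF omega_hat_generators])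

lemma omega_hat_nhd_subset: "omega_hat_nhd p n \<subseteq> ideal_power (omega_hat p) (omega_hat_ideal p :: (nat \<Rightarrow> (nat \<Rightarrow>\<^sub>0 'w fps) set) set) n"
  using Om.nhd_pair_subset[of "Poly_Mapping.single 0 (of_nat p)" "Poly_Mapping.single 0 (q - 1)" n]
  by (simp add: omega_ideal_def omega_hat_ideal_def omega_hat_const_eq)

lemma omega_hat_nhd_1_subset: "omega_hat_nhd p 1 \<subseteq> (omega_hat_ideal p :: (nat \<Rightarrow> (nat \<Rightarrow>\<^sub>0 'w fps) set) set)"
  using omega_hat_nhd_subset[of 1] Om.hat.ideal_power_1[OF omega_hat_ideal_ideal] by simp

sublocale TX: completed_tensor_product "Rxi_ring :: 'w fps fps ring" Rxi_ring "R_ring :: 'w fps ring"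
    "taylor_Rxi p" fps_const "Rxi_ideal p" "Rxi_ideal p"
  rewrites "adic_completion (tensor_ring R_ring Rxi_ring (taylor_Rxi p) Rxi_ring fps_const)
      (tensor_adic_ideal R_ring Rxi_ring (Rxi_ideal p) (taylor_Rxi p) Rxi_ring (Rxi_ideal p) (fps_const :: 'w fps \<Rightarrow> _)) = Rxi2_ring p"
    and "completion_nhd (tensor_ring R_ring Rxi_ring (taylor_Rxi p) Rxi_ring fps_const)
      (tensor_adic_ideal R_ring Rxi_ring (Rxi_ideal p) (taylor_Rxi p) Rxi_ring (Rxi_ideal p) (fps_const :: 'w fps \<Rightarrow> _)) = Rxi2_nhd p"
    and "completed_pure_tensor R_ring Rxi_ring (Rxi_ideal p) (taylor_Rxi p) Rxi_ring (Rxi_ideal p) (fps_const :: 'w fps \<Rightarrow> _) = Rxi2_tensor p"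
proof -
  show "completed_tensor_product (Rxi_ring :: 'w fps fps ring) Rxi_ring (R_ring :: 'w fps ring)
    (taylor_Rxi p) fps_const (Rxi_ideal p) (Rxi_ideal p)"
    using Rxi.is_cring Rxi_ideal_ideal unfolding Rxi_ring_def
    by (intro completed_tensor_product.intro completed_tensor_product_axioms.intro tensor_product.intro
      tensor_product_axioms.intro ring_pair.intro) simp_all
qed (simp_all add: Rxi2_ring_def Rxi2_nhd_def Rxi2_tensor_def completed_tensor_def completed_tensor_nhd_def fun_eq_iff)

sublocale TO: completed_tensor_product "omega_hat p :: (nat \<Rightarrow> (nat \<Rightarrow>\<^sub>0 'w fps) set) ring" "omega_hat p" "R_ring :: 'w fps ring"
    "taylor_omega p" "omega_hat_const p" "omega_hat_ideal p" "omega_hat_ideal p"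
  rewrites "adic_completion (tensor_ring R_ring (omega_hat p) (taylor_omega p) (omega_hat p) (omega_hat_const p))
      (tensor_adic_ideal R_ring (omega_hat p) (omega_hat_ideal p) (taylor_omega p) (omega_hat p) (omega_hat_ideal p) (omega_hat_const p)) = (omega2_ring p :: 'w omega2 ring)"
    and "completion_nhd (tensor_ring R_ring (omega_hat p) (taylor_omega p) (omega_hat p) (omega_hat_const p))
      (tensor_adic_ideal R_ring (omega_hat p) (omega_hat_ideal p) (taylor_omega p) (omega_hat p) (omega_hat_ideal p) (omega_hat_const p)) = (omega2_nhd p :: nat \<Rightarrow> 'w omega2 set)"
    and "completed_pure_tensor R_ring (omega_hat p) (omega_hat_ideal p) (taylor_omega p) (omega_hat p) (omega_hat_ideal p) (omega_hat_const p) =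
      (omega2_tensor p :: (nat \<Rightarrow> (nat \<Rightarrow>\<^sub>0 'w fps) set) \<Rightarrow> _ \<Rightarrow> 'w omega2)"
proof -
  show "completed_tensor_product (omega_hat p :: (nat \<Rightarrow> (nat \<Rightarrow>\<^sub>0 'w fps) set) ring) (omega_hat p) (R_ring :: 'w fps ring)
    (taylor_omega p) (omega_hat_const p) (omega_hat_ideal p) (omega_hat_ideal p)"
    using Om.hat.is_cring omega_hat_ideal_ideal omega_hat_const_simps(1) ring_hom_closed[OF taylor_omega(1)]
    by (intro completed_tensor_product.intro completed_tensor_product_axioms.intro tensor_product.intro
      tensor_product_axioms.intro ring_pair.intro) simp_all
qed (simp_all add: omega2_ring_def omega2_nhd_def omega2_tensor_def completed_tensor_def completed_tensor_nhd_def fun_eq_iff)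

lemma TO_balance: "TO.pt (taylor_omega p (r :: 'w fps)) \<one>\<^bsub>omega_hat p\<^esub> = TO.pt \<one>\<^bsub>omega_hat p\<^esub> (omega_hat_const p r)"
  using TO.pt_balance[of "\<one>\<^bsub>omega_hat p\<^esub>" r "\<one>\<^bsub>omega_hat p\<^esub>"] TO.f_closed[of r] omega_hat_const_simps(1)[of r]
  by simp

lemma omega2_balance: "omega2_tensor p (taylor_omega p (r :: 'w fps)) \<one>\<^bsub>omega_hat p\<^esub> = omega2_tensor p \<one>\<^bsub>omega_hat p\<^esub> (omega_hat_const p r)"
  unfolding TO.cpt_eq TO_balance ..

lemma omega2_const_eq: "omega2_const p = (\<lambda>a. omega2_tensor p a \<one>\<^bsub>omega_hat p\<^esub>) \<circ> (omega_hat_const p :: 'w fps \<Rightarrow> _)"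
  by (rule ext) (simp add: omega2_const_def)

lemma omega2_const_hom: "omega2_const p \<in> ring_hom (ring_of_type_algebra :: 'w fps ring) (omega2_ring p)"
  unfolding omega2_const_eq by (rule ring_hom_trans[OF omega_hat_const_hom TO.cpt_left_hom])

lemma omega2_const_nhd: "omega2_const p (of_nat p :: 'w fps) \<in> omega2_nhd p 1" "omega2_const p (fps_X :: 'w fps) \<in> omega2_nhd p 1"
  using const_generators_nhd omega_hat_nhd_1_subset TO.cpt_left_nhd unfolding omega2_const_def by blast+

lemma Delta_Rxi:
  "Delta_Rxi p \<in> ring_hom (ring_of_type_algebra :: 'w fps fps ring) (Rxi2_ring p)"
  "Delta_Rxi p (fps_const (r :: 'w fps)) = Rxi2_tensor p (fps_const r) 1"
  "Delta_Rxi p (fps_X :: 'w fps fps) = Rxi2_tensor p 1 fps_X \<oplus>\<^bsub>Rxi2_ring p\<^esub> Rxi2_tensor p fps_X 1"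
proof -
  have h: "(\<lambda>r::'w fps. Rxi2_tensor p (fps_const r) 1) \<in> ring_hom ring_of_type_algebra (Rxi2_ring p)"
    using ring_hom_trans[OF fps_const_hom TX.cpt_left_hom[unfolded Rxi_ring_def]] by (simp add: comp_def)
  have left: "Rxi2_tensor p x 1 \<in> Rxi2_nhd p 1" and right: "Rxi2_tensor p 1 x \<in> Rxi2_nhd p 1"
    if "x \<in> GRxi 1" for x :: "'w fps fps"
    using that TX.cpt_left_nhd TX.cpt_right_nhd unfolding GRxi_1 by (auto simp del: One_nat_def)
  have gp: "Rxi2_tensor p (fps_const (of_nat p :: 'w fps)) 1 \<in> Rxi2_nhd p 1"
    "Rxi2_tensor p (fps_const (fps_X :: 'w fps)) 1 \<in> Rxi2_nhd p 1"
    using left Rxi_generators by (simp_all add: fps_of_nat del: One_nat_def)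
  have b: "Rxi2_tensor p 1 fps_X \<oplus>\<^bsub>Rxi2_ring p\<^esub> Rxi2_tensor p (fps_X :: 'w fps fps) 1 \<in> Rxi2_nhd p 1"
    by (intro TX.CT.hatf.filtration_add left right Rxi_generators)
  from Rxi_continuous_hom[OF TX.CT.hatf.complete_filtered_ring_axioms h gp b]
  have "\<exists>F. Delta_Rxi p = F \<and> F \<in> ring_hom (ring_of_type_algebra :: 'w fps fps ring) (Rxi2_ring p) \<and>
    (\<forall>r. F (fps_const r) = Rxi2_tensor p (fps_const r) 1) \<and>
    F fps_X = Rxi2_tensor p 1 fps_X \<oplus>\<^bsub>Rxi2_ring p\<^esub> Rxi2_tensor p fps_X 1"
    unfolding Delta_Rxi_def xi_def by blast
  then show "Delta_Rxi p \<in> ring_hom (ring_of_type_algebra :: 'w fps fps ring) (Rxi2_ring p)"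
    "Delta_Rxi p (fps_const (r :: 'w fps)) = Rxi2_tensor p (fps_const r) 1"
    "Delta_Rxi p (fps_X :: 'w fps fps) = Rxi2_tensor p 1 fps_X \<oplus>\<^bsub>Rxi2_ring p\<^esub> Rxi2_tensor p fps_X 1"
    by blast+
qed

text \<open>Pure tensors span a dense subring, so their images determine a continuous morphism;
  existence is the universal property applied to the two composites with
  \<open>Rxi_to_omega\<close>.\<close>

lemma Rxi2_to_omega2:
  "Rxi2_to_omega2 p \<in> ring_hom (Rxi2_ring p) (omega2_ring p :: 'w omega2 ring)"
  "Rxi2_to_omega2 p (Rxi2_tensor p a b) = omega2_tensor p (Rxi_to_omega p a) (Rxi_to_omega p (b :: 'w fps fps))"
proof -
  let ?l = "(\<lambda>a. omega2_tensor p a \<one>\<^bsub>omega_hat p\<^esub>) \<circ> (Rxi_to_omega p :: 'w fps fps \<Rightarrow> _)"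
  let ?r = "omega2_tensor p \<one>\<^bsub>omega_hat p\<^esub> \<circ> (Rxi_to_omega p :: 'w fps fps \<Rightarrow> _)"
  have l: "?l \<in> ring_hom Rxi_ring (omega2_ring p)" and r: "?r \<in> ring_hom Rxi_ring (omega2_ring p)"
    unfolding Rxi_ring_def
    by (rule ring_hom_trans[OF Rxi_to_omega(1) TO.cpt_left_hom] ring_hom_trans[OF Rxi_to_omega(1) TO.cpt_right_hom])+
  have nhd: "Rxi_to_omega p ` Rxi_ideal p \<subseteq> (omega_hat_ideal p :: (nat \<Rightarrow> (nat \<Rightarrow>\<^sub>0 'w fps) set) set)"
    using Rxi_to_omega(4)[of 1] omega_hat_nhd_1_subset unfolding GRxi_1 by blast
  have nhds: "?l ` Rxi_ideal p \<subseteq> omega2_nhd p 1" "?r ` Rxi_ideal p \<subseteq> omega2_nhd p 1"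
    using nhd TO.cpt_left_nhd TO.cpt_right_nhd unfolding image_comp[symmetric] by blast+
  have closed: "Rxi_to_omega p (a :: 'w fps fps) \<in> carrier (omega_hat p)" for a
    using ring_hom_closed[OF Rxi_to_omega(1)] by simp
  have bal: "?l (taylor_Rxi p s) = ?r (fps_const s)" for s
    by (simp add: Rxi_to_omega_taylor Rxi_to_omega omega2_balance)
  have lr: "?l a \<otimes>\<^bsub>omega2_ring p\<^esub> ?r b = omega2_tensor p (Rxi_to_omega p a) (Rxi_to_omega p b)" for a b
    unfolding comp_apply TO.cpt_eq using closed
    by (simp add: TO.CT.toh.hom_mult[symmetric] TO.pt_mult)
  obtain F where F0: "F \<in> ring_hom (Rxi2_ring p) (omega2_ring p)" "F \<in> extensional (carrier (Rxi2_ring p))"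
    "\<And>a b. \<lbrakk>a \<in> carrier Rxi_ring; b \<in> carrier Rxi_ring\<rbrakk> \<Longrightarrow>
      F (Rxi2_tensor p a b) = ?l a \<otimes>\<^bsub>omega2_ring p\<^esub> ?r b"
    "\<And>n. F ` Rxi2_nhd p n \<subseteq> omega2_nhd p n"
    by (rule TX.completed_tensor_hom_exists[OF TO.CT.hatf.complete_filtered_ring_axioms l r bal nhds]) (rule that)
  have F: "F \<in> ring_hom (Rxi2_ring p) (omega2_ring p)" "F \<in> extensional (carrier (Rxi2_ring p))"
    "F (Rxi2_tensor p a b) = omega2_tensor p (Rxi_to_omega p a) (Rxi_to_omega p b)"
    "F ` Rxi2_nhd p n \<subseteq> omega2_nhd p n" for a b n
    using F0 lr by simp_all
  have "(THE f. continuous_algebra_hom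
      (Rxi2_ring p) (Rxi2_nhd p) (\<lambda>r. Rxi2_tensor p (fps_const r) 1)
      (omega2_ring p) (omega2_nhd p) (omega2_const p) f \<and>
    (\<forall>a b. f (Rxi2_tensor p a b) = omega2_tensor p (Rxi_to_omega p a) (Rxi_to_omega p b))) = F"
  proof (rule the_equality)
    have "\<forall>n. \<exists>m. F ` Rxi2_nhd p m \<subseteq> omega2_nhd p n" using F(4) by blast
    then show "continuous_algebra_hom (Rxi2_ring p) (Rxi2_nhd p) (\<lambda>r. Rxi2_tensor p (fps_const r) 1)
      (omega2_ring p) (omega2_nhd p) (omega2_const p) F \<and>
      (\<forall>a b. F (Rxi2_tensor p a b) = omega2_tensor p (Rxi_to_omega p a) (Rxi_to_omega p b))"
      unfolding continuous_algebra_hom_def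
      using F(1-3) ring_hom_one[OF Rxi_to_omega(1)] by (simp add: Rxi_to_omega omega2_const_def)
    fix f assume f: "continuous_algebra_hom (Rxi2_ring p) (Rxi2_nhd p) (\<lambda>r :: 'w fps. Rxi2_tensor p (fps_const r) 1)
      (omega2_ring p) (omega2_nhd p) (omega2_const p) f \<and>
      (\<forall>a b. f (Rxi2_tensor p a b) = omega2_tensor p (Rxi_to_omega p a) (Rxi_to_omega p b))"
    show "f = F"
    proof (rule extensionalityI)
      show "f \<in> extensional (carrier (Rxi2_ring p))" using f by (simp add: continuous_algebra_hom_def)
      show "f x = F x" if "x \<in> carrier (Rxi2_ring p)" for x
      proof (rule TX.completed_tensor_hom_unique[OF TO.CT.hatf.complete_filtered_ring_axioms _ F(1) _ _ _ that])
        show "f \<in> ring_hom (Rxi2_ring p) (omega2_ring p)" "\<exists>m. f ` Rxi2_nhd p m \<subseteq> omega2_nhd p n" for n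
          using f by (simp_all add: continuous_algebra_hom_def)
        show "f (Rxi2_tensor p a b) = F (Rxi2_tensor p a b)" for a b using f F(3) by simp
        show "\<exists>m. F ` Rxi2_nhd p m \<subseteq> omega2_nhd p n" for n using F(4) by blast
      qed
    qed (rule F(2))
  qed
  then have "Rxi2_to_omega2 p = F" unfolding Rxi2_to_omega2_def .
  then show "Rxi2_to_omega2 p \<in> ring_hom (Rxi2_ring p) (omega2_ring p :: 'w omega2 ring)"
    "Rxi2_to_omega2 p (Rxi2_tensor p a b) = omega2_tensor p (Rxi_to_omega p a) (Rxi_to_omega p (b :: 'w fps fps))"
    using F by simp_all
qed

section \<open>Evaluation of the completed tensor square at two exponents\<close>

lemma hat_eval_const: "hat_eval m (omega_hat_const p r) = r"
  by (simp add: omega_hat_const_eq hat_eval omega_eval_single)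

lemma hat_eval_ideal: "hat_eval m ` omega_hat_ideal p \<subseteq> GR 1"
  unfolding omega_hat_ideal_def
  by (rule ring_hom_genideal_subset[OF Om.hat.ring_axioms R.ring_axioms hat_eval(1) omega_hat_generators R.filtration_ideal])
    (use R_ideal_generators in \<open>simp add: hat_eval_const GR_1 q_minus_1 del: One_nat_def\<close>)

lemma psi_of_nat: "psi m (of_nat n) = of_nat n"
proof -
  have "psi m 0 = 0" using psi_simps(1)[of m 0 0] by simp
  then show ?thesis by (induction n) (simp_all add: psi_simps)
qed

lemma q_power_minus_1_mem_GR: "q ^ N - 1 \<in> GR 1"
proof -
  have "(q ^ N - 1 :: 'w fps) $ i \<in> GW (1 - i)" for i by (cases i) (simp_all add: q_def binomial_fps_nth)
  then show ?thesis by (simp add: GR_eq W.fps_filtration_def)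
qed

lemma psi_GR: "psi m ` GR n \<subseteq> GR n"
  by (rule R_ideal_imageI[OF R.filtered_ring_axioms psi_hom])
    (use R_ideal_generators q_power_minus_1_mem_GR[of "p * m + 1"] in \<open>simp_all add: psi_of_nat psi_X GR_1 del: One_nat_def\<close>)

text \<open>The completed evaluation and its restriction to uncompleted tensors are chosen jointly,
  because the estimate between the two is needed. The right factor is specialised at l and then
  moved by \<open>psi m\<close>, since its scalars act on the left factor through the Taylor
  map.\<close>

definition tensor_eval_pair where
  "tensor_eval_pair m l = (SOME (F, h). F \<in> ring_hom (omega2_ring p :: 'w omega2 ring) ring_of_type_algebra \<and>
    h \<in> ring_hom TO.TR ring_of_type_algebra \<and>
    (\<forall>a\<in>carrier (omega_hat p). \<forall>b\<in>carrier (omega_hat p). h (TO.pt a b) = hat_eval m a * psi m (hat_eval l b)) \<and>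
    (\<forall>n. h ` TO.CT.P n \<subseteq> GR n) \<and>
    (\<forall>x\<in>carrier (omega2_ring p). \<forall>n. \<forall>t\<in>x n. F x - h t \<in> GR n) \<and>
    (\<forall>t\<in>carrier TO.TR. F (TO.CT.to t) = h t))"

definition Ev :: "nat \<Rightarrow> nat \<Rightarrow> 'w omega2 \<Rightarrow> 'w fps" where "Ev m l = fst (tensor_eval_pair m l)"
definition ev where "ev m l = snd (tensor_eval_pair m l)"

lemma
  shows Ev_hom: "Ev m l \<in> ring_hom (omega2_ring p) ring_of_type_algebra"
    and ev_hom: "ev m l \<in> ring_hom TO.TR ring_of_type_algebra"
    and ev_pt: "\<lbrakk>a \<in> carrier (omega_hat p); b \<in> carrier (omega_hat p)\<rbrakk> \<Longrightarrow> ev m l (TO.pt a b) = hat_eval m a * psi m (hat_eval l b)"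
    and ev_P: "ev m l ` TO.CT.P n \<subseteq> GR n"
    and Ev_mem: "\<lbrakk>x \<in> carrier (omega2_ring p); t \<in> x n\<rbrakk> \<Longrightarrow> Ev m l x - ev m l t \<in> GR n"
    and Ev_to: "t \<in> carrier TO.TR \<Longrightarrow> Ev m l (TO.CT.to t) = ev m l t"
proof -
  have r: "psi m \<circ> hat_eval l \<in> ring_hom (omega_hat p) ring_of_type_algebra"
    by (rule ring_hom_trans[OF hat_eval(1) psi_hom])
  have bal: "hat_eval m (taylor_omega p s) = (psi m \<circ> hat_eval l) (omega_hat_const p s)" for s
    by (simp add: hat_eval_const psi_def)
  have nhd: "(psi m \<circ> hat_eval l) ` omega_hat_ideal p \<subseteq> GR 1"
    using hat_eval_ideal[of l] psi_GR[of m 1] unfolding image_comp[symmetric] by blast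
  obtain F h where "F \<in> ring_hom (omega2_ring p :: 'w omega2 ring) ring_of_type_algebra"
    "\<And>t. t \<in> carrier TO.TR \<Longrightarrow> F (TO.CT.to t) = h t"
    "\<And>x t n. \<lbrakk>x \<in> carrier (omega2_ring p); t \<in> x n\<rbrakk> \<Longrightarrow> F x \<ominus>\<^bsub>ring_of_type_algebra\<^esub> h t \<in> GR n"
    "h \<in> ring_hom TO.TR ring_of_type_algebra"
    "\<And>a b. \<lbrakk>a \<in> carrier (omega_hat p); b \<in> carrier (omega_hat p)\<rbrakk> \<Longrightarrow>
      h (TO.pt a b) = hat_eval m a \<otimes>\<^bsub>ring_of_type_algebra\<^esub> (psi m \<circ> hat_eval l) b"
    "\<And>n. h ` TO.CT.P n \<subseteq> GR n"
    by (rule TO.completed_tensor_hom_exists[OF complete_GR hat_eval(1)[of m] r bal hat_eval_ideal nhd]) (rule that)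
  then have "\<exists>Fh. case Fh of (F, h) \<Rightarrow> F \<in> ring_hom (omega2_ring p :: 'w omega2 ring) ring_of_type_algebra \<and>
    h \<in> ring_hom TO.TR ring_of_type_algebra \<and>
    (\<forall>a\<in>carrier (omega_hat p). \<forall>b\<in>carrier (omega_hat p). h (TO.pt a b) = hat_eval m a * psi m (hat_eval l b)) \<and>
    (\<forall>n. h ` TO.CT.P n \<subseteq> GR n) \<and>
    (\<forall>x\<in>carrier (omega2_ring p). \<forall>n. \<forall>t\<in>x n. F x - h t \<in> GR n) \<and>
    (\<forall>t\<in>carrier TO.TR. F (TO.CT.to t) = h t)"
    by (intro exI[of _ "(F, h)"]) simp
  from someI_ex[OF this, folded tensor_eval_pair_def]
  show "Ev m l \<in> ring_hom (omega2_ring p) ring_of_type_algebra"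
    "ev m l \<in> ring_hom TO.TR ring_of_type_algebra"
    "\<lbrakk>a \<in> carrier (omega_hat p); b \<in> carrier (omega_hat p)\<rbrakk> \<Longrightarrow> ev m l (TO.pt a b) = hat_eval m a * psi m (hat_eval l b)"
    "ev m l ` TO.CT.P n \<subseteq> GR n"
    "\<lbrakk>x \<in> carrier (omega2_ring p); t \<in> x n\<rbrakk> \<Longrightarrow> Ev m l x - ev m l t \<in> GR n"
    "t \<in> carrier TO.TR \<Longrightarrow> Ev m l (TO.CT.to t) = ev m l t"
    unfolding Ev_def ev_def case_prod_unfold by blast+
qed

section \<open>Injectivity of the evaluation on the tensor square\<close>


lemma X_mult_mem_GR: "fps_X * f \<in> GR N \<Longrightarrow> f \<in> GR (N - 1)"
  unfolding GR_eq W.fps_filtration_def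
proof (intro CollectI allI)
  fix i assume "fps_X * f \<in> {f. \<forall>i. f $ i \<in> GW (N - i)}"
  then have "(fps_X * f) $ Suc i \<in> GW (N - Suc i)" by blast
  then show "f $ i \<in> GW (N - 1 - i)" by simp
qed

lemma X_power_mult_mem_GR: "fps_X ^ k * f \<in> GR N \<Longrightarrow> f \<in> GR (N - k)"
proof (induction k arbitrary: N)
  case (Suc k)
  then have "fps_X ^ k * f \<in> GR (N - 1)" by (intro X_mult_mem_GR) (simp add: mult.assoc)
  from Suc.IH[OF this] show ?case by simp
qed simp

text \<open>The cofactor (p m + 1)_q has constant term p m + 1, which is prime to p. Hence
  \<open>psi m\<close> changes q - 1 only by a unit, and the diagonal entries in both variables have
  the same order in X.\<close>

lemma q_power_eq_X_unit: "\<exists>z y. q ^ (p * m + 1) - 1 = fps_X * z \<and> z * y = (1 :: 'w fps)"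
proof -
  have "\<not> p dvd p * m + 1"
    using prime_gt_1_nat[OF prime_p] dvd_add_right_iff[of p "p * m" 1] by auto
  then obtain w :: 'w where w: "of_nat (p * m + 1) * w = 1" by (rule of_nat_unit_W)
  let ?z = "gauss_integer q (p * m + 1) :: 'w fps"
  have "?z $ 0 = of_nat (p * m + 1)"
    by (simp add: gauss_integer_def fps_sum_nth q_def binomial_fps_nth)
  then obtain y where "?z * y = 1" using w unit_of_nth_0[of ?z w] by metis
  moreover have "q ^ (p * m + 1) - 1 = fps_X * ?z"
    by (rule gauss_integer_telescope[of "q :: 'w fps" "p * m + 1", unfolded q_minus_1, symmetric])
  ultimately show ?thesis by blast
qed

lemma bas_self_unit: "\<exists>z y. bas k k = fps_X ^ k * z \<and> z * y = (1 :: 'w fps)"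
proof (intro exI conjI)
  show "bas k k = fps_X ^ k * (q ^ k * Q ^ (k * (k - 1) div 2))"
    unfolding bas_self power_mult_distrib q_minus_1 by (simp only: mult.assoc)
  have "q ^ k * Q ^ (k * (k - 1) div 2) * qinv ^ (k + p * (k * (k - 1) div 2)) = (q * qinv) ^ (k + p * (k * (k - 1) div 2))"
    unfolding power_mult_distrib power_add power_mult by (simp only: ac_simps)
  then show "q ^ k * Q ^ (k * (k - 1) div 2) * qinv ^ (k + p * (k * (k - 1) div 2)) = 1"
    unfolding q_qinv by simp
qed

lemma psi_power: "psi m (x ^ k) = psi m x ^ k"
  by (induction k) (simp_all add: psi_simps)

lemma psi_bas_self_unit: "\<exists>z y. psi m (bas k k) = fps_X ^ k * z \<and> z * y = (1 :: 'w fps)"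
proof -
  obtain z y where z: "bas k k = fps_X ^ k * z" "z * y = 1" using bas_self_unit by blast
  obtain z' y' where z': "q ^ (p * m + 1) - 1 = fps_X * z'" "z' * y' = (1 :: 'w fps)"
    using q_power_eq_X_unit by blast
  have "psi m (bas k k) = fps_X ^ k * (z' ^ k * psi m z)"
    unfolding z(1) psi_simps(2) psi_power psi_X z'(1) power_mult_distrib by (simp only: mult.assoc)
  moreover have "z' ^ k * psi m z * (y' ^ k * psi m y) = (z' * y') ^ k * psi m (z * y)"
    unfolding power_mult_distrib psi_simps(2) by (simp only: ac_simps)
  ultimately show ?thesis unfolding z z' psi_simps(3) by (metis mult_1 power_one)
qed

lemma psi_0: "psi m 0 = 0" using psi_simps(1)[of m 0 0] by simp

text \<open>Solving the triangular system loses at most \<open>k\<close> powers of the ideal in step \<open>k\<close>.\<close>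

lemma triangular_mem_GR:
  fixes g :: "nat \<Rightarrow> 'w fps"
  assumes "\<And>l. (\<Sum>k\<le>l. g k * B k l) \<in> GR N"
    and B: "\<And>k. \<exists>z y. B k k = fps_X ^ k * z \<and> z * y = 1"
  shows "g k \<in> GR (N - k * k)"
proof (induction k rule: less_induct)
  case (less k)
  \<comment> \<open>An upper bound for the loss at all previous indices; the division by X^k costs k
    more, and (k - 1)^2 + k is at most k^2.\<close>
  let ?L = "(k - 1) * (k - 1)"
  have "(\<Sum>j<k. g j * B j k) \<in> GR (N - ?L)"
  proof (rule R.G_sum)
    fix j assume "j \<in> {..<k}"
    then have "g j \<in> GR (N - j * j)" "j * j \<le> ?L" using less by (auto intro!: mult_le_mono)
    then have "g j \<in> GR (N - ?L)" by (elim R.G_antimono) simp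
    then show "g j * B j k \<in> GR (N - ?L)" by (rule R.G_mult_right)
  qed
  moreover have "(\<Sum>j\<le>k. g j * B j k) \<in> GR (N - ?L)"
    using assms(1)[of k] by (rule R.G_antimono) simp
  ultimately have "(\<Sum>j\<le>k. g j * B j k) - (\<Sum>j<k. g j * B j k) \<in> GR (N - ?L)"
    by (intro R.G_diff)
  then have gB: "g k * B k k \<in> GR (N - ?L)" by (simp add: lessThan_Suc_atMost[symmetric])
  obtain z y where z: "B k k = fps_X ^ k * z" "z * y = 1" using B by blast
  have "y * (g k * B k k) = fps_X ^ k * g k * (z * y)" unfolding z(1) by (simp only: ac_simps)
  then have "fps_X ^ k * g k \<in> GR (N - ?L)" using R.G_mult_left[OF gB, of y] z(2) by simp
  then have "g k \<in> GR (N - ?L - k)" by (rule X_power_mult_mem_GR)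
  moreover have "?L + k \<le> k * k" by (cases k) simp_all
  then have "N - k * k \<le> N - ?L - k" by simp
  ultimately show ?case by (rule R.G_antimono)
qed

section \<open>Finite combinations of products of divided powers in the tensor square\<close>

definition tconst where "tconst r = TO.pt (omega_hat_const p r) \<one>\<^bsub>omega_hat p\<^esub>"
definition tensor_basis :: "nat \<times> nat \<Rightarrow> _" where
  "tensor_basis jk = TO.pt (Om.to (Poly_Mapping.single (fst jk) 1)) (Om.to (Poly_Mapping.single (snd jk) (1 :: 'w fps)))"

lemma tconst_hom: "tconst \<in> ring_hom ring_of_type_algebra TO.TR"
proof -
  have "tconst = (\<lambda>a. TO.pt a \<one>\<^bsub>omega_hat p\<^esub>) \<circ> omega_hat_const p" by (rule ext) (simp add: tconst_def)
  then show ?thesis using ring_hom_trans[OF omega_hat_const_hom TO.pt_left_hom] by simp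
qed

sublocale tconst: ring_hom_ring "ring_of_type_algebra :: 'w fps ring" TO.TR tconst
  using tconst_hom R.ring_axioms TO.TR.ring_axioms by (intro ring_hom_ringI2)

lemma tconst_simps:
  "tconst r \<in> carrier TO.TR" "tconst (r + s) = tconst r \<oplus>\<^bsub>TO.TR\<^esub> tconst s" "tconst (r * s) = tconst r \<otimes>\<^bsub>TO.TR\<^esub> tconst s"
  "tconst 0 = \<zero>\<^bsub>TO.TR\<^esub>"
  using tconst.hom_closed[of r] tconst.hom_add[of r s] tconst.hom_mult[of r s] tconst.hom_zero by simp_all

lemma to_closed [simp]: "Om.to (x :: nat \<Rightarrow>\<^sub>0 'w fps) \<in> carrier (omega_hat p)"
  using Om.toh.hom_closed[of x] by simp

lemma tensor_basis_closed: "tensor_basis jk \<in> carrier TO.TR"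
  by (simp add: tensor_basis_def)

lemma tconst_TJ: "tconst ` R_ideal p \<subseteq> TO.TJ"
proof -
  have TJ: "TO.CT.P 1 = TO.TJ" by (rule TO.TR.ideal_power_1[OF TO.CT.I_ideal])
  have "omega_hat_const p (of_nat p :: 'w fps) \<in> omega_hat_ideal p" "omega_hat_const p (fps_X :: 'w fps) \<in> omega_hat_ideal p"
    using const_generators_nhd omega_hat_nhd_1_subset by blast+
  then have "tconst (of_nat p) \<in> TO.CT.P 1" "tconst fps_X \<in> TO.CT.P 1"
    unfolding TJ using TO.pt_left_TJ by (auto simp: tconst_def)
  from R_ideal_imageI(1)[OF TO.CT.adic.filtered_ring_axioms tconst_hom this] show ?thesis unfolding TJ .
qed

lemma tconst_P: "tconst ` GR n \<subseteq> TO.CT.P n"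
proof -
  have "tconst ` R_ideal p \<subseteq> TO.CT.P 1"
    using tconst_TJ TO.TR.ideal_power_1[OF TO.CT.I_ideal] by (simp del: One_nat_def)
  from ring_hom_ideal_power_subset[OF R.is_cring TO.CT.adic.filtered_ring_axioms tconst_hom R_ideal_ideal this]
  show ?thesis unfolding R_ring_def .
qed

text \<open>All scalars are placed in the left factor, through its canonical structure. Different
  coefficient families are not claimed to give different elements; the coefficients are controlled
  only by evaluation.\<close>

definition lin_comb :: "(nat \<times> nat \<Rightarrow>\<^sub>0 'w fps) \<Rightarrow> _" where
  "lin_comb c = finsum TO.TR (\<lambda>jk. tconst (Poly_Mapping.lookup c jk) \<otimes>\<^bsub>TO.TR\<^esub> tensor_basis jk) (Poly_Mapping.keys c)"

lemma lin_comb_term_closed: "(\<lambda>jk. tconst (Poly_Mapping.lookup c jk) \<otimes>\<^bsub>TO.TR\<^esub> tensor_basis jk) \<in> S \<rightarrow> carrier TO.TR"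
  by (simp add: tconst_simps tensor_basis_closed)

lemma lin_comb_superset:
  assumes "finite S" "Poly_Mapping.keys c \<subseteq> S"
  shows "lin_comb c = finsum TO.TR (\<lambda>jk. tconst (Poly_Mapping.lookup c jk) \<otimes>\<^bsub>TO.TR\<^esub> tensor_basis jk) S"
  unfolding lin_comb_def
  by (rule TO.TR.add.finprod_mono_neutral_cong_left[OF assms _ _ lin_comb_term_closed])
    (simp_all add: in_keys_iff tconst_simps tensor_basis_closed)

lemma lin_comb_closed: "lin_comb c \<in> carrier TO.TR"
  unfolding lin_comb_def by (rule TO.TR.finsum_closed[OF lin_comb_term_closed])

lemma lin_comb_0: "lin_comb 0 = \<zero>\<^bsub>TO.TR\<^esub>"
  by (simp add: lin_comb_def)

lemma lin_comb_single: "lin_comb (Poly_Mapping.single jk r) = tconst r \<otimes>\<^bsub>TO.TR\<^esub> tensor_basis jk"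
  using lin_comb_superset[of "{jk}" "Poly_Mapping.single jk r"] by (simp add: tconst_simps tensor_basis_closed)

lemma lin_comb_add: "lin_comb (c + d) = lin_comb c \<oplus>\<^bsub>TO.TR\<^esub> lin_comb d"
proof -
  let ?S = "Poly_Mapping.keys c \<union> Poly_Mapping.keys d"
  let ?t = "\<lambda>c jk. tconst (Poly_Mapping.lookup c jk) \<otimes>\<^bsub>TO.TR\<^esub> tensor_basis jk"
  have "lin_comb (c + d) = finsum TO.TR (?t (c + d)) ?S"
    by (rule lin_comb_superset) (use keys_add[of c d] in auto)
  also have "\<dots> = finsum TO.TR (\<lambda>jk. ?t c jk \<oplus>\<^bsub>TO.TR\<^esub> ?t d jk) ?S"
    by (simp add: lookup_add tconst_simps TO.TR.l_distr tensor_basis_closed)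
  also have "\<dots> = finsum TO.TR (?t c) ?S \<oplus>\<^bsub>TO.TR\<^esub> finsum TO.TR (?t d) ?S"
    by (rule TO.TR.finsum_addf[OF lin_comb_term_closed lin_comb_term_closed])
  also have "\<dots> = lin_comb c \<oplus>\<^bsub>TO.TR\<^esub> lin_comb d"
    using lin_comb_superset[of ?S c] lin_comb_superset[of ?S d] by simp
  finally show ?thesis .
qed

lemma lin_comb_uminus: "lin_comb (- c) = \<ominus>\<^bsub>TO.TR\<^esub> lin_comb c"
  by (rule TO.TR.minus_equality[symmetric]) (simp_all add: lin_comb_closed lin_comb_add[symmetric] lin_comb_0)

lemma lin_comb_smult: "\<exists>d. lin_comb d = tconst r \<otimes>\<^bsub>TO.TR\<^esub> lin_comb c \<and> (\<forall>jk. Poly_Mapping.lookup d jk = r * Poly_Mapping.lookup c jk)"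
proof (induction c rule: poly_mapping_add_induct)
  case zero
  show ?case by (rule exI[of _ 0]) (simp add: lin_comb_0 tconst_simps)
next
  case (single jk s)
  show ?case
    by (rule exI[of _ "Poly_Mapping.single jk (r * s)"])
      (simp add: lin_comb_single tconst_simps TO.TR.m_assoc tensor_basis_closed lookup_single when_def)
next
  case (add x y)
  then obtain d e where "lin_comb d = tconst r \<otimes>\<^bsub>TO.TR\<^esub> lin_comb x" "\<forall>jk. Poly_Mapping.lookup d jk = r * Poly_Mapping.lookup x jk"
    "lin_comb e = tconst r \<otimes>\<^bsub>TO.TR\<^esub> lin_comb y" "\<forall>jk. Poly_Mapping.lookup e jk = r * Poly_Mapping.lookup y jk" by blast
  then show ?case
    by (intro exI[of _ "d + e"]) (simp add: lin_comb_add tconst_simps TO.TR.r_distr lin_comb_closed lookup_add distrib_left)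
qed

lemma lin_comb_mem_P:
  assumes "\<And>jk. Poly_Mapping.lookup c jk \<in> GR n" shows "lin_comb c \<in> TO.CT.P n"
proof -
  have "finsum TO.TR (\<lambda>jk. tconst (Poly_Mapping.lookup c jk) \<otimes>\<^bsub>TO.TR\<^esub> tensor_basis jk) S \<in> TO.CT.P n" if "finite S" for S
    using that
  proof (induction S)
    case empty
    then show ?case by (simp add: TO.CT.adic.filtration_zero)
  next
    case (insert jk S)
    have "tconst (Poly_Mapping.lookup c jk) \<otimes>\<^bsub>TO.TR\<^esub> tensor_basis jk \<in> TO.CT.P n"
      by (rule TO.CT.adic.filtration_mult_right[OF subsetD[OF tconst_P imageI[OF assms]] tensor_basis_closed])
    then show ?case
      using insert TO.CT.adic.filtration_add lin_comb_term_closed[of c S] tconst_simps(1) tensor_basis_closed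
      by (simp add: TO.TR.finsum_insert)
  qed
  then show ?thesis unfolding lin_comb_def by simp
qed

lemma ev_tconst: "ev m l (tconst r) = r"
  using hat_eval_const[of l 1]
  by (simp add: tconst_def ev_pt omega_hat_const_simps hat_eval_const psi_simps)

lemma ev_lin:
  "ev m l (lin_comb c) = (\<Sum>jk\<in>Poly_Mapping.keys c. Poly_Mapping.lookup c jk * (bas (fst jk) m * psi m (bas (snd jk) l)))"
proof -
  let ?s = "\<lambda>c S. \<Sum>jk\<in>S. Poly_Mapping.lookup c jk * (bas (fst jk) m * psi m (bas (snd jk) l))"
  have sup: "?s c (Poly_Mapping.keys c) = ?s c S" if "finite S" "Poly_Mapping.keys c \<subseteq> S" for c S
    by (rule sum.mono_neutral_left) (use that in \<open>auto simp: in_keys_iff\<close>)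
  interpret e: ring_hom_ring TO.TR "ring_of_type_algebra :: 'w fps ring" "ev m l"
    using ev_hom TO.TR.ring_axioms R.ring_axioms by (intro ring_hom_ringI2)
  have e_W: "ev m l (tensor_basis jk) = bas (fst jk) m * psi m (bas (snd jk) l)" for jk
    by (simp add: tensor_basis_def ev_pt hat_eval omega_eval_single[of _ 1, simplified])
  show ?thesis
  proof (induction c rule: poly_mapping_add_induct)
    case zero
    show ?case using e.hom_zero by (simp add: lin_comb_0)
  next
    case (single jk r)
    show ?case
      using e.hom_mult[OF tconst_simps(1) tensor_basis_closed, of r jk] sup[of "{jk}" "Poly_Mapping.single jk r"]
      by (simp add: lin_comb_single ev_tconst e_W)
  next
    case (add x y)
    let ?S = "Poly_Mapping.keys x \<union> Poly_Mapping.keys y"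
    have "?s (x + y) (Poly_Mapping.keys (x + y)) = ?s (x + y) ?S"
      by (rule sup) (use keys_add[of x y] in auto)
    also have "\<dots> = ?s x (Poly_Mapping.keys x) + ?s y (Poly_Mapping.keys y)"
      using sup[of ?S x] sup[of ?S y] by (simp add: lookup_add distrib_right sum.distrib)
    finally show ?case
      using e.hom_add[OF lin_comb_closed lin_comb_closed, of x y] add by (simp add: lin_comb_add)
  qed
qed

text \<open>Two triangular systems in succession: for fixed m the values in l determine the partial
  sums \<open>H m k\<close> with loss k * k, and then the values in m determine the coefficients
  with a further loss j * j.\<close>

lemma lin_comb_coefficients_mem_GR:
  assumes "\<And>m l. ev m l (lin_comb c) \<in> GR N"
  shows "Poly_Mapping.lookup c (j, k) \<in> GR (N - k * k - j * j)"
proof -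
  let ?c = "\<lambda>j k. Poly_Mapping.lookup c (j, k)"
  define H where "H m k = (\<Sum>j\<le>m. ?c j k * bas j m)" for m k
  have ev: "ev m l (lin_comb c) = (\<Sum>k\<le>l. H m k * psi m (bas k l))" for m l
  proof -
    let ?f = "\<lambda>jk. Poly_Mapping.lookup c jk * (bas (fst jk) m * psi m (bas (snd jk) l))"
    let ?S = "Poly_Mapping.keys c \<union> {..m} \<times> {..l}"
    have "ev m l (lin_comb c) = sum ?f ?S"
      unfolding ev_lin by (rule sum.mono_neutral_left) (auto simp: in_keys_iff)
    also have "\<dots> = sum ?f ({..m} \<times> {..l})"
    proof (rule sum.mono_neutral_right)
      show "\<forall>jk\<in>?S - {..m} \<times> {..l}. ?f jk = 0"
      proof
        fix jk assume "jk \<in> ?S - {..m} \<times> {..l}"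
        then have "m < fst jk \<or> l < snd jk" by (cases jk) auto
        then show "?f jk = 0" by (auto simp: bas_eq_0 psi_0)
      qed
    qed auto
    also have "\<dots> = (\<Sum>j\<le>m. \<Sum>k\<le>l. ?c j k * (bas j m * psi m (bas k l)))"
      by (simp add: sum.cartesian_product case_prod_unfold)
    also have "\<dots> = (\<Sum>k\<le>l. \<Sum>j\<le>m. ?c j k * (bas j m * psi m (bas k l)))"
      by (rule sum.swap)
    also have "\<dots> = (\<Sum>k\<le>l. H m k * psi m (bas k l))"
      by (simp add: H_def sum_distrib_right mult.assoc)
    finally show ?thesis .
  qed
  have "H m k \<in> GR (N - k * k)" for m k
    by (rule triangular_mem_GR[of "H m" "\<lambda>k l. psi m (bas k l)"]) (use assms ev psi_bas_self_unit in simp_all)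
  then show ?thesis
    by (intro triangular_mem_GR[of "\<lambda>j. ?c j k" bas]) (use bas_self_unit in \<open>simp_all add: H_def\<close>)
qed

text \<open>Both entries of a pure tensor are approximated by finite combinations of divided powers.
  Scalars in the left entry can be pulled out at once; those in the right entry first have to cross
  the tensor sign.\<close>

lemma lin_comb_dense:
  assumes t: "t \<in> carrier TO.TR"
  shows "\<exists>c. t \<ominus>\<^bsub>TO.TR\<^esub> lin_comb c \<in> TO.CT.P N"
proof -
  let ?Q = "\<lambda>t. \<exists>c. t \<ominus>\<^bsub>TO.TR\<^esub> lin_comb c \<in> TO.CT.P N"
  note cl = TO.TR.m_closed TO.TR.a_closed lin_comb_closed
  have Q_lin: "?Q (lin_comb c)" for c
    using TO.CT.adic.filtration_cong_refl[OF lin_comb_closed] by blast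
  have Q_add: "?Q (s \<oplus>\<^bsub>TO.TR\<^esub> t)" if "s \<in> carrier TO.TR" "t \<in> carrier TO.TR" and Q: "?Q s" "?Q t" for s t
  proof -
    obtain c d where "s \<ominus>\<^bsub>TO.TR\<^esub> lin_comb c \<in> TO.CT.P N" "t \<ominus>\<^bsub>TO.TR\<^esub> lin_comb d \<in> TO.CT.P N" using Q by blast
    from TO.CT.adic.filtration_cong_add[OF that(1,2) lin_comb_closed lin_comb_closed this]
    show ?thesis unfolding lin_comb_add[symmetric] by blast
  qed
  have Q_uminus: "?Q (\<ominus>\<^bsub>TO.TR\<^esub> t)" if t: "t \<in> carrier TO.TR" and Q: "?Q t" for t
  proof -
    obtain c where "t \<ominus>\<^bsub>TO.TR\<^esub> lin_comb c \<in> TO.CT.P N" using Q by blast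
    from TO.CT.adic.filtration_cong_uminus[OF t lin_comb_closed this]
    show ?thesis unfolding lin_comb_uminus[symmetric] by blast
  qed
  have Q_cong: "?Q s" if "s \<in> carrier TO.TR" "t \<in> carrier TO.TR" "s \<ominus>\<^bsub>TO.TR\<^esub> t \<in> TO.CT.P N" and Q: "?Q t" for s t
  proof -
    obtain c where "t \<ominus>\<^bsub>TO.TR\<^esub> lin_comb c \<in> TO.CT.P N" using Q by blast
    from TO.CT.adic.filtration_cong_trans[OF that(1,2) lin_comb_closed that(3) this]
    show ?thesis by blast
  qed
  have left: "TO.pt a \<one>\<^bsub>omega_hat p\<^esub> \<in> TO.CT.P N" and right: "TO.pt \<one>\<^bsub>omega_hat p\<^esub> a \<in> TO.CT.P N"
    if "a \<in> omega_hat_nhd p N" for a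
  proof -
    have P1: "TO.CT.P 1 = TO.TJ" by (rule TO.TR.ideal_power_1[OF TO.CT.I_ideal])
    have a: "a \<in> ideal_power (omega_hat p) (omega_hat_ideal p) N" using that omega_hat_nhd_subset by blast
    show "TO.pt a \<one>\<^bsub>omega_hat p\<^esub> \<in> TO.CT.P N"
      using ring_hom_ideal_power_subset[OF Om.hat.is_cring TO.CT.adic.filtered_ring_axioms TO.pt_left_hom omega_hat_ideal_ideal, of N]
        TO.pt_left_TJ a unfolding P1 by blast
    show "TO.pt \<one>\<^bsub>omega_hat p\<^esub> a \<in> TO.CT.P N"
      using ring_hom_ideal_power_subset[OF Om.hat.is_cring TO.CT.adic.filtered_ring_axioms TO.pt_right_hom omega_hat_ideal_ideal, of N]
        TO.pt_right_TJ a unfolding P1 by blast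
  qed
  interpret lh: ring_hom_ring "omega_hat p" TO.TR "\<lambda>a. TO.pt a \<one>\<^bsub>omega_hat p\<^esub>"
    using TO.pt_left_hom Om.hat.ring_axioms TO.TR.ring_axioms by (intro ring_hom_ringI2)
  interpret rh: ring_hom_ring "omega_hat p" TO.TR "TO.pt \<one>\<^bsub>omega_hat p\<^esub>"
    using TO.pt_right_hom Om.hat.ring_axioms TO.TR.ring_axioms by (intro ring_hom_ringI2)
  have pt_cong: "TO.pt a b \<ominus>\<^bsub>TO.TR\<^esub> TO.pt a' b' \<in> TO.CT.P N"
    if c: "a \<in> carrier (omega_hat p)" "a' \<in> carrier (omega_hat p)" "b \<in> carrier (omega_hat p)" "b' \<in> carrier (omega_hat p)"
      and n: "a \<ominus>\<^bsub>omega_hat p\<^esub> a' \<in> omega_hat_nhd p N" "b \<ominus>\<^bsub>omega_hat p\<^esub> b' \<in> omega_hat_nhd p N" for a a' b b'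
  proof -
    have "TO.pt a \<one>\<^bsub>omega_hat p\<^esub> \<ominus>\<^bsub>TO.TR\<^esub> TO.pt a' \<one>\<^bsub>omega_hat p\<^esub> \<in> TO.CT.P N"
      "TO.pt \<one>\<^bsub>omega_hat p\<^esub> b \<ominus>\<^bsub>TO.TR\<^esub> TO.pt \<one>\<^bsub>omega_hat p\<^esub> b' \<in> TO.CT.P N"
      using left[OF n(1)] right[OF n(2)] lh.hom_minus[OF c(1,2)] rh.hom_minus[OF c(3,4)] by simp_all
    from TO.CT.adic.filtration_cong_mult[OF _ _ _ _ this]
    show ?thesis unfolding TO.pt_eq_mult[OF c(1,3)] TO.pt_eq_mult[OF c(2,4)] using c by simp
  qed
  have refl: "a \<ominus>\<^bsub>omega_hat p\<^esub> a \<in> omega_hat_nhd p N" if "a \<in> carrier (omega_hat p)"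
    for a :: "nat \<Rightarrow> (nat \<Rightarrow>\<^sub>0 'w fps) set"
    by (rule Om.hatf.filtration_cong_refl[OF that])
  have to_single: "Om.to (Poly_Mapping.single k r) = omega_hat_const p r \<otimes>\<^bsub>omega_hat p\<^esub> Om.to (Poly_Mapping.single k 1)"
    for k and r :: "'w fps"
  proof -
    have "Poly_Mapping.single 0 r \<otimes>\<^bsub>omega_ring p\<^esub> Poly_Mapping.single k 1 = Poly_Mapping.single k r"
      by (simp add: omega_eval_inject[symmetric] fun_eq_iff omega_eval_mult omega_eval_single)
    then show ?thesis
      using Om.toh.hom_mult[of "Poly_Mapping.single 0 r" "Poly_Mapping.single k 1"] by (simp add: omega_hat_const_eq)
  qed
  let ?to1 = "\<lambda>k. Om.to (Poly_Mapping.single k (1 :: 'w fps))"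
  have Q1: "?Q (TO.pt (Om.to y) (?to1 k))" for y k
  proof (induction y rule: poly_mapping_add_induct)
    case zero
    have "TO.pt (Om.to 0) (?to1 k) = \<zero>\<^bsub>TO.TR\<^esub>"
      using lh.hom_zero Om.toh.hom_zero TO.pt_eq_mult[of "Om.to 0" "?to1 k"] by simp
    then show ?case using Q_lin[of 0] by (simp add: lin_comb_0)
  next
    case (single j r)
    have "TO.pt (Om.to (Poly_Mapping.single j r)) (?to1 k) = lin_comb (Poly_Mapping.single (j, k) r)"
      unfolding to_single[of j r] lin_comb_single tconst_def tensor_basis_def
      using omega_hat_const_simps(1)[of r] by (simp add: TO.pt_mult)
    then show ?case using Q_lin by metis
  next
    case (add x y)
    have "TO.pt (Om.to (x + y)) (?to1 k) = TO.pt (Om.to x) (?to1 k) \<oplus>\<^bsub>TO.TR\<^esub> TO.pt (Om.to y) (?to1 k)"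
      using Om.toh.hom_add[of x y] by (simp add: TO.pt_add_left)
    then show ?case using Q_add[OF _ _ add] by simp
  qed
  have Q2: "?Q (TO.pt (Om.to x) (Om.to y))" for x y
  proof (induction y rule: poly_mapping_add_induct)
    case zero
    have "TO.pt (Om.to x) (Om.to 0) = \<zero>\<^bsub>TO.TR\<^esub>"
      using rh.hom_zero Om.toh.hom_zero TO.pt_eq_mult[of "Om.to x" "Om.to 0"] by simp
    then show ?case using Q_lin[of 0] by (simp add: lin_comb_0)
  next
    case (single k r)
    \<comment> \<open>Crossing to the left turns r into \<theta>(r), which lies in the completed
      algebra only and is therefore approximated once more, by z.\<close>
    have \<theta>: "taylor_omega p r \<in> carrier (omega_hat p)" using TO.f_closed[of r] by simp
    obtain z where z: "z \<in> carrier (omega_ring p)" "taylor_omega p r \<ominus>\<^bsub>omega_hat p\<^esub> Om.to z \<in> omega_hat_nhd p N"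
      by (rule Om.completion_dense[OF \<theta>, of N])
    let ?w = "x \<otimes>\<^bsub>omega_ring p\<^esub> z"
    have "Om.to x \<otimes>\<^bsub>omega_hat p\<^esub> taylor_omega p r \<ominus>\<^bsub>omega_hat p\<^esub> Om.to x \<otimes>\<^bsub>omega_hat p\<^esub> Om.to z \<in> omega_hat_nhd p N"
      using \<theta> by (intro Om.hatf.filtration_cong_mult z refl) simp_all
    then have d: "Om.to x \<otimes>\<^bsub>omega_hat p\<^esub> taylor_omega p r \<ominus>\<^bsub>omega_hat p\<^esub> Om.to ?w \<in> omega_hat_nhd p N"
      using Om.toh.hom_mult[of x z] by simp
    have "TO.pt (Om.to x) (Om.to (Poly_Mapping.single k r)) = TO.pt (Om.to x \<otimes>\<^bsub>omega_hat p\<^esub> taylor_omega p r) (?to1 k)"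
      unfolding to_single[of k r] by (rule TO.pt_balance[symmetric]) simp_all
    then show ?case
      using Q_cong[OF _ _ _ Q1[of ?w k]] pt_cong[OF _ _ _ _ d refl] \<theta> by simp
  next
    case (add y z)
    have "TO.pt (Om.to x) (Om.to (y + z)) = TO.pt (Om.to x) (Om.to y) \<oplus>\<^bsub>TO.TR\<^esub> TO.pt (Om.to x) (Om.to z)"
      using Om.toh.hom_add[of y z] by (simp add: TO.pt_add_right)
    then show ?case using Q_add[OF _ _ add] by simp
  qed
  show ?thesis
    using t
  proof (induction rule: TO.tensor_induct)
    case (pure a b)
    obtain x where x: "x \<in> carrier (omega_ring p)" "a \<ominus>\<^bsub>omega_hat p\<^esub> Om.to x \<in> omega_hat_nhd p N"
      by (rule Om.completion_dense[OF pure(1), of N])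
    obtain y where y: "y \<in> carrier (omega_ring p)" "b \<ominus>\<^bsub>omega_hat p\<^esub> Om.to y \<in> omega_hat_nhd p N"
      by (rule Om.completion_dense[OF pure(2), of N])
    show ?case using Q_cong[OF _ _ pt_cong[OF _ _ _ _ x(2) y(2)] Q2] pure by simp
  next
    case (diff s t)
    then show ?case using Q_add[OF _ _ _ Q_uminus] by (simp add: TO.TR.minus_eq)
  qed
qed

text \<open>The generator 1 \<otimes> (q - 1) is moved to the left factor, where its additional term
  (p)_q \<omega> is covered because (p)_q lies in the ideal of p and q - 1. With two generators the
  powers of the ideal can be split as in \<open>ideal_power_pair_Suc_mem\<close>.\<close>

lemma TJ_subset: "TO.TJ \<subseteq> genideal TO.TR {tconst (of_nat p), tconst fps_X}"
proof -
  let ?K = "genideal TO.TR {tconst (of_nat p), tconst fps_X}"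
  have gen: "{tconst (of_nat p), tconst fps_X} \<subseteq> carrier TO.TR" by (simp add: tconst_simps)
  have K: "ideal ?K TO.TR" by (rule TO.TR.genideal_ideal[OF gen])
  have gK: "tconst (of_nat p) \<in> ?K" "tconst fps_X \<in> ?K" using TO.TR.genideal_self[OF gen] by auto
  have R_ideal: "R_ideal p = genideal ring_of_type_algebra {of_nat p, fps_X :: 'w fps}"
    by (simp add: R_ideal_def R_ring_def q_minus_1)
  have tcK: "tconst ` R_ideal p \<subseteq> ?K"
    unfolding R_ideal
    by (rule ring_hom_genideal_subset[OF R.ring_axioms TO.TR.ring_axioms tconst_hom _ K]) (use gK in auto)
  have left: "(\<lambda>a. TO.pt a \<one>\<^bsub>omega_hat p\<^esub>) ` omega_hat_ideal p \<subseteq> ?K"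
    unfolding omega_hat_ideal_def
    by (rule ring_hom_genideal_subset[OF Om.hat.ring_axioms TO.TR.ring_axioms TO.pt_left_hom omega_hat_generators K])
      (use gK in \<open>auto simp: tconst_def q_minus_1\<close>)
  have c: "omega_hat_const p (r :: 'w fps) \<in> carrier (omega_hat p)" for r by (rule omega_hat_const_simps(1))
  have "taylor_omega p (of_nat p :: 'w fps) = omega_hat_const p (of_nat p)"
    using taylor_omega(2)[of "of_nat p"] by (simp add: fps_of_nat)
  then have 1: "TO.pt \<one>\<^bsub>omega_hat p\<^esub> (omega_hat_const p (of_nat p :: 'w fps)) \<in> ?K"
    using gK(1) unfolding TO_balance[symmetric] by (simp add: tconst_def)
  have "TO.pt (p_omega p) \<one>\<^bsub>omega_hat p\<^esub> = tconst D \<otimes>\<^bsub>TO.TR\<^esub> TO.pt (omega p) \<one>\<^bsub>omega_hat p\<^esub>"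
    using c[of D] by (simp add: p_omega_def tconst_def TO.pt_mult omega_def)
  moreover have "tconst D \<in> ?K" using tcK D_mem_GR unfolding GR_1 by blast
  ultimately have "TO.pt (p_omega p) \<one>\<^bsub>omega_hat p\<^esub> \<in> ?K"
    using ideal.I_r_closed[OF K] by (simp add: omega_def)
  then have "TO.pt (taylor_omega p (fps_X :: 'w fps)) \<one>\<^bsub>omega_hat p\<^esub> \<in> ?K"
    using gK(2) c[of fps_X] p_omega_carrier additive_subgroup.a_closed[OF ideal.axioms(1)[OF K]]
    by (simp add: taylor_omega TO.pt_add_left tconst_def)
  then have 2: "TO.pt \<one>\<^bsub>omega_hat p\<^esub> (omega_hat_const p (fps_X :: 'w fps)) \<in> ?K"
    unfolding TO_balance .
  have right: "TO.pt \<one>\<^bsub>omega_hat p\<^esub> ` omega_hat_ideal p \<subseteq> ?K"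
    unfolding omega_hat_ideal_def
    by (rule ring_hom_genideal_subset[OF Om.hat.ring_axioms TO.TR.ring_axioms TO.pt_right_hom omega_hat_generators K])
      (use 1 2 in \<open>auto simp: q_minus_1\<close>)
  show ?thesis
    unfolding tensor_adic_ideal_def
    by (rule TO.TR.genideal_minimal[OF K]) (use left right in blast)
qed

lemma TJ_eq: "TO.TJ = genideal TO.TR {tconst (of_nat p), tconst fps_X}"
proof
  show "genideal TO.TR {tconst (of_nat p), tconst fps_X} \<subseteq> TO.TJ"
    by (rule TO.TR.genideal_minimal[OF TO.CT.I_ideal]) (use tconst_TJ R_ideal_generators in auto)
qed (rule TJ_subset)

text \<open>Density with control of the coefficients: each factor p or q - 1 split off from an
  element of a power of the ideal is put into the coefficients of the approximation. In the
  injectivity proof it takes the place of freeness.\<close>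

lemma P_lin:
  assumes "t \<in> TO.CT.P n" "n \<le> N"
  shows "\<exists>d. (\<forall>jk. Poly_Mapping.lookup d jk \<in> GR n) \<and> t \<ominus>\<^bsub>TO.TR\<^esub> lin_comb d \<in> TO.CT.P N"
  using assms
proof (induction n arbitrary: t N)
  case 0
  then show ?case using lin_comb_dense[of t N] TO.CT.adic.filtration_carrier by auto
next
  case (Suc n)
  then obtain M where M: "N = Suc M" "n \<le> M" by (cases N) auto
  obtain s s' where s: "s \<in> TO.CT.P n" "s' \<in> TO.CT.P n"
    "t = tconst (of_nat p) \<otimes>\<^bsub>TO.TR\<^esub> s \<oplus>\<^bsub>TO.TR\<^esub> tconst fps_X \<otimes>\<^bsub>TO.TR\<^esub> s'"
    using TO.TR.ideal_power_pair_Suc_mem[of "tconst (of_nat p)" "tconst fps_X" t n] Suc.prems(1) tconst_simps(1)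
    unfolding TJ_eq by blast
  have mult: "\<exists>d. (\<forall>jk. Poly_Mapping.lookup d jk \<in> GR (Suc n)) \<and> tconst r \<otimes>\<^bsub>TO.TR\<^esub> s \<ominus>\<^bsub>TO.TR\<^esub> lin_comb d \<in> TO.CT.P N"
    if s: "s \<in> TO.CT.P n" and r: "r \<in> GR 1" for s r
  proof -
    obtain d where d: "\<And>jk. Poly_Mapping.lookup d jk \<in> GR n" "s \<ominus>\<^bsub>TO.TR\<^esub> lin_comb d \<in> TO.CT.P M"
      using Suc.IH[OF s M(2)] by blast
    obtain e where e: "lin_comb e = tconst r \<otimes>\<^bsub>TO.TR\<^esub> lin_comb d" "\<And>jk. Poly_Mapping.lookup e jk = r * Poly_Mapping.lookup d jk"
      using lin_comb_smult by blast
    have sc: "s \<in> carrier TO.TR" by (rule TO.CT.adic.filtration_carrier[OF s])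
    have "tconst r \<in> TO.CT.P 1" using tconst_P r by blast
    from TO.CT.adic.filtration_mult[OF this d(2)]
    have "tconst r \<otimes>\<^bsub>TO.TR\<^esub> (s \<ominus>\<^bsub>TO.TR\<^esub> lin_comb d) \<in> TO.CT.P N" by (simp add: M)
    then have "tconst r \<otimes>\<^bsub>TO.TR\<^esub> s \<ominus>\<^bsub>TO.TR\<^esub> lin_comb e \<in> TO.CT.P N"
      using sc tconst_simps(1)[of r] lin_comb_closed[of d] unfolding e(1)
      by (simp add: TO.TR.minus_eq TO.TR.r_distr TO.TR.r_minus)
    moreover have "Poly_Mapping.lookup e jk \<in> GR (Suc n)" for jk
      using R.G_mult[OF r d(1)] by (simp add: e(2))
    ultimately show ?thesis by blast
  qed
  have "of_nat p \<in> GR 1" "fps_X \<in> GR 1" using R_ideal_generators unfolding GR_1 by auto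
  then obtain d d' where d: "\<And>jk. Poly_Mapping.lookup d jk \<in> GR (Suc n)" "tconst (of_nat p) \<otimes>\<^bsub>TO.TR\<^esub> s \<ominus>\<^bsub>TO.TR\<^esub> lin_comb d \<in> TO.CT.P N"
    "\<And>jk. Poly_Mapping.lookup d' jk \<in> GR (Suc n)" "tconst fps_X \<otimes>\<^bsub>TO.TR\<^esub> s' \<ominus>\<^bsub>TO.TR\<^esub> lin_comb d' \<in> TO.CT.P N"
    using mult s(1,2) by metis
  have "t \<ominus>\<^bsub>TO.TR\<^esub> lin_comb (d + d') \<in> TO.CT.P N"
    unfolding s(3) lin_comb_add using s(1,2) TO.CT.adic.filtration_carrier tconst_simps(1)
    by (intro TO.CT.adic.filtration_cong_add d lin_comb_closed) auto
  moreover have "Poly_Mapping.lookup (d + d') jk \<in> GR (Suc n)" for jk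
    using d R.G_add by (simp add: lookup_add)
  ultimately show ?case by blast
qed

text \<open>An approximation of x at level n is compared with one at a higher level N. The
  difference has coefficients in \<open>GR n\<close> up to level N, and the finer combination has
  all its values in \<open>GR N\<close>, so its coefficients are small; hence the coefficients of
  the coarse approximation lie in \<open>GR n\<close>.\<close>

lemma Ev_inject_0:
  assumes x: "x \<in> carrier (omega2_ring p)" and zero: "\<And>m l. Ev m l x = 0"
  shows "x = \<zero>\<^bsub>omega2_ring p\<^esub>"
proof (rule TO.CT.hatf.filtration_separated[OF x])
  fix n
  obtain t0 where t0: "t0 \<in> carrier TO.TR" "t0 \<in> x n" "x \<ominus>\<^bsub>omega2_ring p\<^esub> TO.CT.to t0 \<in> omega2_nhd p n"
    by (rule TO.CT.completion_dense[OF x, of n])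
  obtain c where c: "t0 \<ominus>\<^bsub>TO.TR\<^esub> lin_comb c \<in> TO.CT.P n" using lin_comb_dense[OF t0(1)] by blast
  have "Poly_Mapping.lookup c (j, k) \<in> GR n" for j k
  proof -
    \<comment> \<open>The surplus compensates exactly the loss in
      \<open>lin_comb_coefficients_mem_GR\<close> for the coefficient at (j, k); the finer
      approximation is chosen anew for each coefficient.\<close>
    define N where "N = n + k * k + j * j"
    obtain t where t: "t \<in> carrier TO.TR" "t \<in> x N" "x \<ominus>\<^bsub>omega2_ring p\<^esub> TO.CT.to t \<in> omega2_nhd p N"
      by (rule TO.CT.completion_dense[OF x, of N])
    have "x \<ominus>\<^bsub>omega2_ring p\<^esub> TO.CT.to t \<in> omega2_nhd p n"
      using t(3) TO.CT.hatf.filtration_antimono[of n N] by (auto simp: N_def)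
    then have "TO.CT.to t \<ominus>\<^bsub>omega2_ring p\<^esub> TO.CT.to t0 \<in> omega2_nhd p n"
      using TO.CT.hatf.filtration_cong_trans[OF _ x _ TO.CT.hatf.filtration_cong_sym[OF x] t0(3)] t(1) t0(1) by simp
    then have "TO.CT.to (t \<ominus>\<^bsub>TO.TR\<^esub> t0) \<in> omega2_nhd p n"
      using t(1) t0(1) by (simp add: TO.CT.toh.hom_minus)
    then have "t \<ominus>\<^bsub>TO.TR\<^esub> t0 \<in> TO.CT.P n"
      using t(1) t0(1) by (simp add: TO.CT.to_nhd_iff)
    then have tlin: "t \<ominus>\<^bsub>TO.TR\<^esub> lin_comb c \<in> TO.CT.P n"
      using TO.CT.adic.filtration_cong_trans[OF t(1) t0(1) lin_comb_closed _ c] by blast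
    have nN: "n \<le> N" by (simp add: N_def)
    \<comment> \<open>Passing from level n to level N changes the combination only by
      \<open>d\<close>, whose coefficients are in \<open>GR n\<close>; statements about c + d
      therefore transfer to c.\<close>
    obtain d where d: "\<And>jk. Poly_Mapping.lookup d jk \<in> GR n"
      "(t \<ominus>\<^bsub>TO.TR\<^esub> lin_comb c) \<ominus>\<^bsub>TO.TR\<^esub> lin_comb d \<in> TO.CT.P N"
      using P_lin[OF tlin nN] by blast
    have "(t \<ominus>\<^bsub>TO.TR\<^esub> lin_comb c) \<ominus>\<^bsub>TO.TR\<^esub> lin_comb d = t \<ominus>\<^bsub>TO.TR\<^esub> lin_comb (c + d)"
      unfolding lin_comb_add using t(1) lin_comb_closed[of c] lin_comb_closed[of d] by algebra
    then have td: "t \<ominus>\<^bsub>TO.TR\<^esub> lin_comb (c + d) \<in> TO.CT.P N" using d(2) by simp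
    have "ev m l (lin_comb (c + d)) \<in> GR N" for m l
    proof -
      interpret e: ring_hom_ring TO.TR "ring_of_type_algebra :: 'w fps ring" "ev m l"
        using ev_hom TO.TR.ring_axioms R.ring_axioms by (intro ring_hom_ringI2)
      have "ev m l (t \<ominus>\<^bsub>TO.TR\<^esub> lin_comb (c + d)) \<in> GR N" using td ev_P by blast
      then have 1: "ev m l t - ev m l (lin_comb (c + d)) \<in> GR N"
        using e.hom_minus[OF t(1) lin_comb_closed] by simp
      have "Ev m l x - ev m l t \<in> GR N" by (rule Ev_mem[OF x t(2)])
      then have "ev m l t \<in> GR N" using R.G_uminus zero by fastforce
      then show ?thesis using R.G_diff[OF _ 1] by fastforce
    qed
    from lin_comb_coefficients_mem_GR[OF this, of j k]
    have "Poly_Mapping.lookup (c + d) (j, k) \<in> GR n" by (simp add: N_def)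
    then show ?thesis using R.G_diff[OF _ d(1)[of "(j, k)"]] by (fastforce simp: lookup_add)
  qed
  then have "lin_comb c \<in> TO.CT.P n" by (intro lin_comb_mem_P) auto
  then have "t0 \<in> TO.CT.P n" using TO.CT.adic.filtration_cong_mem[OF t0(1) lin_comb_closed c] by blast
  then have "TO.CT.to t0 \<in> omega2_nhd p n" using t0(1) by (simp add: TO.CT.to_nhd_iff)
  then show "x \<in> omega2_nhd p n"
    using TO.CT.hatf.filtration_cong_mem[OF x _ t0(3)] t0(1) by simp
qed

lemma Ev_inject:
  assumes "x \<in> carrier (omega2_ring p)" "y \<in> carrier (omega2_ring p)" "\<And>m l. Ev m l x = Ev m l y"
  shows "x = y"
proof -
  have "Ev m l (x \<ominus>\<^bsub>omega2_ring p\<^esub> y) = 0" for m l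
  proof -
    interpret E: ring_hom_ring "omega2_ring p" "ring_of_type_algebra :: 'w fps ring" "Ev m l"
      using Ev_hom TO.CT.hat.ring_axioms R.ring_axioms by (intro ring_hom_ringI2)
    show ?thesis using E.hom_minus[OF assms(1,2)] assms(3) by simp
  qed
  then have "x \<ominus>\<^bsub>omega2_ring p\<^esub> y = \<zero>\<^bsub>omega2_ring p\<^esub>" using assms(1,2) by (intro Ev_inject_0) simp_all
  then show ?thesis using assms(1,2) by simp
qed

section \<open>The comultiplication\<close>


sublocale ev: ring_hom_ring TO.TR "ring_of_type_algebra :: 'w fps ring" "ev m l" for m l
  using ev_hom TO.TR.ring_axioms R.ring_axioms by (intro ring_hom_ringI2)
sublocale Ev: ring_hom_ring "omega2_ring p" "ring_of_type_algebra :: 'w fps ring" "Ev m l" for m l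
  using Ev_hom TO.CT.hat.ring_axioms R.ring_axioms by (intro ring_hom_ringI2)

text \<open>The composition of \<open>q \<mapsto> q\<^bsup>p m + 1\<^esup>\<close> and \<open>q \<mapsto> q\<^bsup>p l + 1\<^esup>\<close> is \<open>q \<mapsto> q\<^bsup>p k + 1\<^esup>\<close> for this \<open>k\<close>.\<close>

abbreviation comp_index :: "nat \<Rightarrow> nat \<Rightarrow> nat" where "comp_index m l \<equiv> p * m * l + m + l"

lemma tensor_function_realized:
  "F \<in> tensor_functions psi \<Longrightarrow> \<exists>s\<in>carrier TO.TR. \<forall>m l. ev m l s = F m l"
proof (induction rule: tensor_functions.induct)
  case (pure a b)
  then obtain x y where "a = omega_eval x" "b = omega_eval y" by (auto simp: AF_def)
  then show ?case
    by (intro bexI[of _ "TO.pt (Om.to x) (Om.to y)"]) (simp_all add: ev_pt hat_eval)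
next
  case (add F G)
  then obtain s t where st: "s \<in> carrier TO.TR" "\<forall>m l. ev m l s = F m l"
    "t \<in> carrier TO.TR" "\<forall>m l. ev m l t = G m l" by blast
  then have "ev m l (s \<oplus>\<^bsub>TO.TR\<^esub> t) = F m l + G m l" for m l
    using ev.hom_add[of s t m l] by simp
  then show ?case using st by (intro bexI[of _ "s \<oplus>\<^bsub>TO.TR\<^esub> t"]) simp_all
qed

lemma comultiplication_realized:
  "\<exists>s\<in>carrier TO.TR. \<forall>m l. ev m l s = omega_eval x (comp_index m l)"
proof (induction x rule: poly_mapping_add_induct)
  case zero
  show ?case using ev.hom_zero by (intro bexI[of _ "\<zero>\<^bsub>TO.TR\<^esub>"]) simp_all
next
  case (single n r)
  have "(\<lambda>m l. bas n (comp_index m l)) \<in> tensor_functions psi"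
    by (rule bas_tensor_function) (rule psi_simps psi_q)+
  then obtain s where s: "s \<in> carrier TO.TR" "\<forall>m l. ev m l s = bas n (comp_index m l)"
    using tensor_function_realized by blast
  then have "ev m l (tconst r \<otimes>\<^bsub>TO.TR\<^esub> s) = r * bas n (comp_index m l)" for m l
    using ev.hom_mult[OF tconst_simps(1) s(1), of m l r] by (simp add: ev_tconst)
  then show ?case
    using s tconst_simps(1)[of r] by (intro bexI[of _ "tconst r \<otimes>\<^bsub>TO.TR\<^esub> s"]) (simp_all add: omega_eval_single)
next
  case (add x y)
  then obtain s t where st: "s \<in> carrier TO.TR" "\<forall>m l. ev m l s = omega_eval x (comp_index m l)"
    "t \<in> carrier TO.TR" "\<forall>m l. ev m l t = omega_eval y (comp_index m l)" by blast
  then have "ev m l (s \<oplus>\<^bsub>TO.TR\<^esub> t) = omega_eval (x + y) (comp_index m l)" for m l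
    using ev.hom_add[of s t m l] by (simp add: omega_eval_add)
  then show ?case using st by (intro bexI[of _ "s \<oplus>\<^bsub>TO.TR\<^esub> t"]) simp_all
qed

lemma Ev_const: "Ev m l (omega2_const p r) = r"
  using Ev_to[OF tconst_simps(1)[of r], of m l] ev_tconst by (simp add: omega2_const_def TO.cpt_eq tconst_def)

lemma Ev_tensor:
  "\<lbrakk>a \<in> carrier (omega_hat p); b \<in> carrier (omega_hat p)\<rbrakk>
    \<Longrightarrow> Ev m l (omega2_tensor p a b) = hat_eval m a * psi m (hat_eval l b)"
  by (simp add: TO.cpt_eq Ev_to ev_pt)

lemma omega2_const_closed: "omega2_const p (r :: 'w fps) \<in> carrier (omega2_ring p)"
  using ring_hom_closed[OF omega2_const_hom] by simp

text \<open>Preimages are chosen element by element; as the evaluations are jointly injective ring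
  morphisms, both sides of every ring law coincide and the choice is a morphism.\<close>

lemma algebraic_comultiplication:
  obtains \<phi> where "\<phi> \<in> ring_hom (omega_ring p) (omega2_ring p :: 'w omega2 ring)"
    "\<And>x m l. Ev m l (\<phi> x) = omega_eval x (comp_index m l)"
    "\<And>r. \<phi> (Poly_Mapping.single 0 r) = omega2_const p r"
    "\<And>n. \<phi> ` Om.P n \<subseteq> omega2_nhd p n"
proof -
  have "\<forall>x. \<exists>t. t \<in> carrier (omega2_ring p) \<and> (\<forall>m l. Ev m l t = omega_eval x (comp_index m l))"
  proof
    fix x
    obtain s where s: "s \<in> carrier TO.TR" "\<forall>m l. ev m l s = omega_eval x (comp_index m l)"
      using comultiplication_realized[of x] by blast
    then show "\<exists>t. t \<in> carrier (omega2_ring p) \<and> (\<forall>m l. Ev m l t = omega_eval x (comp_index m l))"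
      by (intro exI[of _ "TO.CT.to s"]) (simp add: Ev_to)
  qed
  from choice[OF this] obtain \<phi> where
    "\<forall>x. \<phi> x \<in> carrier (omega2_ring p) \<and> (\<forall>m l. Ev m l (\<phi> x) = omega_eval x (comp_index m l))" ..
  then have \<phi>: "\<phi> x \<in> carrier (omega2_ring p)" "Ev m l (\<phi> x) = omega_eval x (comp_index m l)" for x m l
    by simp_all
  have Ev_mult: "Ev m l (s \<otimes>\<^bsub>omega2_ring p\<^esub> t) = Ev m l s * Ev m l t"
    and Ev_add: "Ev m l (s \<oplus>\<^bsub>omega2_ring p\<^esub> t) = Ev m l s + Ev m l t"
    if "s \<in> carrier (omega2_ring p)" "t \<in> carrier (omega2_ring p)" for s t m l
    using Ev.hom_mult[OF that] Ev.hom_add[OF that] by simp_all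
  have const: "\<phi> (Poly_Mapping.single 0 r) = omega2_const p r" for r
    by (rule Ev_inject) (simp_all add: \<phi> omega2_const_closed Ev_const omega_eval_single)
  have hom: "\<phi> \<in> ring_hom (omega_ring p) (omega2_ring p)"
  proof (rule ring_hom_memI)
    fix x y
    show "\<phi> (x \<otimes>\<^bsub>omega_ring p\<^esub> y) = \<phi> x \<otimes>\<^bsub>omega2_ring p\<^esub> \<phi> y"
      by (rule Ev_inject) (simp_all add: \<phi> Ev_mult omega_eval_mult)
    show "\<phi> (x \<oplus>\<^bsub>omega_ring p\<^esub> y) = \<phi> x \<oplus>\<^bsub>omega2_ring p\<^esub> \<phi> y"
      by (rule Ev_inject) (simp_all add: \<phi> Ev_add omega_eval_add)
  next
    show "\<phi> \<one>\<^bsub>omega_ring p\<^esub> = \<one>\<^bsub>omega2_ring p\<^esub>"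
      using const[of 1] ring_hom_one[OF omega2_const_hom] by simp
  qed (rule \<phi>)
  have "\<phi> ` omega_ideal p \<subseteq> omega2_nhd p 1"
    unfolding omega_ideal_def
  proof (rule ring_hom_genideal_subset[OF A.ring_axioms TO.CT.hat.ring_axioms hom _ TO.CT.nhd_ideal])
    show "\<phi> ` {Poly_Mapping.single 0 (of_nat p), Poly_Mapping.single 0 (q - 1)} \<subseteq> omega2_nhd p 1"
      unfolding image_insert image_empty const q_minus_1 using omega2_const_nhd by blast
  qed simp
  then have P: "\<phi> ` Om.P n \<subseteq> omega2_nhd p n" for n
    by (rule ring_hom_ideal_power_subset[OF A.is_cring TO.CT.hatf.filtered_ring_axioms hom Om.I_ideal])
  show ?thesis by (rule that[OF hom \<phi>(2) const P])
qed

section \<open>Compatibility with the comultiplication of R[[\<xi>]]\<close>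

lemma Delta_p_omega:
  "Rxi2_to_omega2 p (Delta_Rxi p (fps_X :: 'w fps fps)) =
    omega2_tensor p \<one>\<^bsub>omega_hat p\<^esub> (p_omega p) \<oplus>\<^bsub>omega2_ring p\<^esub> omega2_tensor p (p_omega p) \<one>\<^bsub>omega_hat p\<^esub>"
proof -
  have c: "Rxi2_tensor p (a :: 'w fps fps) b \<in> carrier (Rxi2_ring p)" for a b
    unfolding TX.cpt_eq by (intro TX.CT.toh.hom_closed TX.pt_closed) simp_all
  have "Rxi_to_omega p (1 :: 'w fps fps) = \<one>\<^bsub>omega_hat p\<^esub>" using ring_hom_one[OF Rxi_to_omega(1)] by simp
  then show ?thesis
    unfolding Delta_Rxi ring_hom_add[OF Rxi2_to_omega2(1) c c] by (simp add: Rxi2_to_omega2 Rxi_to_omega)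
qed

text \<open>At m the element \<xi> becomes q^(p m + 1) - q. Thus 1 \<otimes> \<xi> contributes q^((p
  m + 1) (p l + 1)) - q^(p m + 1), and the sum with \<xi> \<otimes> 1 telescopes.\<close>

lemma Ev_Delta_p_omega:
  "Ev m l (Rxi2_to_omega2 p (Delta_Rxi p fps_X)) = D * bas 1 (comp_index m l)"
proof -
  let ?e = "\<one>\<^bsub>omega_hat p\<^esub> :: nat \<Rightarrow> (nat \<Rightarrow>\<^sub>0 'w fps) set"
  have cl: "omega2_tensor p a b \<in> carrier (omega2_ring p)"
    if "a \<in> carrier (omega_hat p)" "b \<in> carrier (omega_hat p)" for a b :: "nat \<Rightarrow> (nat \<Rightarrow>\<^sub>0 'w fps) set"
    unfolding TO.cpt_eq using that by simp
  have h: "hat_eval m (p_omega p) = D * bas 1 m" "hat_eval m ?e = 1" for m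
    unfolding p_omega_eq hat_eval omega_eval_single using ring_hom_one[OF hat_eval(1)] by simp_all
  have pD: "psi m (D * bas 1 l) = q ^ (p * m + 1) * ((q ^ (p * m + 1)) ^ (p * l) - 1)"
  proof -
    have diff: "psi m (x - y) = psi m x - psi m y" for x y
      using psi_simps(1)[of m "x - y" y] by (simp add: algebra_simps)
    have "Q ^ l = q ^ (p * l)" by (simp add: power_mult)
    then show ?thesis unfolding D_bas_1 by (simp only: psi_simps(2,3) diff psi_power psi_q)
  qed
  have "Ev m l (Rxi2_to_omega2 p (Delta_Rxi p fps_X)) = psi m (D * bas 1 l) + D * bas 1 m"
    unfolding Delta_p_omega
    using Ev.hom_add[OF cl[of ?e "p_omega p"] cl[of "p_omega p" ?e], of m l] p_omega_carrier
    by (simp add: Ev_tensor h psi_simps)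
  also have "\<dots> = q ^ (p * m + 1) * ((q ^ (p * m + 1)) ^ (p * l) - 1) + q * (Q ^ m - 1)"
    unfolding pD unfolding D_bas_1 ..
  also have "\<dots> = q * (Q ^ comp_index m l - 1)"
  proof -
    have "q ^ (p * m + 1) * (q ^ (p * m + 1)) ^ (p * l) = q * Q ^ comp_index m l"
      unfolding power_mult[symmetric] power_Suc[symmetric] power_add[symmetric] by (simp add: algebra_simps)
    moreover have "q ^ (p * m + 1) = q * Q ^ m" by (simp add: power_mult)
    ultimately show ?thesis by (simp add: right_diff_distrib)
  qed
  finally show ?thesis unfolding D_bas_1 .
qed

text \<open>The multiplication table for \<omega> times the k-th divided power, solved for the term
  of index k + 1.\<close>

lemma bas_recursion:
  "gauss_integer Q (Suc k) * bas (Suc k) m = (bas 1 m - U * gauss_integer Q k) * bas k m"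
proof -
  have "(bas 1 m - U * gauss_integer Q k) * bas k m =
    U ^ Suc k * Q ^ (k * (k - 1) div 2) * ((gauss_integer Q m - gauss_integer Q k) * gauss_binomial Q m k)"
    unfolding bas_1 unfolding bas_def gauss_term_def right_diff_distrib[symmetric] power_Suc by (simp only: ac_simps)
  also have "\<dots> = gauss_integer Q (Suc k) * (U ^ Suc k * Q ^ (k * (k - 1) div 2 + k) * gauss_binomial Q m (Suc k))"
    unfolding gauss_binomial_absorb power_add by (simp only: ac_simps)
  also have "k * (k - 1) div 2 + k = Suc k * (Suc k - 1) div 2" using triangle_Suc[of k] by simp
  finally show ?thesis unfolding bas_def gauss_term_def by (rule sym)
qed

text \<open>Compatibility with \<open>R[[\<xi>]]\<close> determines the value on \<open>(p)\<^sub>q \<omega>\<close>; the recursion for the divided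
  powers and the regularity of \<open>(p)\<^sub>q (n)\<^bsub>q\<^sup>p\<^esub>\<close> determine the remaining ones.\<close>

lemma Ev_comultiplication:
  assumes \<Delta>: "\<Delta> \<in> ring_hom (omega_hat p) (omega2_ring p :: 'w omega2 ring)"
    and const: "\<And>r. \<Delta> (omega_hat_const p r) = omega2_const p r"
    and xi: "\<Delta> (p_omega p) = Rxi2_to_omega2 p (Delta_Rxi p fps_X)"
  shows "Ev m l (\<Delta> (Om.to x)) = omega_eval x (comp_index m l)"
proof -
  let ?E = "Ev m l \<circ> \<Delta>"
  let ?N = "comp_index m l"
  have E: "?E \<in> ring_hom (omega_hat p) ring_of_type_algebra" by (rule ring_hom_trans[OF \<Delta> Ev_hom])
  interpret E: ring_hom_ring "omega_hat p" "ring_of_type_algebra :: 'w fps ring" ?E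
    using E Om.hat.ring_axioms R.ring_axioms by (intro ring_hom_ringI2)
  have EA: "?E \<circ> Om.to \<in> ring_hom (omega_ring p) ring_of_type_algebra"
    by (rule ring_hom_trans[OF Om.to_completion_hom E])
  define e where "e x = ?E (Om.to x)" for x
  have e_mult: "e (x \<otimes>\<^bsub>omega_ring p\<^esub> y) = e x * e y" and e_add: "e (x + y) = e x + e y" for x y
    using ring_hom_mult[OF EA, of x y] ring_hom_add[OF EA, of x y] by (simp_all add: e_def)
  have e_const: "e (Poly_Mapping.single 0 r) = r" for r
    using Ev_const const[of r] by (simp add: e_def omega_hat_const_eq)
  have e_1: "e (Poly_Mapping.single 1 D) = D * bas 1 ?N"
    using Ev_Delta_p_omega xi by (simp add: e_def p_omega_eq)
  have single_mult: "Poly_Mapping.single 0 r \<otimes>\<^bsub>omega_ring p\<^esub> Poly_Mapping.single k s = Poly_Mapping.single k (r * s)" for r s :: "'w fps" and k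
    by (simp add: omega_eval_inject[symmetric] fun_eq_iff omega_eval_mult omega_eval_single mult.assoc)
  have e_bas: "e (Poly_Mapping.single k 1) = bas k ?N" for k
  proof (induction k)
    case 0
    then show ?case using e_const[of 1] by simp
  next
    case (Suc k)
    let ?g = "gauss_integer Q"
    have reg: "regular (D * ?g (Suc k))"
      by (intro regular_mult regular_D regular_gauss_integer p_pos) simp
    \<comment> \<open>The recursion is multiplied by (p)_q because \<omega> may occur only in the
      combination (p)_q \<omega>, where the value of \<open>\<Delta>\<close> is prescribed.\<close>
    have rec: "Poly_Mapping.single 0 (D * ?g (Suc k)) \<otimes>\<^bsub>omega_ring p\<^esub> Poly_Mapping.single (Suc k) 1 =
      (Poly_Mapping.single 1 D + Poly_Mapping.single 0 (- (D * (U * ?g k)))) \<otimes>\<^bsub>omega_ring p\<^esub> Poly_Mapping.single k 1"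
    proof (subst omega_eval_inject[symmetric], rule ext)
      fix M
      have "D * ?g (Suc k) * bas (Suc k) M = (D * bas 1 M + - (D * (U * ?g k))) * bas k M"
        unfolding mult.assoc[of D] bas_recursion by (simp add: algebra_simps)
      then show "omega_eval (Poly_Mapping.single 0 (D * ?g (Suc k)) \<otimes>\<^bsub>omega_ring p\<^esub> Poly_Mapping.single (Suc k) 1) M =
        omega_eval ((Poly_Mapping.single 1 D + Poly_Mapping.single 0 (- (D * (U * ?g k)))) \<otimes>\<^bsub>omega_ring p\<^esub> Poly_Mapping.single k 1) M"
        unfolding omega_eval_mult omega_eval_add omega_eval_single by simp
    qed
    have "D * ?g (Suc k) * e (Poly_Mapping.single (Suc k) 1) =
      (D * bas 1 ?N + - (D * (U * ?g k))) * bas k ?N"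
      using arg_cong[OF rec, of e] unfolding e_mult e_add e_const e_1 Suc .
    also have "\<dots> = D * ?g (Suc k) * bas (Suc k) ?N"
      unfolding mult.assoc[of D] bas_recursion by (simp add: algebra_simps)
    finally show ?case by (rule regular_cancel[OF reg])
  qed
  have "e x = omega_eval x ?N"
  proof (induction x rule: poly_mapping_add_induct)
    case zero
    show ?case using e_add[of 0 0] by simp
  next
    case (single k r)
    have "e (Poly_Mapping.single k r) = e (Poly_Mapping.single 0 r \<otimes>\<^bsub>omega_ring p\<^esub> Poly_Mapping.single k 1)"
      unfolding single_mult mult_1_right ..
    then show ?case by (simp only: e_mult e_const e_bas omega_eval_single)
  next
    case (add x y)
    then show ?case by (simp add: e_add omega_eval_add)
  qed
  then show ?thesis by (simp add: e_def)
qed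

lemma comultiplication_exists_unique:
  "\<exists>!\<Delta>. \<Delta> \<in> ring_hom (omega_hat p) (omega2_ring p)
    \<and> \<Delta> \<in> extensional (carrier (omega_hat p))
    \<and> (\<forall>r :: 'w fps. \<Delta> (omega_hat_const p r) = omega2_const p r)
    \<and> (\<forall>x :: 'w fps fps. \<Delta> (Rxi_to_omega p x) = Rxi2_to_omega2 p (Delta_Rxi p x))"
proof -
  obtain \<phi> where \<phi>: "\<phi> \<in> ring_hom (omega_ring p) (omega2_ring p :: 'w omega2 ring)"
    "\<And>x m l. Ev m l (\<phi> x) = omega_eval x (comp_index m l)"
    "\<And>r. \<phi> (Poly_Mapping.single 0 r) = omega2_const p r"
    "\<And>n. \<phi> ` Om.P n \<subseteq> omega2_nhd p n"
    by (rule algebraic_comultiplication) (rule that)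
  obtain \<Delta> where \<Delta>: "\<Delta> \<in> ring_hom (omega_hat p) (omega2_ring p)" "\<Delta> \<in> extensional (carrier (omega_hat p))"
    "\<And>a. a \<in> carrier (omega_ring p) \<Longrightarrow> \<Delta> (Om.to a) = \<phi> a" "\<And>n. \<Delta> ` omega_hat_nhd p n \<subseteq> omega2_nhd p n"
    by (rule Om.completion_hom_extend[OF TO.CT.hatf.complete_filtered_ring_axioms \<phi>(1,4)]) (rule that)
  have \<phi>c: "\<phi> x \<in> carrier (omega2_ring p)" for x using ring_hom_closed[OF \<phi>(1)] by simp
  have const: "\<Delta> (omega_hat_const p r) = omega2_const p r" for r
    using \<Delta>(3) \<phi>(3) by (simp add: omega_hat_const_eq)
  have R2c: "Rxi2_to_omega2 p (Delta_Rxi p (x :: 'w fps fps)) \<in> carrier (omega2_ring p)" for x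
    using ring_hom_closed[OF Delta_Rxi(1), of x] ring_hom_closed[OF Rxi2_to_omega2(1)] by simp
  have X: "\<Delta> (p_omega p) = Rxi2_to_omega2 p (Delta_Rxi p fps_X)"
    unfolding p_omega_eq using \<Delta>(3)
    by (intro Ev_inject) (simp_all add: R2c \<phi>c \<phi>(2) Ev_Delta_p_omega omega_eval_single)
  \<comment> \<open>Agreement on constants and on \<xi> suffices, as the image of \<xi> is
    topologically nilpotent.\<close>
  have "\<Delta> \<circ> Rxi_to_omega p = Rxi2_to_omega2 p \<circ> (Delta_Rxi p :: 'w fps fps \<Rightarrow> _)"
  proof (rule TO.CT.hatf.power_series_hom_unique)
    show "\<Delta> \<circ> Rxi_to_omega p \<in> ring_hom (ring_of_type_algebra :: 'w fps fps ring) (omega2_ring p)"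
      by (rule ring_hom_trans[OF Rxi_to_omega(1) \<Delta>(1)])
    show "Rxi2_to_omega2 p \<circ> Delta_Rxi p \<in> ring_hom (ring_of_type_algebra :: 'w fps fps ring) (omega2_ring p)"
      by (rule ring_hom_trans[OF Delta_Rxi(1) Rxi2_to_omega2(1)])
    show "(\<Delta> \<circ> Rxi_to_omega p) (fps_const r) = (Rxi2_to_omega2 p \<circ> Delta_Rxi p) (fps_const r)" for r :: "'w fps"
      using ring_hom_one[OF Rxi_to_omega(1)]
      by (simp add: Rxi_to_omega const Delta_Rxi Rxi2_to_omega2 omega2_const_def)
    show "(\<Delta> \<circ> Rxi_to_omega p) (fps_X :: 'w fps fps) = (Rxi2_to_omega2 p \<circ> Delta_Rxi p) fps_X"
      using X by (simp add: Rxi_to_omega)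
    show "(\<Delta> \<circ> Rxi_to_omega p) (fps_X :: 'w fps fps) \<in> omega2_nhd p 1"
      using \<Delta>(4)[of 1] p_omega_nhd by (auto simp: Rxi_to_omega simp del: One_nat_def)
  qed
  then have compat: "\<Delta> (Rxi_to_omega p x) = Rxi2_to_omega2 p (Delta_Rxi p x)" for x :: "'w fps fps"
    by (metis comp_apply)
  show ?thesis
  proof (rule ex1I[of _ \<Delta>])
    show "\<Delta> \<in> ring_hom (omega_hat p) (omega2_ring p)
      \<and> \<Delta> \<in> extensional (carrier (omega_hat p))
      \<and> (\<forall>r :: 'w fps. \<Delta> (omega_hat_const p r) = omega2_const p r)
      \<and> (\<forall>x :: 'w fps fps. \<Delta> (Rxi_to_omega p x) = Rxi2_to_omega2 p (Delta_Rxi p x))"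
      using \<Delta>(1,2) const compat by blast
  next
    fix \<Delta>' assume \<Delta>': "\<Delta>' \<in> ring_hom (omega_hat p) (omega2_ring p)
      \<and> \<Delta>' \<in> extensional (carrier (omega_hat p))
      \<and> (\<forall>r :: 'w fps. \<Delta>' (omega_hat_const p r) = omega2_const p r)
      \<and> (\<forall>x :: 'w fps fps. \<Delta>' (Rxi_to_omega p x) = Rxi2_to_omega2 p (Delta_Rxi p x))"
    then have hom': "\<Delta>' \<in> ring_hom (omega_hat p) (omega2_ring p)"
      and const': "\<And>r :: 'w fps. \<Delta>' (omega_hat_const p r) = omega2_const p r"
      and X': "\<Delta>' (p_omega p) = Rxi2_to_omega2 p (Delta_Rxi p (fps_X :: 'w fps fps))"
      using Rxi_to_omega(3) by metis+
    \<comment> \<open>Linearity over R places the images of p and q - 1 in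
      \<open>omega2_nhd p 1\<close>, hence powers of the ideal in the neighbourhoods; by
      \<open>omega_hat_nhd_subset\<close> these powers contain the neighbourhoods of the source, so
      \<open>\<Delta>'\<close> is continuous.\<close>
    have "\<Delta>' ` omega_hat_ideal p \<subseteq> omega2_nhd p 1"
      unfolding omega_hat_ideal_def
      by (rule ring_hom_genideal_subset[OF Om.hat.ring_axioms TO.CT.hat.ring_axioms hom' omega_hat_generators TO.CT.nhd_ideal])
        (use omega2_const_nhd in \<open>simp add: const' q_minus_1 del: One_nat_def\<close>)
    then have "\<Delta>' ` ideal_power (omega_hat p) (omega_hat_ideal p) n \<subseteq> omega2_nhd p n" for n
      by (rule ring_hom_ideal_power_subset[OF Om.hat.is_cring TO.CT.hatf.filtered_ring_axioms hom' omega_hat_ideal_ideal])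
    then have nhd': "\<Delta>' ` omega_hat_nhd p n \<subseteq> omega2_nhd p n" for n using omega_hat_nhd_subset by blast
    have to': "\<Delta>' (Om.to x) = \<Delta> (Om.to x)" for x
      using ring_hom_closed[OF hom', of "Om.to x"] ring_hom_closed[OF \<Delta>(1), of "Om.to x"]
      by (intro Ev_inject) (simp_all add: Ev_comultiplication[OF hom' const' X'] Ev_comultiplication[OF \<Delta>(1) const X])
    show "\<Delta>' = \<Delta>"
    proof (rule extensionalityI)
      show "\<Delta>' \<in> extensional (carrier (omega_hat p))" using \<Delta>' by blast
      show "\<Delta>' x = \<Delta> x" if "x \<in> carrier (omega_hat p)" for x
        by (rule Om.completion_hom_unique[OF TO.CT.hatf.complete_filtered_ring_axioms hom' \<Delta>(1) to' _ _ that])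
          (use nhd' \<Delta>(4) in blast)+
    qed (rule \<Delta>(2))
  qed
qed

end

theorem proposition4p11:
  fixes p :: nat
  assumes "Factorial_Ring.prime p"
    and "adically_complete (ring_of_type_algebra :: 'w::comm_ring_1 ring) (p_ideal p)"
  shows "\<exists>!\<Delta>. \<Delta> \<in> ring_hom (omega_hat p) (omega2_ring p)
    \<and> \<Delta> \<in> extensional (carrier (omega_hat p))
    \<and> (\<forall>r :: 'w fps. \<Delta> (omega_hat_const p r) = omega2_const p r)
    \<and> (\<forall>x :: 'w fps fps. \<Delta> (Rxi_to_omega p x) = Rxi2_to_omega2 p (Delta_Rxi p x))"
proof -
  interpret prismatic_base p "TYPE('w)"
    using assms by unfold_locales
  show ?thesis by (rule comultiplication_exists_unique)
qed

end
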